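(* Let $P$ be a probability measure on the space $\Omega$ of cookie environments satisfying either (SE), (ELL) and (ND), or (IID), (WEL) and (BD). Then there is some $R=R(P)\in\mathbb{Z}\cup\{-\infty,+\infty\}$ such that for every integer $k\ge 1$ the following hold: \begin{itemize} \item $X^{(k)}$ is a.s. recurrent if $k>|R|$; \item $X^{(k)}_n\to+\infty$ a.s. if $k\le |R|$ and $R>0$; \item $X^{(k)}_n\to-\infty$ a.s. if $k\le |R|$ and $R<0$. \end{itemize}
   Context: $\mathbb{N}=\{1,2,\dots\}$. The space of cookie environments is $\Omega=[0,1]^{\mathbb{Z}\times\mathbb{N}}$ with the Borel $\sigma$-algebra of the product topology. Given $\omega\in\Omega$ and $x\in\mathbb{Z}$, the excited random walk driven by $\omega$ started at $x$ is the nearest-neighbour process $X$ on $\mathbb{Z}$ with $X_0=x$ which, on the $i$-th visit to a site $y$, jumps (conditionally on its past) to $y+1$ with probability $\omega(y,i)$ and to $y-1$ with probability $1-\omega(y,i)$. Conditions on $P$: (IID): the stacks $(\omega(x,\cdot))_{x\in\mathbb{Z}}$ are i.i.d. under $P$. (SE): $(\omega(x,\cdot))_{x\in\mathbb{Z}}$ is stationary and ergodic under $P$ with respect to the shift on $\mathbb{Z}$. (ELL): $P$-a.s., $\omega(x,n)\in(0,1)$ for all $x\in\mathbb{Z},n\in\mathbb{N}$. (ND): $P$-a.s., $\sum_{i\ge1}\omega(x,i)=\infty$ and $\sum_{i\ge1}(1-\omega(x,i))=\infty$ for all $x\in\mathbb{Z}$. (WEL): for all $x\in\mathbb{Z}$,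 $P(\omega(x,n)>0\ \forall n)>0$ and $P(\omega(x,n)<1\ \forall n)>0$. (BD): there is a deterministic $M$ such that $P$-a.s. $\omega(x,n)=\frac12$ for all $x\in\mathbb{Z}$ and $n>M$. Leftover environments: sample $\omega_0=\omega$ from $P$. For $j\ge1$, conditionally on everything before, let $X^{(j)}$ be an excited random walk driven by $\omega_{j-1}$ started at $0$, and let $L^{(j)}(x)\in\{0,1,\dots\}\cup\{\infty\}$ be its total number of visits to $x$. If $X^{(j)}$ is transient ($L^{(j)}$ finite everywhere), the $j$-leftover environment is $\omega_j(x,n)=\omega_{j-1}(x,n+L^{(j)}(x))$; if $X^{(j)}$ is recurrent, $\omega_j(x,n)=\frac12$ for all $x,n$. A walk is recurrent if it visits every integer infinitely often. "A.s." refers to the annealed measure, i.e. averaging also over $\omega\sim P$. *)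

theory Defs
  imports "HOL-Probability.Probability"
begin

section \<open>Cookie environments\<close>

text \<open>
  Cookies are numbered from \<^term>\<open>0::nat\<close> instead of from 1: \<^term>\<open>\<omega> x i\<close> is the cookie used at
  visit number \<open>i + 1\<close> to the site \<open>x\<close>. The topology of the function type is the product topology,
  so \<open>env_space\<close> is the set of environments with the Borel sets of the product topology.
\<close>

type_synonym env = "int \<Rightarrow> nat \<Rightarrow> real"

definition env_space :: "env measure" where
  "env_space = restrict_space borel {\<omega>. \<forall>x i. \<omega> x i \<in> {0..1}}"

definition IID :: "env measure \<Rightarrow> bool" where
  "IID P \<longleftrightarrow> prob_space.indep_vars P (\<lambda>_. borel) (\<lambda>x \<omega>. \<omega> x) UNIV \<and>
     (\<forall>x y. distr P borel (\<lambda>\<omega>. \<omega> x) = distr P borel (\<lambda>\<omega>. \<omega> y))"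

definition env_shift :: "env \<Rightarrow> env" where
  "env_shift \<omega> = (\<lambda>x. \<omega> (x + 1))"

definition SE :: "env measure \<Rightarrow> bool" where
  "SE P \<longleftrightarrow> distr P P env_shift = P \<and>
     (\<forall>A\<in>sets P. env_shift -` A \<inter> space P = A \<longrightarrow> measure P A \<in> {0, 1})"

definition ELL :: "env measure \<Rightarrow> bool" where
  "ELL P \<longleftrightarrow> (AE \<omega> in P. \<forall>x i. \<omega> x i \<in> {0<..<1})"

definition ND :: "env measure \<Rightarrow> bool" where
  "ND P \<longleftrightarrow> (AE \<omega> in P. \<forall>x. (\<Sum>i. ennreal (\<omega> x i)) = \<infinity> \<and> (\<Sum>i. ennreal (1 - \<omega> x i)) = \<infinity>)"

definition WEL :: "env measure \<Rightarrow> bool" where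
  "WEL P \<longleftrightarrow> (\<forall>x. measure P {\<omega> \<in> space P. \<forall>i. \<omega> x i > 0} > 0 \<and>
                  measure P {\<omega> \<in> space P. \<forall>i. \<omega> x i < 1} > 0)"

text \<open>With cookies numbered from 0, the first \<open>m\<close> cookies have the indices \<open>i < m\<close>.\<close>

definition BD :: "env measure \<Rightarrow> bool" where
  "BD P \<longleftrightarrow> (\<exists>m::nat. AE \<omega> in P. \<forall>x. \<forall>i\<ge>m. \<omega> x i = 1/2)"


section \<open>Excited random walks\<close>

type_synonym path = "nat \<Rightarrow> int"

definition path_space :: "path measure" where
  "path_space = (\<Pi>\<^sub>M n\<in>UNIV. count_space UNIV)"

definition recurrent :: "path \<Rightarrow> bool" where
  "recurrent Y \<longleftrightarrow> (\<forall>x. infinite {n. Y n = x})"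

definition transient :: "path \<Rightarrow> bool" where
  "transient Y \<longleftrightarrow> (\<forall>x. finite {n. Y n = x})"

text \<open>
  The cookie found at time \<open>n\<close>: the number of earlier visits to the current site is the index, counted
  from 0, of the current visit.
\<close>

definition current_cookie :: "env \<Rightarrow> path \<Rightarrow> nat \<Rightarrow> real" where
  "current_cookie \<omega> Y n = \<omega> (Y n) (card {m. m < n \<and> Y m = Y n})"

text \<open>
  On the sample space \<open>M\<close>, the process \<open>Y\<close> is an excited random walk started at \<open>x\<close> in the random
  environment \<open>W\<close>, where the \<open>\<sigma>\<close>-algebra \<open>F n\<close> is the past up to time \<open>n\<close>.
\<close>

definition excited_walk ::
  "'a measure \<Rightarrow> (nat \<Rightarrow> 'a measure) \<Rightarrow> ('a \<Rightarrow> env) \<Rightarrow> ('a \<Rightarrow> path) \<Rightarrow> int \<Rightarrow> bool" where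
  "excited_walk M F W Y x \<longleftrightarrow>
     (AE z in M. Y z 0 = x) \<and>
     (\<forall>n. AE z in M. real_cond_exp M (F n) (indicator {z. Y z (Suc n) = Y z n + 1}) z
                       = current_cookie (W z) (Y z) n) \<and>
     (\<forall>n. AE z in M. real_cond_exp M (F n) (indicator {z. Y z (Suc n) = Y z n - 1}) z
                       = 1 - current_cookie (W z) (Y z) n)"


section \<open>Leftover environments\<close>

text \<open>
  The second alternative is the one for recurrent walks. Paths that are neither recurrent nor
  transient are not covered by the mathematical definition; they also get the second alternative.
\<close>

definition leftover :: "env \<Rightarrow> path \<Rightarrow> env" where
  "leftover \<omega> Y =
     (if transient Y then (\<lambda>x i. \<omega> x (i + card {n. Y n = x})) else (\<lambda>x i. 1/2))"

text \<open>
  A sample point consists of the initial environment and of the paths of all the walks; the walks are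
  numbered from 1, so the \<open>k\<close>-th one has index \<open>k - 1\<close> in the sequence.
\<close>

type_synonym sample = "env \<times> (nat \<Rightarrow> path)"

definition sample_space :: "sample measure" where
  "sample_space = env_space \<Otimes>\<^sub>M (\<Pi>\<^sub>M k\<in>UNIV. path_space)"

definition walk :: "nat \<Rightarrow> sample \<Rightarrow> path" where
  "walk k z = snd z (k - 1)"

primrec leftover_env :: "nat \<Rightarrow> sample \<Rightarrow> env" where
  "leftover_env 0 z = fst z"
| "leftover_env (Suc j) z = leftover (leftover_env j z) (walk (Suc j) z)"

text \<open>
  \<open>past k n\<close> is the \<open>\<sigma>\<close>-algebra generated by the initial environment, by the walks \<open>1, \<dots>, k - 1\<close>, and
  by the walk \<open>k\<close> up to time \<open>n\<close>; \<open>reveal\<close> hides everything else.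
\<close>

definition reveal :: "nat \<Rightarrow> nat \<Rightarrow> sample \<Rightarrow> sample" where
  "reveal k n z = (fst z, \<lambda>i m. if Suc i < k \<or> (Suc i = k \<and> m \<le> n) then walk (Suc i) z m else 0)"

definition past :: "nat \<Rightarrow> nat \<Rightarrow> sample measure" where
  "past k n = vimage_algebra (space sample_space) (reveal k n) sample_space"

text \<open>The annealed joint law of the initial environment and of all the walks.\<close>

definition annealed_law :: "env measure \<Rightarrow> sample measure \<Rightarrow> bool" where
  "annealed_law P M \<longleftrightarrow>
     prob_space M \<and> sets M = sets sample_space \<and> distr M env_space fst = P \<and>
     (\<forall>k\<ge>1. excited_walk M (past k) (leftover_env (k - 1)) (walk k) 0)"

definition extended_ints :: "ereal set" where
  "extended_ints = range (\<lambda>m::int. ereal (of_int m)) \<union> {-\<infinity>, \<infinity>}"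


section \<open>Existence of the annealed law\<close>

text \<open>
  The predicate \<open>annealed_law P\<close> is satisfiable for every \<open>P\<close> (lemma \<open>ex_annealed_law\<close>). The witness
  drives step number \<open>n\<close> of the walk \<open>j + 1\<close> by a uniform random variable with index \<open>(j, n)\<close>, these
  being independent of each other and of the initial environment.
\<close>

lemma env_shift_measurable: "env_shift \<in> env_space \<rightarrow>\<^sub>M env_space"
proof -
  have "env_shift \<in> borel \<rightarrow>\<^sub>M borel"
    unfolding env_shift_def
    by (intro borel_measurable_continuous_onI continuous_on_coordinatewise_then_product
        continuous_on_product_coordinates)
  then show ?thesis
    unfolding env_space_def
    by (intro measurable_restrict_space3) (auto simp: env_shift_def)
qed

lemma measurable_cookie [measurable]: "(\<lambda>\<omega>. \<omega> x i) \<in> borel_measurable env_space"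
proof -
  have "(\<lambda>\<omega>::env. \<omega> x i) \<in> borel_measurable borel"
    by (intro borel_measurable_continuous_onI continuous_on_product_then_coordinatewise[of UNIV "\<lambda>\<omega>. \<omega> x"]
       continuous_on_product_coordinates)
  then show ?thesis unfolding env_space_def by (rule measurable_restrict_space1)
qed

lemma space_env_space: "space env_space = {\<omega>. \<forall>x i. \<omega> x i \<in> {0..1}}"
  by (simp add: env_space_def space_restrict_space)

lemma measurable_env_spaceI:
  assumes "\<And>x i. (\<lambda>z. f z x i) \<in> borel_measurable N"
    and "\<And>z x i. z \<in> space N \<Longrightarrow> f z x i \<in> {0..1}"
  shows "f \<in> N \<rightarrow>\<^sub>M env_space"
  unfolding env_space_def
proof (rule measurable_restrict_space2)
  show "f \<in> space N \<rightarrow> {\<omega>. \<forall>x i. \<omega> x i \<in> {0..1}}" using assms(2) by auto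
  have 1: "(\<lambda>z. f z x) \<in> N \<rightarrow>\<^sub>M borel" for x
    by (rule measurable_coordinatewise_then_product) (rule assms(1))
  show "f \<in> N \<rightarrow>\<^sub>M borel"
    by (rule measurable_coordinatewise_then_product) (rule 1)
qed

lemma measurable_pathI:
  assumes "\<And>n. (\<lambda>z. f z n) \<in> N \<rightarrow>\<^sub>M count_space UNIV"
  shows "f \<in> N \<rightarrow>\<^sub>M path_space"
  unfolding path_space_def using assms
  by (intro measurable_PiM_single') (auto )

lemma measurable_path_coord [measurable]: "(\<lambda>Y. Y n) \<in> path_space \<rightarrow>\<^sub>M count_space UNIV"
  unfolding path_space_def by (rule measurable_component_singleton) simp

lemma space_path_space [simp]: "space path_space = UNIV"
  by (simp add: path_space_def space_PiM)

lemma measurable_current_cookie [measurable (raw)]: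
  assumes [measurable]: "f \<in> N \<rightarrow>\<^sub>M env_space" "g \<in> N \<rightarrow>\<^sub>M path_space"
  shows "(\<lambda>z. current_cookie (f z) (g z) n) \<in> borel_measurable N"
proof -
  have f: "(\<lambda>z. f z x i) \<in> borel_measurable N" for x i
    using measurable_compose[OF assms(1) measurable_cookie] .
  have g: "(\<lambda>z. g z m) \<in> N \<rightarrow>\<^sub>M count_space UNIV" for m
    using measurable_compose[OF assms(2) measurable_path_coord] .
  note [measurable] = f g
  have c: "(\<lambda>z. card {m. m < n \<and> g z m = g z n}) \<in> N \<rightarrow>\<^sub>M count_space UNIV"
  proof -
    have "card {m. m < n \<and> g z m = g z n} = (\<Sum>m<n. if g z m = g z n then 1 else 0)" for z
      by (simp add: sum.If_cases Int_def)
    then show ?thesis by simp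
  qed
  note [measurable] = c
  have 3: "(\<lambda>z. f z (g z n) i) \<in> borel_measurable N" for i
    by (rule measurable_compose_countable[where f="\<lambda>x z. f z x i", OF f g])
  show ?thesis unfolding current_cookie_def
    by (rule measurable_compose_countable[where f="\<lambda>i z. f z (g z n) i" and g="\<lambda>z. card {m. m < n \<and> g z m = g z n}", OF 3 c])
qed

lemma infinite_visits_iff: "infinite {n. (Y::path) n = x} \<longleftrightarrow> (\<forall>N. \<exists>n\<ge>N. Y n = x)"
  by (auto simp: infinite_nat_iff_unbounded_le)

lemma finite_visits_iff: "finite {n. (Y::path) n = x} \<longleftrightarrow> (\<exists>K. \<forall>n. n \<ge> K \<longrightarrow> Y n \<noteq> x)"
  using infinite_visits_iff[of Y x] by meson

lemma card_visits_iff: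
  assumes "finite {n. (Y::path) n = x}"
  shows "card {n. Y n = x} = l \<longleftrightarrow>
    (\<exists>N. (\<forall>n\<ge>N. Y n \<noteq> x) \<and> (\<Sum>n<N. if Y n = x then 1 else 0) = l)"
proof -
  have *: "card {n. Y n = x} = (\<Sum>n<N. if Y n = x then 1 else 0)" if "\<forall>n\<ge>N. Y n \<noteq> x" for N
  proof -
    have "{n. Y n = x} = {..<N} \<inter> {n. Y n = x}" using that by (auto simp: not_le[symmetric])
    then show ?thesis by (simp add: sum.If_cases)
  qed
  have "\<exists>N. \<forall>n\<ge>N. Y n \<noteq> x" using assms infinite_visits_iff by blast
  then show ?thesis using * by metis
qed

lemma measurable_leftover [measurable (raw)]:
  assumes [measurable]: "f \<in> N \<rightarrow>\<^sub>M env_space" "g \<in> N \<rightarrow>\<^sub>M path_space"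
  shows "(\<lambda>z. leftover (f z) (g z)) \<in> N \<rightarrow>\<^sub>M env_space"
proof (rule measurable_env_spaceI)
  have f[measurable]: "(\<lambda>z. f z x i) \<in> borel_measurable N" for x i
    using measurable_compose[OF assms(1) measurable_cookie] .
  have g[measurable]: "(\<lambda>z. g z m) \<in> N \<rightarrow>\<^sub>M count_space UNIV" for m
    using measurable_compose[OF assms(2) measurable_path_coord] .
  fix x i
  have t: "Measurable.pred N (\<lambda>z. transient (g z))"
  proof -
    have "transient (g z) \<longleftrightarrow> (\<forall>x. \<exists>K. \<forall>n. n \<ge> K \<longrightarrow> g z n \<noteq> x)" for z
      by (simp only: transient_def finite_visits_iff)
    then have e: "(\<lambda>z. transient (g z)) = (\<lambda>z. \<forall>x. \<exists>K. \<forall>n. n \<ge> K \<longrightarrow> g z n \<noteq> x)"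
      by (intro ext)
    have "Measurable.pred N (\<lambda>z. g z n \<noteq> x)" for n x by measurable
    note [measurable] = this
    show ?thesis unfolding e by measurable
  qed
  define h where "h z = (if transient (g z) then card {n. g z n = x} else 0)" for z
  have h: "h \<in> N \<rightarrow>\<^sub>M count_space UNIV"
  proof -
    have "Measurable.pred N (\<lambda>z. h z = l)" for l
    proof -
      have e: "(\<lambda>z. h z = l) = (\<lambda>z. (transient (g z) \<and> 
         (\<exists>N. (\<forall>n. n\<ge>N \<longrightarrow> g z n \<noteq> x) \<and> (\<Sum>n<N. if g z n = x then 1 else 0) = l)) \<or> (\<not> transient (g z) \<and> l = 0))"
        unfolding h_def using card_visits_iff by (auto simp: transient_def fun_eq_iff)
      have "Measurable.pred N (\<lambda>z. g z n \<noteq> x)" for n by measurable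
      note [measurable] = this t
      show ?thesis unfolding e by measurable
    qed
    then have "h -` {l} \<inter> space N \<in> sets N" for l
      by (simp only: pred_def vimage_def Int_def conj_commute singleton_iff mem_Collect_eq)
    then show ?thesis by (simp add: measurable_count_space_eq2_countable)
  qed
  show "(\<lambda>z. leftover (f z) (g z) x i) \<in> borel_measurable N"
  proof -
    have 1: "(\<lambda>z. f z x (i + h z)) \<in> borel_measurable N"
      by (rule measurable_compose_countable[where f="\<lambda>l z. f z x (i + l)" and g=h, OF f h])
    have "leftover (f z) (g z) x i = (if transient (g z) then f z x (i + h z) else 1/2)" for z
      by (auto simp: leftover_def h_def)
    then show ?thesis using 1 t by simp
  qed
next
  fix z x i assume "z \<in> space N"
  then have "f z \<in> space env_space" by (rule measurable_space[OF assms(1)])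
  then show "leftover (f z) (g z) x i \<in> {0..1}" by (auto simp: leftover_def space_env_space)
qed

primrec steps :: "env \<Rightarrow> (nat \<Rightarrow> real) \<Rightarrow> nat \<Rightarrow> path" where
  "steps \<omega> v 0 = (\<lambda>_. 0)"
| "steps \<omega> v (Suc n) = (steps \<omega> v n)(Suc n := steps \<omega> v n n +
     (if v n < current_cookie \<omega> (steps \<omega> v n) n then 1 else - 1))"

definition driven :: "env \<Rightarrow> (nat \<Rightarrow> real) \<Rightarrow> path" where
  "driven \<omega> v n = steps \<omega> v n n"

lemma steps_le: "m \<le> n \<Longrightarrow> steps \<omega> v n m = driven \<omega> v m"
  by (induction n) (auto simp: driven_def le_Suc_eq)

lemma current_cookie_cong:
  "(\<And>m. m \<le> n \<Longrightarrow> Y m = Z m) \<Longrightarrow> current_cookie \<omega> Y n = current_cookie \<omega> Z n"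
  unfolding current_cookie_def by (auto intro!: arg_cong2[where f=\<omega>] arg_cong[where f=card])

lemma driven_0 [simp]: "driven \<omega> v 0 = 0"
  by (simp add: driven_def)

lemma driven_Suc: "driven \<omega> v (Suc n) = driven \<omega> v n +
     (if v n < current_cookie \<omega> (driven \<omega> v) n then 1 else - 1)"
proof -
  have "current_cookie \<omega> (steps \<omega> v n) n = current_cookie \<omega> (driven \<omega> v) n"
    by (rule current_cookie_cong) (rule steps_le)
  then show ?thesis by (simp add: driven_def[of _ _ "Suc n"] steps_le)
qed

lemma driven_cong: "(\<And>m. m < n \<Longrightarrow> v m = w m) \<Longrightarrow> driven \<omega> v n = driven \<omega> w n"
proof (induction n rule: less_induct)
  case (less n)
  show ?case
  proof (cases n)
    case (Suc k)
    have "driven \<omega> v m = driven \<omega> w m" if "m \<le> k" for m using less Suc that by auto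
    moreover from this have "current_cookie \<omega> (driven \<omega> v) k = current_cookie \<omega> (driven \<omega> w) k"
      by (rule current_cookie_cong)
    ultimately show ?thesis using less.prems[of k] by (simp add: Suc driven_Suc)
  qed simp
qed

lemma measurable_steps:
  assumes [measurable]: "f \<in> N \<rightarrow>\<^sub>M env_space" "\<And>n. (\<lambda>z. v z n) \<in> borel_measurable N"
  shows "(\<lambda>z. steps (f z) (v z) n) \<in> N \<rightarrow>\<^sub>M path_space"
proof (induction n)
  case 0 then show ?case by (simp add: measurable_const)
next
  case (Suc n)
  note [measurable] = Suc
  have [measurable]: "(\<lambda>z. steps (f z) (v z) n m) \<in> N \<rightarrow>\<^sub>M count_space UNIV" for m
    using measurable_compose[OF Suc measurable_path_coord] .
  have "(\<lambda>z. steps (f z) (v z) (Suc n) m) \<in> N \<rightarrow>\<^sub>M count_space UNIV" for m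
    by (cases "m = Suc n") simp_all
  then show ?case by (rule measurable_pathI)
qed

lemma measurable_driven [measurable (raw)]:
  assumes [measurable]: "f \<in> N \<rightarrow>\<^sub>M env_space" "\<And>n. (\<lambda>z. v z n) \<in> borel_measurable N"
  shows "(\<lambda>z. driven (f z) (v z)) \<in> N \<rightarrow>\<^sub>M path_space"
  unfolding driven_def
  by (intro measurable_pathI measurable_compose[OF measurable_steps measurable_path_coord] assms)

primrec env_of :: "nat \<Rightarrow> env \<times> (nat \<times> nat \<Rightarrow> real) \<Rightarrow> env" where
  "env_of 0 s = fst s"
| "env_of (Suc j) s = leftover (env_of j s) (driven (env_of j s) (\<lambda>n. snd s (j, n)))"

definition walk_of :: "nat \<Rightarrow> env \<times> (nat \<times> nat \<Rightarrow> real) \<Rightarrow> path" where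
  "walk_of j s = driven (env_of j s) (\<lambda>n. snd s (j, n))"

definition sample_of :: "env \<times> (nat \<times> nat \<Rightarrow> real) \<Rightarrow> sample" where
  "sample_of s = (fst s, \<lambda>j. walk_of j s)"

lemma walk_sample_of [simp]: "walk (Suc j) (sample_of s) = walk_of j s"
  by (simp add: walk_def sample_of_def)

lemma leftover_env_sample_of [simp]: "leftover_env j (sample_of s) = env_of j s"
  by (induction j) (auto simp: sample_of_def walk_def walk_of_def)

abbreviation unif :: "real measure" where "unif \<equiv> uniform_measure lborel {0..1}"
abbreviation seeds :: "(nat \<times> nat \<Rightarrow> real) measure" where "seeds \<equiv> \<Pi>\<^sub>M i\<in>UNIV. unif"

lemma prob_unif: "prob_space unif"
  by (rule prob_space_uniform_measure) auto

lemma unif_less: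
  assumes "0 \<le> q" "q \<le> 1"
  shows "measure unif {v. (v < q) = b} = (if b then q else 1 - q)"
proof -
  interpret U: prob_space unif by (rule prob_unif)
  have eq: "{0..1} \<inter> {v. v < q} = {0..<q}" using assms by auto
  have 1: "measure unif {v. v < q} = q"
    using assms by (subst measure_uniform_measure) (auto simp: eq)
  have "measure unif (space unif - {v. v < q}) = 1 - measure unif {v. v < q}"
    by (rule U.prob_compl) simp
  moreover have "space unif - {v. v < q} = {v. \<not> v < q}" by auto
  ultimately show ?thesis using 1 by simp
qed

context
  fixes P :: "env measure"
  assumes P: "prob_space P" and sets_P [measurable_cong]: "sets P = sets env_space"
begin

lemma measurable_env_of [measurable]: "env_of j \<in> P \<Otimes>\<^sub>M seeds \<rightarrow>\<^sub>M env_space"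
proof (induction j)
  case 0
  have "fst \<in> P \<Otimes>\<^sub>M seeds \<rightarrow>\<^sub>M env_space" by measurable
  then show ?case by (simp cong: measurable_cong)
next
  case (Suc j)
  note [measurable] = Suc
  have [measurable]: "(\<lambda>s. snd s (j, n)) \<in> borel_measurable (P \<Otimes>\<^sub>M seeds)" for n
    by measurable
  show ?case by (simp add: measurable_leftover measurable_driven Suc)
qed

lemma measurable_walk_of [measurable]: "walk_of j \<in> P \<Otimes>\<^sub>M seeds \<rightarrow>\<^sub>M path_space"
proof -
  have [measurable]: "(\<lambda>s. snd s (j, n)) \<in> borel_measurable (P \<Otimes>\<^sub>M seeds)" for n
    by measurable
  show ?thesis unfolding walk_of_def by measurable
qed

lemma measurable_sample_of [measurable]: "sample_of \<in> P \<Otimes>\<^sub>M seeds \<rightarrow>\<^sub>M sample_space"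
proof -
  have "(\<lambda>s. \<lambda>j. walk_of j s) \<in> P \<Otimes>\<^sub>M seeds \<rightarrow>\<^sub>M (\<Pi>\<^sub>M k\<in>UNIV. path_space)"
    by (intro measurable_PiM_single') auto
  moreover have "fst \<in> P \<Otimes>\<^sub>M seeds \<rightarrow>\<^sub>M env_space" by measurable
  ultimately show ?thesis unfolding sample_of_def sample_space_def by (rule measurable_Pair[rotated])
qed

end

lemma measurable_fst_sample [measurable]: "fst \<in> sample_space \<rightarrow>\<^sub>M env_space"
  unfolding sample_space_def by measurable

lemma measurable_walk [measurable]: "walk k \<in> sample_space \<rightarrow>\<^sub>M path_space"
  unfolding walk_def sample_space_def by measurable

lemma measurable_walk_at [measurable]: "(\<lambda>z. walk k z n) \<in> sample_space \<rightarrow>\<^sub>M count_space UNIV"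
  using measurable_compose[OF measurable_walk measurable_path_coord] .

lemma measurable_leftover_env [measurable]: "leftover_env j \<in> sample_space \<rightarrow>\<^sub>M env_space"
  by (induction j) (auto simp: measurable_leftover cong: measurable_cong)

lemma measurable_reveal [measurable]: "reveal k n \<in> sample_space \<rightarrow>\<^sub>M sample_space"
proof -
  have "(\<lambda>z i m. if Suc i < k \<or> (Suc i = k \<and> m \<le> n) then walk (Suc i) z m else 0)
      \<in> sample_space \<rightarrow>\<^sub>M (\<Pi>\<^sub>M k\<in>UNIV. path_space)"
    by (intro measurable_PiM_single' measurable_pathI) auto
  then show ?thesis
    unfolding reveal_def by (subst (2) sample_space_def) (rule measurable_Pair[OF measurable_fst_sample])
qed

lemma walk_reveal: "k < l \<or> (k = l \<and> m \<le> n) \<Longrightarrow> k > 0 \<Longrightarrow> walk k (reveal l n z) m = walk k z m"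
  by (auto simp: walk_def reveal_def)

lemma leftover_env_reveal: "j < k \<Longrightarrow> leftover_env j (reveal k n z) = leftover_env j z"
proof (induction j)
  case (Suc j)
  then have "walk (Suc j) (reveal k n z) = walk (Suc j) z" by (intro ext walk_reveal) auto
  with Suc show ?case by simp
qed (simp add: reveal_def)

lemma env_of_upd: "i \<le> j \<Longrightarrow> env_of i (\<omega>, u((j, n) := v)) = env_of i (\<omega>, u)"
  by (induction i) auto

lemma reveal_sample_of_upd:
  "reveal (Suc j) n (sample_of (\<omega>, u((j, n) := v))) = reveal (Suc j) n (sample_of (\<omega>, u))"
proof -
  have "walk_of i (\<omega>, u((j, n) := v)) m = walk_of i (\<omega>, u) m" if "i < j \<or> i = j \<and> m \<le> n" for i m
  proof -
    have "driven w (\<lambda>k. (u((j, n) := v)) (i, k)) m = driven w (\<lambda>k. u (i, k)) m" for w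
      by (rule driven_cong) (use that in auto)
    moreover have "env_of i (\<omega>, u((j, n) := v)) = env_of i (\<omega>, u)"
      by (rule env_of_upd) (use that in auto)
    ultimately show ?thesis unfolding walk_of_def snd_conv by metis
  qed
  then show ?thesis
    by (auto simp: reveal_def sample_of_def walk_def fun_eq_iff)
qed

lemma current_cookie_01:
  "\<omega> \<in> space env_space \<Longrightarrow> 0 \<le> current_cookie \<omega> Y n \<and> current_cookie \<omega> Y n \<le> 1"
  by (auto simp: current_cookie_def space_env_space)

lemma integral_seeds_upd:
  fixes f :: "(nat \<times> nat \<Rightarrow> real) \<Rightarrow> real"
  assumes f [measurable]: "f \<in> borel_measurable seeds" and bd: "\<And>u. \<bar>f u\<bar> \<le> 1"
  shows "(\<integral>u. f u \<partial>seeds) = (\<integral>u. (\<integral>v. f (u(i := v)) \<partial>unif) \<partial>seeds)"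
proof -
  interpret U: prob_space unif by (rule prob_unif)
  interpret S: prob_space seeds by (intro prob_space_PiM prob_unif)
  interpret US: pair_prob_space unif seeds ..
  have d: "distr (unif \<Otimes>\<^sub>M seeds) seeds (\<lambda>(v, u). u(i := v)) = seeds"
    using distr_pair_PiM_eq_PiM[of UNIV "\<lambda>_. unif" i] prob_unif by simp
  have m [measurable]: "(\<lambda>(v, u). u(i := v)) \<in> unif \<Otimes>\<^sub>M seeds \<rightarrow>\<^sub>M seeds"
    unfolding split_beta'
    by (rule measurable_fun_upd[where J=UNIV]) auto
  have m2 [measurable]: "(\<lambda>(v, u). f (u(i := v))) \<in> borel_measurable (unif \<Otimes>\<^sub>M seeds)"
    using measurable_compose[OF m f] by (simp add: split_beta')
  have "(\<integral>u. f u \<partial>seeds) = (\<integral>u. f u \<partial>distr (unif \<Otimes>\<^sub>M seeds) seeds (\<lambda>(v, u). u(i := v)))"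
    by (simp only: d)
  also have "\<dots> = (\<integral>(v, u). f (u(i := v)) \<partial>(unif \<Otimes>\<^sub>M seeds))"
    by (subst integral_distr[OF m f]) (simp add: split_beta')
  also have "\<dots> = (\<integral>u. (\<integral>v. f (u(i := v)) \<partial>unif) \<partial>seeds)"
    by (rule US.integral_snd[symmetric])
       (auto intro!: US.P.integrable_const_bound[of _ 1] simp: bd split_beta')
  finally show ?thesis .
qed

context
  fixes P :: "env measure"
  assumes P: "prob_space P" and sets_P [measurable_cong]: "sets P = sets env_space"
begin

lemma integral_sample_of:
  fixes H Q :: "sample \<Rightarrow> real" and j n :: nat
  assumes [measurable]: "H \<in> borel_measurable sample_space" "Q \<in> borel_measurable sample_space"
    and H: "\<And>z. 0 \<le> H z \<and> H z \<le> 1" and Q: "\<And>z. z \<in> space sample_space \<Longrightarrow> 0 \<le> Q z \<and> Q z \<le> 1"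
  defines "T \<equiv> \<lambda>s. reveal (Suc j) n (sample_of s)"
  shows "(\<integral>s. H (T s) * of_bool ((snd s (j, n) < Q (T s)) = b) \<partial>(P \<Otimes>\<^sub>M seeds)) =
         (\<integral>s. H (T s) * (if b then Q (T s) else 1 - Q (T s)) \<partial>(P \<Otimes>\<^sub>M seeds))" 
proof -
  interpret P: prob_space P by (rule P)
  interpret U: prob_space unif by (rule prob_unif)
  interpret S: prob_space seeds by (intro prob_space_PiM prob_unif)
  interpret PS: pair_prob_space P seeds ..
  note [measurable] = measurable_sample_of[OF P sets_P]
  have T [measurable]: "T \<in> P \<Otimes>\<^sub>M seeds \<rightarrow>\<^sub>M sample_space"
    unfolding T_def by measurable
  have T_upd: "T (\<omega>, u((j, n) := v)) = T (\<omega>, u)" for \<omega> u v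
    unfolding T_def by (rule reveal_sample_of_upd)
  have TS: "T (\<omega>, u) \<in> space sample_space" if "\<omega> \<in> space P" for \<omega> u
    using measurable_space[OF T, of "(\<omega>, u)"] that by (simp add: space_pair_measure space_PiM)
  have [measurable]: "(\<lambda>s. snd s (j, n)) \<in> borel_measurable (P \<Otimes>\<^sub>M seeds)" by measurable
  let ?L = "\<lambda>s. H (T s) * of_bool ((snd s (j, n) < Q (T s)) = b)"
  let ?R = "\<lambda>s. H (T s) * (if b then Q (T s) else 1 - Q (T s))"
  have L [measurable]: "?L \<in> borel_measurable (P \<Otimes>\<^sub>M seeds)" by measurable
  have R [measurable]: "?R \<in> borel_measurable (P \<Otimes>\<^sub>M seeds)" by measurable
  have Lb: "\<bar>?L s\<bar> \<le> 1" for s using H[of "T s"] by auto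
  have Rb: "\<bar>?R s\<bar> \<le> 1" if "s \<in> space (P \<Otimes>\<^sub>M seeds)" for s
    using H[of "T s"] Q[of "T s"] measurable_space[OF T that] by (auto simp: abs_mult intro!: mult_le_one)
  have "(\<integral>s. ?L s \<partial>(P \<Otimes>\<^sub>M seeds)) = (\<integral>\<omega>. (\<integral>u. ?L (\<omega>, u) \<partial>seeds) \<partial>P)"
    by (rule PS.integral_fst'[symmetric], rule PS.P.integrable_const_bound[of _ 1])
       (use Lb in \<open>auto\<close>)
  also have "\<dots> = (\<integral>\<omega>. (\<integral>u. ?R (\<omega>, u) \<partial>seeds) \<partial>P)"
  proof (rule Bochner_Integration.integral_cong[OF refl])
    fix \<omega> assume w: "\<omega> \<in> space P"
    have "(\<integral>u. ?L (\<omega>, u) \<partial>seeds) = (\<integral>u. (\<integral>v. ?L (\<omega>, u((j, n) := v)) \<partial>unif) \<partial>seeds)"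
      by (rule integral_seeds_upd) (rule measurable_compose[OF measurable_Pair1'[OF w] L], rule Lb)
    also have "\<dots> = (\<integral>u. ?R (\<omega>, u) \<partial>seeds)"
    proof (rule Bochner_Integration.integral_cong[OF refl])
      fix u
      have "(\<integral>v. ?L (\<omega>, u((j, n) := v)) \<partial>unif) =
            (\<integral>v. H (T (\<omega>, u)) * indicator {v. (v < Q (T (\<omega>, u))) = b} v \<partial>unif)"
        by (simp add: T_upd indicator_def of_bool_def)
      also have "\<dots> = H (T (\<omega>, u)) * measure unif {v. (v < Q (T (\<omega>, u))) = b}"
        by simp
      also have "\<dots> = ?R (\<omega>, u)"
        using unif_less[of "Q (T (\<omega>, u))" b] Q[OF TS[OF w]] by simp
      finally show "(\<integral>v. ?L (\<omega>, u((j, n) := v)) \<partial>unif) = ?R (\<omega>, u)" .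
    qed
    finally show "(\<integral>u. ?L (\<omega>, u) \<partial>seeds) = (\<integral>u. ?R (\<omega>, u) \<partial>seeds)" .
  qed
  also have "\<dots> = (\<integral>s. ?R s \<partial>(P \<Otimes>\<^sub>M seeds))"
    by (rule PS.integral_fst', rule PS.P.integrable_const_bound[of _ 1])
       (use Rb in \<open>auto intro!: AE_I2\<close>)
  finally show ?thesis .
qed

lemma cond_exp_sample_of:
  defines "M \<equiv> distr (P \<Otimes>\<^sub>M seeds) sample_space sample_of"
  shows "AE z in M. real_cond_exp M (past (Suc j) n)
     (indicator {z. walk (Suc j) z (Suc n) = walk (Suc j) z n + (if b then 1 else - 1)}) z =
     (if b then current_cookie (leftover_env j z) (walk (Suc j) z) n
      else 1 - current_cookie (leftover_env j z) (walk (Suc j) z) n)"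
proof -
  interpret P: prob_space P by (rule P)
  interpret U: prob_space unif by (rule prob_unif)
  interpret S: prob_space seeds by (intro prob_space_PiM prob_unif)
  interpret PS: pair_prob_space P seeds ..
  note so [measurable] = measurable_sample_of[OF P sets_P]
  interpret M: prob_space M unfolding M_def by (rule PS.P.prob_space_distr) (rule so)
  have sM [measurable_cong, simp]: "sets M = sets sample_space" and spM [simp]: "space M = space sample_space"
    by (auto simp: M_def)
  let ?F = "past (Suc j) n"
  have re: "reveal (Suc j) n \<in> space sample_space \<rightarrow> space sample_space"
    using measurable_space[OF measurable_reveal] by blast
  have F: "sets ?F = {reveal (Suc j) n -` B \<inter> space sample_space | B. B \<in> sets sample_space}"
    unfolding past_def by (rule sets_vimage_algebra2[OF re])
  interpret MF: finite_measure_subalgebra M ?F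
  proof
    show "subalgebra M ?F" unfolding subalgebra_def
      using F measurable_sets[OF measurable_reveal] by (auto simp: past_def)
  qed
  define q where "q z = current_cookie (leftover_env j z) (walk (Suc j) z) n" for z
  define g where "g z = (if b then q z else 1 - q z)" for z
  define E where "E = {z. walk (Suc j) z (Suc n) = walk (Suc j) z n + (if b then 1 else - 1)}"
  have q [measurable]: "q \<in> borel_measurable sample_space" unfolding q_def by measurable
  have g [measurable]: "g \<in> borel_measurable sample_space" unfolding g_def by measurable
  have q01: "0 \<le> q z \<and> q z \<le> 1" if "z \<in> space sample_space" for z
    unfolding q_def by (intro current_cookie_01 measurable_space[OF measurable_leftover_env that])
  have qr: "q (reveal (Suc j) n z) = q z" for z
  proof -
    have "current_cookie w (walk (Suc j) (reveal (Suc j) n z)) n = current_cookie w (walk (Suc j) z) n" for w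
      by (rule current_cookie_cong) (auto intro: walk_reveal)
    then show ?thesis by (simp add: q_def leftover_env_reveal)
  qed
  have Em: "(indicator E :: sample \<Rightarrow> real) \<in> borel_measurable sample_space"
  proof -
    have "Measurable.pred sample_space (\<lambda>z. walk (Suc j) z (Suc n) = walk (Suc j) z n + (if b then 1 else - 1))"
      by measurable
    then show ?thesis unfolding E_def indicator_def mem_Collect_eq of_bool_def by measurable
  qed
  note [measurable] = Em
  have Eq: "indicator E (sample_of s) = (of_bool ((snd s (j, n) < q (sample_of s)) = b) :: real)" for s
    by (auto simp: E_def q_def walk_of_def driven_Suc indicator_def)
  have "AE z in M. real_cond_exp M ?F (indicator E) z = g z"
  proof (rule MF.real_cond_exp_charact)
    fix A assume "A \<in> sets ?F"
    then obtain B where B [measurable]: "B \<in> sets sample_space"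
      and A: "A = reveal (Suc j) n -` B \<inter> space sample_space" using F by auto
    have Am [measurable]: "A \<in> sets sample_space" unfolding A by measurable
    have Ai: "indicator A (sample_of s) = (indicator B (reveal (Suc j) n (sample_of s)) :: real)"
      if "s \<in> space (P \<Otimes>\<^sub>M seeds)" for s
      using measurable_space[OF so that] by (auto simp: A indicator_def)
    have "(\<integral>z\<in>A. (indicator E z :: real) \<partial>M) = (\<integral>s. indicator A (sample_of s) * (indicator E (sample_of s) :: real) \<partial>(P \<Otimes>\<^sub>M seeds))"
      unfolding set_lebesgue_integral_def M_def by (subst integral_distr) auto
    also have "\<dots> = (\<integral>s. indicator B (reveal (Suc j) n (sample_of s)) *
         of_bool ((snd s (j, n) < q (reveal (Suc j) n (sample_of s))) = b) \<partial>(P \<Otimes>\<^sub>M seeds))"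
      by (intro Bochner_Integration.integral_cong refl) (simp only: Ai Eq qr)
    also have "\<dots> = (\<integral>s. indicator B (reveal (Suc j) n (sample_of s)) *
         (if b then q (reveal (Suc j) n (sample_of s)) else 1 - q (reveal (Suc j) n (sample_of s))) \<partial>(P \<Otimes>\<^sub>M seeds))"
      by (rule integral_sample_of) (use q01 in \<open>auto simp: indicator_def\<close>)
    also have "\<dots> = (\<integral>s. indicator A (sample_of s) * g (sample_of s) \<partial>(P \<Otimes>\<^sub>M seeds))"
      by (intro Bochner_Integration.integral_cong refl) (simp only: Ai g_def qr)
    also have "\<dots> = (\<integral>z\<in>A. g z \<partial>M)"
      unfolding set_lebesgue_integral_def M_def by (subst integral_distr) auto
    finally show "(\<integral>z\<in>A. (indicator E z :: real) \<partial>M) = (\<integral>z\<in>A. g z \<partial>M)" .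
  next
    show "integrable M (indicator E :: _ \<Rightarrow> real)"
      by (rule M.integrable_const_bound[of _ 1]) (auto simp: indicator_def)
    show "integrable M g"
      by (rule M.integrable_const_bound[of _ 1]) (use q01 in \<open>auto intro!: AE_I2 simp: g_def\<close>)
    have "reveal (Suc j) n \<in> ?F \<rightarrow>\<^sub>M sample_space"
      unfolding past_def by (rule measurable_vimage_algebra1[OF re])
    from measurable_compose[OF this g] show "g \<in> borel_measurable ?F"
      by (simp only: g_def[abs_def] qr)
  qed
  then show ?thesis by (simp only: E_def g_def q_def)
qed

lemma ex_annealed_law: "\<exists>M. annealed_law P M"
proof -
  interpret P: prob_space P by (rule P)
  interpret S: prob_space seeds by (intro prob_space_PiM prob_unif)
  interpret PS: pair_prob_space P seeds ..
  note so [measurable] = measurable_sample_of[OF P sets_P]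
  let ?M = "distr (P \<Otimes>\<^sub>M seeds) sample_space sample_of"
  have "distr ?M env_space fst = distr (P \<Otimes>\<^sub>M seeds) env_space (fst \<circ> sample_of)"
    by (rule distr_distr) measurable
  also have "\<dots> = distr (P \<Otimes>\<^sub>M seeds) P fst"
    by (rule distr_cong) (auto simp: sample_of_def sets_P)
  also have "\<dots> = P" by (rule S.distr_pair_fst)
  finally have 1: "distr ?M env_space fst = P" .
  have "AE z in ?M. walk (Suc j) z 0 = 0" for j
    by (subst AE_distr_iff) (auto simp: walk_of_def)
  then have "excited_walk ?M (past (Suc j)) (leftover_env j) (walk (Suc j)) 0" for j
    unfolding excited_walk_def
    using cond_exp_sample_of[of j _ True] cond_exp_sample_of[of j _ False] by simp
  then have "excited_walk ?M (past k) (leftover_env (k - 1)) (walk k) 0" if "k \<ge> 1" for k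
    using that by (cases k) auto
  with 1 show ?thesis unfolding annealed_law_def
    by (intro exI[of _ ?M]) (auto intro: PS.P.prob_space_distr)
qed

end

end

theory Submission
  imports Defs
begin

text \<open>
  Draw every jump in advance: the \<open>i\<close>-th arrow at the site \<open>x\<close> points to the right if an independent
  uniform seed lies below the cookie \<open>\<omega> x i\<close>, and the walk that makes the \<open>i\<close>-th visit to \<open>x\<close>, counting
  the visits of all the walks together, follows this arrow. As long as the walks are transient, each
  walk finds the arrows that its predecessors have left over, so a single field of arrows decides the
  fate of all the walks. This is the law of the walks in the theorem, because the one-step conditional
  probabilities determine the annealed law (\<open>step_law_unique\<close>) and because a walk always looks at a
  seed that has never been used before (\<open>nn_integral_fresh_seed\<close>, \<open>step_law_arrow_law\<close>).

  Send walkers from \<open>x\<close> one after the other, each of which stops when it reaches \<open>x - 1\<close>. Let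
  \<open>T\<^sub>k x\<close> be the number of walkers that come back before the \<open>k\<close>-th one has escaped to the right. If
  \<open>k\<close> walkers escape then \<open>T\<^sub>k (x + 1) + k\<close> right arrows are used at \<open>x\<close>, and the left arrows in front
  of the last of them are the returns: \<open>T\<^sub>k x = F\<^sub>x (T\<^sub>k (x + 1) + k)\<close>, where \<open>F\<^sub>x r\<close> is the number of
  left arrows at \<open>x\<close> in front of the \<open>r\<close>-th right arrow. The recursion can be taken as the definition
  of \<open>T\<^sub>k\<close>, and \<open>T\<^sub>k\<close> is finite at one site if and only if it is finite at all of them.

  Conservation of flow and a least action principle for the walks show that, when \<open>k\<close> walks have gone to
  \<open>+\<infinity>\<close> and \<open>T\<^sub>1\<close> is infinite for the reflected arrows, the next walk goes to \<open>+\<infinity>\<close> if \<open>T\<^sub>k\<^sub>+\<^sub>1\<close> is finite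
  and is recurrent otherwise (\<open>next_walk_after_right\<close>). The finiteness of \<open>T\<^sub>k\<close> is a shift-invariant tail
  event, so it has probability 0 or 1 (\<open>escapes_zero_one\<close>), and \<open>R\<close> is the supremum of the \<open>k\<close> for which
  it has probability 1, up to the sign, which tells the direction.

  It remains to exclude that \<open>T\<^sub>1\<close> is finite for both directions (\<open>not_both_escape\<close>). Let \<open>r x\<close> be \<open>T\<^sub>1 x\<close>
  and let \<open>l x\<close> be the same quantity for walkers that start at \<open>x\<close> and escape to the left. Then
  \<open>l (-1) < r 0\<close> and \<open>l 0 \<le> r 1\<close> both say that the left arrow number \<open>l (-1) + 1\<close> at 0 precedes the
  right arrow number \<open>r 1 + 1\<close> there. By stationarity \<open>l (-1) < r 0\<close> has the probability of \<open>l 0 < r 1\<close>, so \<open>l 0 = r 1\<close> has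
  probability 0. But \<open>l 0 = r 1 = 0\<close> has positive probability, since finitely many arrows at 0 can
  be prescribed to point to the left, and finitely many at 1 to the right. Applied to the environment that is constantly \<open>1/2\<close>, the same argument and the
  left-right symmetry give the recurrence of the walks that come after a recurrent one (\<open>fair_arrows\<close>).
\<close>

section \<open>Left and right arrows at one site\<close>

text \<open>An arrow is \<^term>\<open>True\<close> if it points to the right.\<close>

type_synonym arrows = "int \<Rightarrow> nat \<Rightarrow> bool"

primrec rights :: "(nat \<Rightarrow> bool) \<Rightarrow> nat \<Rightarrow> nat" where
  "rights b 0 = 0"
| "rights b (Suc n) = rights b n + of_bool (b n)"

abbreviation lefts :: "(nat \<Rightarrow> bool) \<Rightarrow> nat \<Rightarrow> nat" where
  "lefts b \<equiv> rights (\<lambda>i. \<not> b i)"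

lemma rights_mono: "m \<le> n \<Longrightarrow> rights b m \<le> rights b n"
  by (rule lift_Suc_mono_le) auto

lemma ex_rights_ge: "\<exists>\<^sub>\<infinity>i. b i \<Longrightarrow> \<exists>n. r \<le> rights b n"
proof (induction r)
  case (Suc r)
  then obtain n where n: "r \<le> rights b n" by auto
  obtain i where i: "i \<ge> n" "b i" using Suc.prems unfolding INFM_nat_le by blast
  have "Suc r \<le> rights b (Suc i)" using n rights_mono[OF i(1), of b] i(2) by simp
  then show ?case by blast
qed auto

text \<open>
  The number of arrows up to and including the \<open>r\<close>-th right one.
\<close>

definition hit :: "(nat \<Rightarrow> bool) \<Rightarrow> nat \<Rightarrow> nat" where
  "hit b r = (LEAST n. r \<le> rights b n)"

lemma hit_le_iff:
  assumes "\<exists>\<^sub>\<infinity>i. b i"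
  shows "hit b r \<le> n \<longleftrightarrow> r \<le> rights b n"
proof
  have "r \<le> rights b (hit b r)" unfolding hit_def by (rule LeastI_ex[OF ex_rights_ge[OF assms]])
  then show "r \<le> rights b n" if "hit b r \<le> n" using rights_mono[OF that, of b] by simp
qed (auto simp: hit_def intro: Least_le)

lemma hit_rights:
  assumes "c = 0 \<or> b (c - 1)"
  shows "hit b (rights b c) = c"
  unfolding hit_def
proof (rule Least_equality)
  fix n assume "rights b c \<le> rights b n"
  moreover have "rights b n < rights b c" if n: "n < c"
  proof -
    obtain d where d: "c = Suc d" using n by (cases c) auto
    then have "rights b n \<le> rights b d" using n by (intro rights_mono) auto
    then show ?thesis using d assms by simp
  qed
  ultimately show "c \<le> n" by force
qed auto

text \<open>
  The number of left arrows in front of the \<open>r\<close>-th right arrow, which is the function \<open>F\<close> of the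
  introduction.
\<close>

definition failures :: "(nat \<Rightarrow> bool) \<Rightarrow> nat \<Rightarrow> nat" where
  "failures b r = lefts b (hit b r)"

lemma failures_mono:
  assumes "\<exists>\<^sub>\<infinity>i. b i" "r \<le> s"
  shows "failures b r \<le> failures b s"
proof -
  have "s \<le> rights b (hit b s)" using hit_le_iff[OF assms(1)] by blast
  then have "hit b r \<le> hit b s" using assms by (simp add: hit_le_iff)
  then show ?thesis unfolding failures_def by (rule rights_mono)
qed

lemma failures_unbounded:
  assumes "\<exists>\<^sub>\<infinity>i. b i" "\<exists>\<^sub>\<infinity>i. \<not> b i"
  shows "\<exists>r. m < failures b r"
proof -
  obtain n where n: "Suc m \<le> lefts b n" using ex_rights_ge[OF assms(2)] by blast
  have "\<not> hit b (Suc (rights b n)) \<le> n" using assms(1) by (simp add: hit_le_iff)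
  then have "lefts b n \<le> failures b (Suc (rights b n))"
    unfolding failures_def by (intro rights_mono) simp
  with n show ?thesis by (intro exI[of _ "Suc (rights b n)"]) simp
qed

lemma lefts_less_failures:
  assumes "\<exists>\<^sub>\<infinity>i. b i" "\<not> b c" "rights b c < r"
  shows "lefts b c < failures b r"
proof -
  have "\<not> hit b r \<le> c" using assms by (simp add: hit_le_iff)
  then have "lefts b (Suc c) \<le> failures b r" unfolding failures_def by (intro rights_mono) simp
  then show ?thesis using assms(2) by simp
qed

lemma hit_Suc:
  assumes "\<exists>\<^sub>\<infinity>i. b i"
  obtains h where "hit b (Suc p) = Suc h" "b h"
proof -
  have 1: "Suc p \<le> rights b (hit b (Suc p))" using hit_le_iff[OF assms] by blast
  then obtain h where h: "hit b (Suc p) = Suc h" by (cases "hit b (Suc p)") auto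
  have "\<not> hit b (Suc p) \<le> h" using h by simp
  then have "rights b h < Suc p" using hit_le_iff[OF assms] by simp
  with 1 h have "b h" by (cases "b h") auto
  with h that show ?thesis by blast
qed

text \<open>
  Either side says that the left arrow number \<open>q + 1\<close> precedes the right arrow number \<open>p + 1\<close>.
\<close>

lemma failures_duality:
  assumes "\<exists>\<^sub>\<infinity>i. b i" "\<exists>\<^sub>\<infinity>i. \<not> b i"
  shows "failures (\<lambda>i. \<not> b i) (Suc q) \<le> p \<longleftrightarrow> q < failures b (Suc p)"
proof -
  let ?h = "hit b (Suc p)" and ?h' = "hit (\<lambda>i. \<not> b i) (Suc q)"
  obtain h where h: "?h = Suc h" "b h" by (rule hit_Suc[OF assms(1)])
  obtain h' where h': "?h' = Suc h'" "\<not> b h'" by (rule hit_Suc[OF assms(2)])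
  have "failures (\<lambda>i. \<not> b i) (Suc q) \<le> p \<longleftrightarrow> \<not> Suc p \<le> rights b ?h'"
    by (auto simp: failures_def)
  also have "\<dots> \<longleftrightarrow> ?h' < ?h" by (simp only: hit_le_iff[OF assms(1), symmetric] not_le)
  also have "\<dots> \<longleftrightarrow> ?h' \<le> ?h"
    using h h' by (cases "h = h'") auto
  also have "\<dots> \<longleftrightarrow> q < failures b (Suc p)"
    by (simp only: hit_le_iff[OF assms(2)] failures_def Suc_le_eq)
  finally show ?thesis .
qed

section \<open>Walkers on a half-line\<close>

definition balanced :: "arrows \<Rightarrow> bool" where
  "balanced a \<longleftrightarrow> (\<forall>x. (\<exists>\<^sub>\<infinity>i. a x i) \<and> (\<exists>\<^sub>\<infinity>i. \<not> a x i))"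

text \<open>
  Walkers start at \<open>x\<close> one after the other and stop at \<open>x - 1\<close> or at \<open>x + d\<close>; this is the number of
  those that stop at \<open>x - 1\<close> before \<open>k\<close> of them have stopped at \<open>x + d\<close>. Such a walker steps from \<open>x\<close> to
  \<open>x + 1\<close> as often as it comes back from there, and once more if it reaches \<open>x + d\<close>, so that
  \<open>returns k a (d - 1) (x + 1) + k\<close> right arrows are used at \<open>x\<close>.
\<close>

primrec returns :: "nat \<Rightarrow> arrows \<Rightarrow> nat \<Rightarrow> int \<Rightarrow> nat" where
  "returns k a 0 x = 0"
| "returns k a (Suc d) x = failures (a x) (returns k a d (x + 1) + k)"

text \<open>
  For balanced arrows, the counts are bounded as the barrier \<open>x + d\<close> recedes if and only if \<open>k\<close> of the walkers that start at
  \<open>x\<close> escape to the right.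
\<close>

definition escapes :: "nat \<Rightarrow> arrows \<Rightarrow> int \<Rightarrow> bool" where
  "escapes k a x \<longleftrightarrow> (\<exists>m. \<forall>d. returns k a d x \<le> m)"

definition total_returns :: "nat \<Rightarrow> arrows \<Rightarrow> int \<Rightarrow> nat" where
  "total_returns k a x = (LEAST m. \<forall>d. returns k a d x \<le> m)"

lemma returns_cong: "(\<And>y. y \<ge> x \<Longrightarrow> a y = b y) \<Longrightarrow> returns k a d x = returns k b d x"
  by (induction d arbitrary: x) auto

lemma returns_shift: "returns k (\<lambda>x. a (x + 1)) d x = returns k a d (x + 1)"
  by (induction d arbitrary: x) auto

context
  fixes a :: arrows
  assumes a: "balanced a"
begin

lemma often_right: "\<exists>\<^sub>\<infinity>i. a x i" and often_left: "\<exists>\<^sub>\<infinity>i. \<not> a x i"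
  using a by (auto simp: balanced_def)

lemma returns_mono: "k \<le> l \<Longrightarrow> d \<le> e \<Longrightarrow> returns k a d x \<le> returns l a e x"
proof (induction d arbitrary: e x)
  case (Suc d)
  then obtain e' where "e = Suc e'" "d \<le> e'" by (cases e) auto
  with Suc show ?case by (auto intro!: failures_mono often_right add_mono)
qed simp

lemma escapes_antimono: "k \<le> l \<Longrightarrow> escapes l a x \<Longrightarrow> escapes k a x"
  unfolding escapes_def using returns_mono[of k l] by (meson order_refl order_trans)

text \<open>
  Infinitely many right arrows at \<open>x\<close> send enough walkers to \<open>x + 1\<close>; conversely, if no bound holds at
  \<open>x + 1\<close>, then the walkers use up all the left arrows at \<open>x\<close>.
\<close>

lemma escapes_next: "escapes k a x \<longleftrightarrow> escapes k a (x + 1)"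
proof
  assume "escapes k a x"
  then obtain m where m: "returns k a d x \<le> m" for d unfolding escapes_def by blast
  obtain r where r: "m < failures (a x) r"
    using failures_unbounded[OF often_right often_left] by blast
  have "returns k a d (x + 1) \<le> r" for d
  proof (rule ccontr)
    assume "\<not> ?thesis"
    then have "failures (a x) r \<le> returns k a (Suc d) x"
      using failures_mono[OF often_right] by simp
    then show False using r m[of "Suc d"] by simp
  qed
  then show "escapes k a (x + 1)" unfolding escapes_def by blast
next
  assume "escapes k a (x + 1)"
  then obtain m where m: "returns k a d (x + 1) \<le> m" for d unfolding escapes_def by blast
  have "returns k a d x \<le> failures (a x) (m + k)" for d
    using m by (cases d) (auto intro!: failures_mono often_right)
  then show "escapes k a x" unfolding escapes_def by blast
qed

lemma escapes_iff: "escapes k a x \<longleftrightarrow> escapes k a y"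
proof -
  have "escapes k a x \<longleftrightarrow> escapes k a 0" for x
  proof (induction x rule: int_induct[where k=0])
    case (step2 i) then show ?case using escapes_next[of k "i - 1"] by simp
  qed (auto simp: escapes_next[symmetric])
  then show ?thesis by blast
qed

lemma returns_le_total: "escapes k a x \<Longrightarrow> returns k a d x \<le> total_returns k a x"
  unfolding escapes_def total_returns_def by (rule LeastI_ex[THEN spec])

lemma total_attained:
  assumes "escapes k a x"
  shows "\<exists>d. returns k a d x = total_returns k a x"
proof (cases "total_returns k a x")
  case 0
  then show ?thesis by (intro exI[of _ 0]) simp
next
  case (Suc m)
  then have "\<not> (\<forall>d. returns k a d x \<le> m)"
    using not_less_Least[of m "\<lambda>m. \<forall>d. returns k a d x \<le> m"] unfolding total_returns_def by auto
  then show ?thesis using returns_le_total[OF assms] Suc by (metis le_antisym not_less_eq_eq)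
qed

text \<open>
  The counts \<open>returns\<close> increase to \<open>total_returns\<close> and are integers, so they attain it, and the recursion passes to the limit.
\<close>

lemma total_rec:
  assumes e: "escapes k a x"
  shows "total_returns k a x = failures (a x) (total_returns k a (x + 1) + k)"
proof (rule antisym)
  have e': "escapes k a (x + 1)" using e escapes_next by blast
  have "returns k a d x \<le> failures (a x) (total_returns k a (x + 1) + k)" for d
    by (cases d) (auto intro!: failures_mono often_right returns_le_total e')
  then show "total_returns k a x \<le> failures (a x) (total_returns k a (x + 1) + k)"
    unfolding total_returns_def[of k a x] by (intro Least_le) blast
  obtain d where "returns k a d (x + 1) = total_returns k a (x + 1)" using total_attained[OF e'] by blast
  then have "returns k a (Suc d) x = failures (a x) (total_returns k a (x + 1) + k)" by simp
  then show "failures (a x) (total_returns k a (x + 1) + k) \<le> total_returns k a x"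
    using returns_le_total[OF e, of "Suc d"] by simp
qed

lemma total_mono: 
  assumes "k \<le> l" "escapes l a x" shows "total_returns k a x \<le> total_returns l a x"
  using assms returns_mono[of k l] returns_le_total[OF assms(2)] 
  unfolding total_returns_def[of k] by (intro Least_le) (meson order_refl order_trans)

text \<open>
  If the last arrow used at each site points to the right, then the numbers of left arrows used solve
  the recursion of \<open>returns\<close>. They are nonnegative at the barrier, where \<open>returns\<close> is 0, and the
  recursion is monotone, so they dominate \<open>returns\<close>.
\<close>

lemma escapes_if_balanced_flow:
  assumes "\<And>x. x \<ge> 0 \<Longrightarrow> rights (a x) (c x) = lefts (a (x + 1)) (c (x + 1)) + k"
    and "\<And>x. x \<ge> 0 \<Longrightarrow> c x = 0 \<or> a x (c x - 1)"
  shows "escapes k a x"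
proof -
  have "returns k a d x \<le> lefts (a x) (c x)" if "x \<ge> 0" for d x
    using that
  proof (induction d arbitrary: x)
    case (Suc d)
    have "returns k a (Suc d) x \<le> failures (a x) (rights (a x) (c x))"
      using Suc by (auto intro!: failures_mono often_right simp: assms(1))
    also have "\<dots> = lefts (a x) (c x)"
      unfolding failures_def by (subst hit_rights) (use assms(2) Suc.prems in auto)
    finally show ?case .
  qed simp
  then have "escapes k a 0" unfolding escapes_def by blast
  then show ?thesis using escapes_iff by blast
qed

end

section \<open>Walks directed by arrows\<close>

text \<open>
  The state of the walk is its position together with the number of arrows used at every site.
\<close>

primrec walk_state :: "arrows \<Rightarrow> nat \<Rightarrow> int \<times> (int \<Rightarrow> nat)" where
  "walk_state a 0 = (0, \<lambda>_. 0)"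
| "walk_state a (Suc n) = (case walk_state a n of (y, u) \<Rightarrow>
     (y + (if a y (u y) then 1 else - 1), u(y := Suc (u y))))"

definition arrow_walk :: "arrows \<Rightarrow> path" where
  "arrow_walk a n = fst (walk_state a n)"

definition used :: "arrows \<Rightarrow> nat \<Rightarrow> int \<Rightarrow> nat" where
  "used a n = snd (walk_state a n)"

lemma arrow_walk_0 [simp]: "arrow_walk a 0 = 0" and used_0 [simp]: "used a 0 x = 0"
  by (simp_all add: arrow_walk_def used_def)

lemma arrow_walk_Suc: "arrow_walk a (Suc n) =
    arrow_walk a n + (if a (arrow_walk a n) (used a n (arrow_walk a n)) then 1 else - 1)"
  and used_Suc: "used a (Suc n) x = used a n x + of_bool (arrow_walk a n = x)"
  by (simp_all add: arrow_walk_def used_def split: prod.split)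

lemma used_eq_card: "used a n x = card {m. m < n \<and> arrow_walk a m = x}"
proof (induction n)
  case (Suc n)
  let ?S = "{m. m < n \<and> arrow_walk a m = x}"
  have "{m. m < Suc n \<and> arrow_walk a m = x} = (if arrow_walk a n = x then insert n ?S else ?S)"
    by (auto simp: less_Suc_eq)
  then show ?case using Suc by (simp add: used_Suc)
qed simp

definition visits :: "path \<Rightarrow> int \<Rightarrow> nat" where
  "visits Y x = card {n. Y n = x}"

lemma used_eventually:
  assumes "finite {n. arrow_walk a n = x}"
  shows "\<forall>\<^sub>F n in sequentially. used a n x = visits (arrow_walk a) x"
proof -
  obtain N where "\<forall>n. n \<ge> N \<longrightarrow> arrow_walk a n \<noteq> x" using assms unfolding finite_visits_iff by blast
  then have N: "n < N" if "arrow_walk a n = x" for n using that not_le by blast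
  have "{m. m < n \<and> arrow_walk a m = x} = {m. arrow_walk a m = x}" if "n \<ge> N" for n
    using N that less_le_trans by blast
  then have "used a n x = visits (arrow_walk a) x" if "n \<ge> N" for n
    using that by (simp add: used_eq_card visits_def)
  then show ?thesis unfolding eventually_sequentially by blast
qed

lemma used_unbounded:
  assumes "infinite {n. arrow_walk a n = x}"
  shows "\<exists>n. used a n x = i \<and> arrow_walk a n = x"
proof (induction i)
  case 0
  obtain n where n: "arrow_walk a n = x" using assms not_finite_existsD by blast
  define m where "m = (LEAST n. arrow_walk a n = x)"
  have "arrow_walk a m = x" unfolding m_def by (rule LeastI[of _ n]) (rule n)
  moreover have "{l. l < m \<and> arrow_walk a l = x} = {}" using not_less_Least m_def by blast
  ultimately show ?case unfolding used_eq_card by (metis card.empty)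
next
  case (Suc i)
  then obtain n where n: "used a n x = i" "arrow_walk a n = x" by blast
  have "\<exists>m>n. arrow_walk a m = x" using assms by (auto simp: infinite_nat_iff_unbounded)
  define m where "m = (LEAST m. n < m \<and> arrow_walk a m = x)"
  have m: "n < m \<and> arrow_walk a m = x" unfolding m_def by (rule LeastI_ex) fact
  have "l \<le> n" if "l < m" "arrow_walk a l = x" for l
  proof -
    have "\<not> (n < l \<and> arrow_walk a l = x)" using \<open>l < m\<close> unfolding m_def by (rule not_less_Least)
    then show ?thesis using that by simp
  qed
  then have "{l. l < m \<and> arrow_walk a l = x} = insert n {l. l < n \<and> arrow_walk a l = x}"
    using m n by (auto intro: le_neq_implies_less)
  then have "used a m x = Suc i" using n by (simp add: used_eq_card)
  with m show ?case by blast
qed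

text \<open>
  A site that is visited infinitely often has all its arrows used, so the walk also visits infinitely
  often every neighbour to which infinitely many of them point.
\<close>

lemma infinite_visits_neighbour:
  assumes inf: "infinite {n. arrow_walk a n = x}" and b: "\<exists>\<^sub>\<infinity>i. a x i = s"
  shows "infinite {n. arrow_walk a n = x + (if s then 1 else - 1)}"
proof -
  obtain t where t: "used a (t i) x = i" "arrow_walk a (t i) = x" for i
    using used_unbounded[OF inf] by metis
  have "inj t" using t(1) by (metis injI)
  then have "inj (\<lambda>i. Suc (t i))" by (auto simp: inj_def)
  then have "infinite ((\<lambda>i. Suc (t i)) ` {i. a x i = s})"
    using b unfolding frequently_cofinite by (meson finite_imageD inj_on_subset subset_UNIV)
  moreover have "(\<lambda>i. Suc (t i)) ` {i. a x i = s} \<subseteq> {n. arrow_walk a n = x + (if s then 1 else - 1)}"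
    using t by (auto simp: arrow_walk_Suc)
  ultimately show ?thesis using finite_subset by blast
qed

lemma recurrent_if_infinite_visits:
  assumes a: "balanced a" and x: "infinite {n. arrow_walk a n = x}"
  shows "recurrent (arrow_walk a)"
  unfolding recurrent_def
proof
  fix y
  show "infinite {n. arrow_walk a n = y}"
  proof (induction y rule: int_induct[where k=x])
    case (step1 i)
    then show ?case using infinite_visits_neighbour[of a i True] a by (auto simp: balanced_def)
  next
    case (step2 i)
    then show ?case using infinite_visits_neighbour[of a i False] a by (auto simp: balanced_def)
  qed (rule x)
qed

text \<open>
  A nearest-neighbour path cannot jump over a site.
\<close>

lemma stays_below:
  assumes "\<And>n. n \<ge> N \<Longrightarrow> arrow_walk a n \<noteq> x" "arrow_walk a N < x" "n \<ge> N"
  shows "arrow_walk a n < x"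
  using assms(3)
proof (induction n rule: dec_induct)
  case (step n)
  then show ?case using assms(1)[of "Suc n"] by (auto simp: arrow_walk_Suc split: if_splits)
qed (rule assms(2))

definition reflect :: "arrows \<Rightarrow> arrows" where
  "reflect a = (\<lambda>x i. \<not> a (- x) i)"

lemma reflect_reflect [simp]: "reflect (reflect a) = a"
  by (simp add: reflect_def fun_eq_iff)

lemma balanced_reflect [simp]: "balanced (reflect a) \<longleftrightarrow> balanced a"
proof -
  have "balanced (reflect a)" if "balanced a" for a
    using that by (simp add: balanced_def reflect_def)
  from this[of a] this[of "reflect a"] show ?thesis by (metis reflect_reflect)
qed

lemma walk_reflect: "arrow_walk (reflect a) n = - arrow_walk a n \<and> (\<forall>x. used (reflect a) n x = used a n (- x))"
  by (induction n) (auto simp: arrow_walk_Suc used_Suc reflect_def)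

lemma arrow_walk_reflect: "arrow_walk (reflect a) n = - arrow_walk a n"
  using walk_reflect by auto

lemma visits_reflect: "visits (arrow_walk (reflect a)) x = visits (arrow_walk a) (- x)"
  by (auto simp: visits_def arrow_walk_reflect intro!: arg_cong[where f=card])

lemma recurrent_reflect: "recurrent (arrow_walk (reflect a)) \<longleftrightarrow> recurrent (arrow_walk a)"
proof -
  have "{n. arrow_walk (reflect a) n = x} = {n. arrow_walk a n = - x}" for x
    by (auto simp: arrow_walk_reflect)
  then show ?thesis unfolding recurrent_def by (metis minus_minus)
qed

lemma at_top_reflect: "filterlim (arrow_walk (reflect a)) at_top sequentially \<longleftrightarrow> filterlim (arrow_walk a) at_bot sequentially"
proof -
  have e: "(Z \<le> - arrow_walk a n) = (arrow_walk a n \<le> - Z)" for Z n by linarith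
  have "filterlim (arrow_walk (reflect a)) at_top sequentially \<longleftrightarrow>
      (\<forall>Z. \<forall>\<^sub>F n in sequentially. arrow_walk a n \<le> - Z)"
    by (simp only: filterlim_at_top arrow_walk_reflect e)
  also have "\<dots> \<longleftrightarrow> (\<forall>Z. \<forall>\<^sub>F n in sequentially. arrow_walk a n \<le> Z)"
    by (metis minus_minus)
  finally show ?thesis by (simp only: filterlim_at_bot)
qed

lemma not_recurrent_cases:
  assumes "balanced a" "\<not> recurrent (arrow_walk a)"
  shows "filterlim (arrow_walk a) at_top sequentially \<or> filterlim (arrow_walk a) at_bot sequentially"
proof -
  have fin: "finite {n. arrow_walk a n = x}" for x using assms recurrent_if_infinite_visits by blast
  have lim: "filterlim (arrow_walk a) at_top sequentially"
    if fin: "\<And>x. finite {n. arrow_walk a n = x}" and pos: "\<forall>n\<ge>N. arrow_walk a n > 0" for a N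
    unfolding filterlim_at_top
  proof
    fix Z
    have "\<forall>\<^sub>F n in sequentially. arrow_walk a n \<noteq> x" for x
      using fin[of x] unfolding finite_visits_iff eventually_sequentially .
    then have "\<forall>\<^sub>F n in sequentially. \<forall>x\<in>{0..Z}. arrow_walk a n \<noteq> x"
      by (intro eventually_ball_finite) auto
    moreover have "\<forall>\<^sub>F n in sequentially. arrow_walk a n > 0"
      using pos unfolding eventually_sequentially by blast
    ultimately show "\<forall>\<^sub>F n in sequentially. Z \<le> arrow_walk a n"
      by eventually_elim force
  qed
  obtain N where N: "\<And>n. n \<ge> N \<Longrightarrow> arrow_walk a n \<noteq> 0" using fin[of 0] unfolding finite_visits_iff by blast
  show ?thesis
  proof (cases "arrow_walk a N < 0")
    case True
    then have "\<forall>n\<ge>N. arrow_walk (reflect a) n > 0" using stays_below[OF N] by (auto simp: arrow_walk_reflect)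
    moreover have "finite {n. arrow_walk (reflect a) n = x}" for x
    proof -
      have "{n. arrow_walk (reflect a) n = x} = {n. arrow_walk a n = - x}" by (auto simp: arrow_walk_reflect)
      then show ?thesis using fin[of "- x"] by simp
    qed
    ultimately show ?thesis using lim at_top_reflect by blast
  next
    case False
    then have "arrow_walk (reflect a) N < 0" using N[of N] by (simp add: arrow_walk_reflect)
    then have "\<forall>n\<ge>N. arrow_walk (reflect a) n < 0"
      using stays_below[of N "reflect a" 0] N by (auto simp: arrow_walk_reflect)
    then show ?thesis using lim[OF fin, of N] by (auto simp: arrow_walk_reflect)
  qed
qed

lemma eventually_above:
  assumes "filterlim (Y :: path) at_top sequentially"
  shows "\<forall>\<^sub>F n in sequentially. x < Y n"
  using assms unfolding filterlim_at_top
  by (elim allE[of _ "x + 1"]) (auto elim: eventually_mono)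

lemma finite_visits_at_top:
  assumes "filterlim Y at_top sequentially"
  shows "finite {n. (Y :: path) n = x}"
proof -
  obtain N where "\<forall>n\<ge>N. x < Y n"
    using eventually_above[OF assms] unfolding eventually_sequentially by blast
  then show ?thesis unfolding finite_visits_iff by (intro exI[of _ N]) auto
qed

text \<open>
  Had the walk left \<open>x\<close> to the left after its last visit, it could not have come back to go to \<open>+\<infinity>\<close>.
\<close>

lemma last_arrow_right:
  assumes lim: "filterlim (arrow_walk a) at_top sequentially" and x: "x \<ge> 0"
  shows "visits (arrow_walk a) x > 0" "a x (visits (arrow_walk a) x - 1)"
proof -
  let ?Y = "arrow_walk a" and ?V = "{n. arrow_walk a n = x}"
  have fin: "finite ?V" by (rule finite_visits_at_top[OF lim])
  have big: "\<exists>n\<ge>N. ?Y n > x" for N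
    using eventually_above[OF lim] unfolding eventually_sequentially by (meson nle_le)
  have ne: "?V \<noteq> {}"
  proof
    assume e: "?V = {}"
    have "x \<noteq> 0"
    proof
      assume "x = 0"
      then have "0 \<in> ?V" by simp
      with e show False by blast
    qed
    with x have Y0: "?Y 0 < x" by simp
    have "?Y n < x" for n by (rule stays_below[of 0, OF _ Y0]) (use e in blast, simp)
    then show False using big[of 0] by (meson less_asym)
  qed
  define n where "n = Max ?V"
  have n: "?Y n = x" using Max_in[OF fin ne] by (simp add: n_def)
  have after: "?Y m \<noteq> x" if "m \<ge> Suc n" for m
    using Max_ge[OF fin, of m] that by (auto simp: n_def)
  have "?V = insert n {m. m < n \<and> ?Y m = x}"
    using n after by (auto simp: not_less_eq_eq[symmetric]) (metis not_less_eq_eq nless_le)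
  then have v: "visits ?Y x = Suc (used a n x)" by (simp add: visits_def used_eq_card)
  then show "visits ?Y x > 0" by simp
  show "a x (visits ?Y x - 1)"
  proof (rule ccontr)
    assume "\<not> ?thesis"
    then have "?Y (Suc n) < x" using n v by (simp add: arrow_walk_Suc)
    then have s: "?Y (Suc n) < x" .
    have "?Y m < x" if "m \<ge> Suc n" for m by (rule stays_below[OF after s that])
    then show False using big[of "Suc n"] by (meson less_asym)
  qed
qed

section \<open>Flow and the next walk\<close>

definition drop_arrows :: "(int \<Rightarrow> nat) \<Rightarrow> arrows \<Rightarrow> arrows" where
  "drop_arrows c a x i = a x (c x + i)"

lemma INFM_nat_shift:
  assumes "\<exists>\<^sub>\<infinity>i. P (i::nat)" shows "\<exists>\<^sub>\<infinity>i. P (c + i)"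
  unfolding INFM_nat_le
proof
  fix m
  obtain n where "n \<ge> c + m" "P n" using assms unfolding INFM_nat_le by blast
  then show "\<exists>n\<ge>m. P (c + n)" by (intro exI[of _ "n - c"]) auto
qed

lemma drop_arrows_eq: "drop_arrows c a x i = a x (c x + i)"
  by (simp add: drop_arrows_def)

lemma balanced_drop_arrows: "balanced a \<Longrightarrow> balanced (drop_arrows c a)"
  by (auto simp: balanced_def drop_arrows_def intro: INFM_nat_shift)

text \<open>
  The net number of crossings of the edge between \<open>x\<close> and \<open>x + 1\<close> from left to right.
\<close>

definition flow :: "arrows \<Rightarrow> (int \<Rightarrow> nat) \<Rightarrow> int \<Rightarrow> int" where
  "flow a c x = int (rights (a x) (c x)) - int (lefts (a (x + 1)) (c (x + 1)))"

lemma flow_walk: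
  fixes a c defines "d \<equiv> drop_arrows c a"
  shows "flow a (\<lambda>x. c x + used d n x) x = flow a c x + of_bool (x \<ge> 0) - of_bool (x \<ge> arrow_walk d n)"
proof (induction n)
  case (Suc n)
  let ?y = "arrow_walk d n"
  have y: "d ?y (used d n ?y) = a ?y (c ?y + used d n ?y)"
    unfolding d_def by (rule drop_arrows_eq)
  consider "?y = x" | "?y = x + 1" | "?y \<noteq> x" "?y \<noteq> x + 1" by blast
  then show ?case
    using Suc y by cases (auto simp: flow_def used_Suc arrow_walk_Suc)
qed (simp add: flow_def)

definition total_used :: "arrows \<Rightarrow> (int \<Rightarrow> nat) \<Rightarrow> int \<Rightarrow> nat" where
  "total_used a c x = c x + visits (arrow_walk (drop_arrows c a)) x"

lemma flow_total_used_at_top: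
  assumes lim: "filterlim (arrow_walk (drop_arrows c a)) at_top sequentially"
  shows "flow a (total_used a c) x = flow a c x + of_bool (x \<ge> 0)"
proof -
  have "\<forall>\<^sub>F n in sequentially. x < arrow_walk (drop_arrows c a) n"
    by (rule eventually_above[OF lim])
  then have "\<forall>\<^sub>F n in sequentially. flow a (total_used a c) x = flow a c x + of_bool (x \<ge> 0)"
    using used_eventually[OF finite_visits_at_top[OF lim], of x]
      used_eventually[OF finite_visits_at_top[OF lim], of "x + 1"]
  proof eventually_elim
    case (elim n)
    then show ?case using flow_walk[of a c n x] by (simp add: total_used_def flow_def)
  qed
  then show ?thesis by simp
qed

lemma drop_arrows_reflect: "drop_arrows (\<lambda>x. c (- x)) (reflect a) = reflect (drop_arrows c a)"
  by (simp add: drop_arrows_def reflect_def fun_eq_iff)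

lemma total_used_reflect: "total_used (reflect a) (\<lambda>x. c (- x)) x = total_used a c (- x)"
  by (simp add: total_used_def drop_arrows_reflect visits_reflect)

lemma flow_reflect: "flow (reflect a) (\<lambda>x. c (- x)) x = - flow a c (- x - 1)"
  by (simp add: flow_def reflect_def)

text \<open>
  The state after \<open>k\<close> walks from 0 to \<open>+\<infinity>\<close>: every edge to the right of 0 has been crossed \<open>k\<close> times more
  often to the right than to the left, and every other edge equally often in both directions. The bound on
  the left arrows expresses that the walks use as few arrows as possible.
\<close>

definition after_right :: "arrows \<Rightarrow> nat \<Rightarrow> (int \<Rightarrow> nat) \<Rightarrow> bool" where
  "after_right a k c \<longleftrightarrow> (\<forall>x. flow a c x = (if x \<ge> 0 then int k else 0) \<and>
     (x \<ge> 0 \<longrightarrow> lefts (a x) (c x) \<le> total_returns k a x))"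

lemma after_right_0: "after_right a 0 (\<lambda>_. 0)"
  by (simp add: after_right_def flow_def)

text \<open>
  The least action principle: the next walk never uses more left arrows than \<open>k + 1\<close> escaping walkers
  have to. The first violation would be a left arrow at the present position \<open>x\<close>. At \<open>x + 1\<close> the bound
  still holds, so by conservation of flow at most \<open>total_returns (Suc k) a (x + 1) + k\<close> right arrows have
  been used at \<open>x\<close>. Hence this left arrow lies in front of the next right arrow after so many, and is
  one of those counted by \<open>total_returns (Suc k) a x\<close>.
\<close>

lemma lefts_le_total:
  assumes a: "balanced a" and c: "after_right a k c" and e: "escapes (Suc k) a 0" and x: "x \<ge> 0"
  shows "lefts (a x) (c x + used (drop_arrows c a) n x) \<le> total_returns (Suc k) a x"
  using x
proof (induction n arbitrary: x)
  case 0
  then show ?case using c total_mono[OF a, of k "Suc k" x] e escapes_iff[OF a, of "Suc k" x 0]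
    by (force simp: after_right_def)
next
  case (Suc n)
  let ?d = "drop_arrows c a"
  let ?C = "c x + used ?d n x"
  have IH: "lefts (a y) (c y + used ?d n y) \<le> total_returns (Suc k) a y" if "y \<ge> 0" for y
    using Suc that by auto
  show ?case
  proof (cases "arrow_walk ?d n = x \<and> \<not> a x ?C")
    case True
    have "int (rights (a x) ?C) = int (lefts (a (x + 1)) (c (x + 1) + used ?d n (x + 1))) + int k"
      using flow_walk[of a c n x] True Suc.prems c by (simp add: flow_def after_right_def)
    also have "\<dots> \<le> int (total_returns (Suc k) a (x + 1) + k)" using IH[of "x + 1"] Suc.prems by simp
    finally have "lefts (a x) ?C < failures (a x) (total_returns (Suc k) a (x + 1) + Suc k)"
      using True by (intro lefts_less_failures often_right a) auto
    also have "\<dots> = total_returns (Suc k) a x"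
      using total_rec[OF a, of "Suc k" x] e escapes_iff[OF a, of "Suc k" x 0] by simp
    finally show ?thesis using True by (simp add: used_Suc)
  next
    case False
    then show ?thesis using IH[OF Suc.prems] by (auto simp: used_Suc)
  qed
qed

text \<open>
  To the left of 0 the earlier walks have no net flow, so a walk to \<open>-\<infinity>\<close> would leave the reflected arrows
  with the flow of one escaping walker.
\<close>

lemma not_at_bot_after_right:
  assumes a: "balanced a" and c: "after_right a k c" and e: "\<not> escapes 1 (reflect a) 0"
  shows "\<not> filterlim (arrow_walk (drop_arrows c a)) at_bot sequentially"
proof
  let ?b = "reflect a" and ?d = "\<lambda>x. c (- x)"
  assume "filterlim (arrow_walk (drop_arrows c a)) at_bot sequentially"
  then have lim: "filterlim (arrow_walk (drop_arrows ?d ?b)) at_top sequentially"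
    by (simp add: drop_arrows_reflect at_top_reflect)
  have "escapes 1 ?b 0"
  proof (rule escapes_if_balanced_flow)
    show "balanced ?b" using a by simp
    fix x :: int assume x: "x \<ge> 0"
    have "flow ?b ?d x = 0" using c x by (simp add: flow_reflect after_right_def)
    then show "rights (?b x) (total_used ?b ?d x) = lefts (?b (x + 1)) (total_used ?b ?d (x + 1)) + 1"
      using flow_total_used_at_top[OF lim, of x] x by (simp add: flow_def)
    show "total_used ?b ?d x = 0 \<or> ?b x (total_used ?b ?d x - 1)"
      using last_arrow_right[OF lim x] by (auto simp: total_used_def drop_arrows_def)
  qed
  with e show False by simp
qed

text \<open>
  A walk to \<open>+\<infinity>\<close> produces the flow of \<open>k + 1\<close> escaping walkers, so these escape. Conversely, if they
  escape then the walk uses only finitely many of the left arrows at 0, so that it is not recurrent.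
\<close>

lemma next_walk_after_right:
  assumes a: "balanced a" and c: "after_right a k c" and e: "\<not> escapes 1 (reflect a) 0"
  shows "escapes (Suc k) a 0 \<Longrightarrow> filterlim (arrow_walk (drop_arrows c a)) at_top sequentially \<and>
          after_right a (Suc k) (total_used a c)"
    and "\<not> escapes (Suc k) a 0 \<Longrightarrow> recurrent (arrow_walk (drop_arrows c a))"
proof -
  let ?d = "drop_arrows c a" and ?t = "total_used a c"
  have d: "balanced ?d" by (rule balanced_drop_arrows[OF a])
  note cases = not_recurrent_cases[OF d] not_at_bot_after_right[OF assms]
  {
    assume lim: "filterlim (arrow_walk ?d) at_top sequentially"
    have fl: "flow a ?t x = (if x \<ge> 0 then int (Suc k) else 0)" for x
      using flow_total_used_at_top[OF lim] c by (simp add: after_right_def)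
    have "escapes (Suc k) a 0"
    proof (rule escapes_if_balanced_flow[OF a])
      fix x :: int assume x: "x \<ge> 0"
      show "rights (a x) (?t x) = lefts (a (x + 1)) (?t (x + 1)) + Suc k"
        using fl[of x] x by (simp add: flow_def)
      show "?t x = 0 \<or> a x (?t x - 1)"
        using last_arrow_right[OF lim x] by (auto simp: total_used_def drop_arrows_def)
    qed
    note this and fl
  } note top = this
  show "recurrent (arrow_walk ?d)" if "\<not> escapes (Suc k) a 0" using that top cases by blast
  show "filterlim (arrow_walk ?d) at_top sequentially \<and> after_right a (Suc k) ?t"
    if e': "escapes (Suc k) a 0"
  proof -
    note le = lefts_le_total[OF a c e']
    have "\<not> recurrent (arrow_walk ?d)"
    proof
      assume "recurrent (arrow_walk ?d)"
      then have inf: "infinite {n. arrow_walk ?d n = 0}" by (simp add: recurrent_def)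
      obtain r where r: "Suc (total_returns (Suc k) a 0) \<le> lefts (a 0) r"
        using ex_rights_ge[OF often_left[OF a]] by blast
      obtain n where "used ?d n 0 = r" using used_unbounded[OF inf] by blast
      then have "lefts (a 0) r \<le> lefts (a 0) (c 0 + used ?d n 0)" by (intro rights_mono) simp
      then show False using le[of 0 n] r by simp
    qed
    then have lim: "filterlim (arrow_walk ?d) at_top sequentially" using cases by blast
    have "lefts (a x) (?t x) \<le> total_returns (Suc k) a x" if "x \<ge> 0" for x
    proof -
      obtain n where "used ?d n x = visits (arrow_walk ?d) x"
        using eventually_happens'[OF sequentially_bot used_eventually[OF finite_visits_at_top[OF lim]]] by blast
      then show ?thesis using le[OF that, of n] by (simp add: total_used_def)
    qed
    then show ?thesis using lim top(2)[OF lim] by (simp add: after_right_def)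
  qed
qed

section \<open>The annealed law is determined by its one-step probabilities\<close>

definition step_prob :: "nat \<Rightarrow> nat \<Rightarrow> bool \<Rightarrow> sample \<Rightarrow> real" where
  "step_prob k n b z = (let q = current_cookie (leftover_env (k - 1) z) (walk k z) n in if b then q else 1 - q)"

definition step_event :: "nat \<Rightarrow> nat \<Rightarrow> bool \<Rightarrow> sample set" where
  "step_event k n b = {z \<in> space sample_space. walk k z (Suc n) = walk k z n + (if b then 1 else - 1)}"

text \<open>
  The defining property of the annealed law with the conditional probabilities integrated over the events
  of the past. In this form it can be verified without conditional expectations.
\<close>

definition step_law :: "env measure \<Rightarrow> sample measure \<Rightarrow> bool" where
  "step_law P M \<longleftrightarrow> prob_space M \<and> sets M = sets sample_space \<and> distr M env_space fst = P \<and>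
     (\<forall>k\<ge>1. (AE z in M. walk k z 0 = 0) \<and>
       (\<forall>n b. \<forall>A\<in>sets sample_space. 
          emeasure M (reveal k n -` A \<inter> step_event k n b) =
          (\<integral>\<^sup>+z. indicator A (reveal k n z) * ennreal (step_prob k n b z) \<partial>M)))"

lemma measurable_step_prob [measurable]: "step_prob k n b \<in> borel_measurable sample_space"
  unfolding step_prob_def Let_def by (cases b) simp_all

lemma step_event_sets [measurable]: "step_event k n b \<in> sets sample_space"
  unfolding step_event_def by measurable

lemma step_prob_01: "z \<in> space sample_space \<Longrightarrow> 0 \<le> step_prob k n b z \<and> step_prob k n b z \<le> 1"
  using current_cookie_01[OF measurable_space[OF measurable_leftover_env]]
  by (auto simp: step_prob_def Let_def)

lemma step_prob_reveal:
  assumes "k \<ge> 1" shows "step_prob k n b (reveal k n z) = step_prob k n b z"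
proof -
  have "current_cookie w (walk k (reveal k n z)) n = current_cookie w (walk k z) n" for w
    by (rule current_cookie_cong) (use assms in \<open>auto intro: walk_reveal\<close>)
  then show ?thesis using assms by (simp add: step_prob_def leftover_env_reveal)
qed

lemma annealed_law_step_law:
  assumes M: "annealed_law P M"
  shows "step_law P M"
proof -
  interpret M: prob_space M using M by (simp add: annealed_law_def)
  have sM [measurable_cong, simp]: "sets M = sets sample_space" using M by (simp add: annealed_law_def)
  then have spM [simp]: "space M = space sample_space" by (rule sets_eq_imp_space_eq)
  have "emeasure M (reveal k n -` A \<inter> step_event k n b) =
          (\<integral>\<^sup>+z. indicator A (reveal k n z) * ennreal (step_prob k n b z) \<partial>M)"
    if k: "k \<ge> 1" and A [measurable]: "A \<in> sets sample_space" for k n b A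
  proof -
    let ?F = "past k n" and ?E = "{z. walk k z (Suc n) = walk k z n + (if b then 1 else - 1)}"
    have re: "reveal k n \<in> space sample_space \<rightarrow> space sample_space"
      using measurable_space[OF measurable_reveal] by blast
    have F: "sets ?F = {reveal k n -` B \<inter> space sample_space | B. B \<in> sets sample_space}"
      unfolding past_def by (rule sets_vimage_algebra2[OF re])
    interpret MF: finite_measure_subalgebra M ?F
    proof
      show "subalgebra M ?F" unfolding subalgebra_def
        using F measurable_sets[OF measurable_reveal] by (auto simp: past_def)
    qed
    have ce: "AE z in M. real_cond_exp M ?F (indicator ?E) z = step_prob k n b z"
    proof -
      have "excited_walk M (past k) (leftover_env (k - 1)) (walk k) 0" using M k by (simp add: annealed_law_def)
      then show ?thesis unfolding excited_walk_def step_prob_def Let_def by (cases b) simp_all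
    qed
    let ?A = "reveal k n -` A \<inter> space sample_space"
    have AF: "?A \<in> sets ?F" using F A by blast
    have Am [measurable]: "?A \<in> sets sample_space" by (rule measurable_sets[OF measurable_reveal A])
    have Em: "(indicator ?E :: sample \<Rightarrow> real) \<in> borel_measurable sample_space"
    proof -
      have "Measurable.pred sample_space (\<lambda>z. walk k z (Suc n) = walk k z n + (if b then 1 else - 1))"
        by measurable
      then show ?thesis unfolding indicator_def mem_Collect_eq of_bool_def by measurable
    qed
    have Ei: "integrable M (indicator ?E :: _ \<Rightarrow> real)"
      by (rule M.integrable_const_bound[of _ 1]) (use Em in auto)
    have "measure M (?A \<inter> step_event k n b) = (\<integral>z. indicator (?A \<inter> step_event k n b) z \<partial>M)" by simp
    also have "\<dots> = (\<integral>z\<in>?A. (indicator ?E z :: real) \<partial>M)"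
      unfolding set_lebesgue_integral_def
      by (rule Bochner_Integration.integral_cong) (auto simp: indicator_def step_event_def)
    also have "\<dots> = (\<integral>z\<in>?A. real_cond_exp M ?F (indicator ?E) z \<partial>M)"
      by (rule MF.real_cond_exp_intA[OF Ei AF])
    also have "\<dots> = (\<integral>z\<in>?A. step_prob k n b z \<partial>M)"
      unfolding set_lebesgue_integral_def 
      by (rule integral_cong_AE) (use ce in auto)
    finally have m: "measure M (?A \<inter> step_event k n b) = (\<integral>z\<in>?A. step_prob k n b z \<partial>M)" .
    have "(\<integral>\<^sup>+z. indicator A (reveal k n z) * ennreal (step_prob k n b z) \<partial>M) = 
       (\<integral>\<^sup>+z. ennreal (indicator ?A z * step_prob k n b z) \<partial>M)"
      by (rule nn_integral_cong) (auto simp: indicator_def)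
    also have "\<dots> = ennreal (\<integral>z. indicator ?A z * step_prob k n b z \<partial>M)"
      by (rule nn_integral_eq_integral, rule M.integrable_const_bound[of _ 1])
         (use step_prob_01 in \<open>auto simp: indicator_def\<close>)
    also have "\<dots> = emeasure M (?A \<inter> step_event k n b)"
      using m by (simp add: M.emeasure_eq_measure set_lebesgue_integral_def)
    also have "?A \<inter> step_event k n b = reveal k n -` A \<inter> step_event k n b"
      by (auto simp: step_event_def)
    finally show ?thesis by simp
  qed
  then show ?thesis
    using M unfolding step_law_def annealed_law_def excited_walk_def by simp
qed

definition cylinder :: "env set \<Rightarrow> (nat \<Rightarrow> nat \<Rightarrow> int set) \<Rightarrow> sample set" where
  "cylinder A B = {z \<in> space sample_space. fst z \<in> A \<and> (\<forall>i m. snd z i m \<in> B i m)}"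

text \<open>
  The condition on \<open>B\<close> restricts only finitely many walks at finitely many times. These sets are stable
  under intersection and generate the sample space, and whether \<open>z\<close> lies in one of them can be read off
  from \<open>reveal k n z\<close> for large \<open>k\<close> and \<open>n\<close>.
\<close>

definition cylinders :: "sample set set" where
  "cylinders = {cylinder A B | A B N. A \<in> sets env_space \<and> (\<forall>i m. N \<le> i \<or> N \<le> m \<longrightarrow> B i m = UNIV)}"

lemma space_sample_space: "space sample_space = space env_space \<times> UNIV"
  by (auto simp: sample_space_def space_pair_measure space_PiM)

lemma cylinder_in_cylinders: "A \<in> sets env_space \<Longrightarrow> (\<And>i m. N \<le> i \<or> N \<le> m \<Longrightarrow> B i m = UNIV) \<Longrightarrow> cylinder A B \<in> cylinders"
  unfolding cylinders_def by blast

lemma cylinder_sets: "C \<in> cylinders \<Longrightarrow> C \<in> sets sample_space"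
proof -
  assume "C \<in> cylinders"
  then obtain A B where C: "C = cylinder A B" and A [measurable]: "A \<in> sets env_space"
    unfolding cylinders_def by blast
  have w: "(\<lambda>z. snd z i m) \<in> sample_space \<rightarrow>\<^sub>M count_space UNIV" for i m
    using measurable_walk_at[of "Suc i" m] by (simp add: walk_def)
  have "Measurable.pred sample_space (\<lambda>z. snd z i m \<in> B i m)" for i m
    using w by measurable
  note [measurable] = this
  show ?thesis unfolding C cylinder_def by measurable
qed

lemma Int_stable_cylinders: "Int_stable cylinders"
proof (rule Int_stableI)
  fix C D assume "C \<in> cylinders" "D \<in> cylinders"
  then obtain A B N A' B' N' where *: "C = cylinder A B" "A \<in> sets env_space" "\<forall>i m. N \<le> i \<or> N \<le> m \<longrightarrow> B i m = UNIV"
    "D = cylinder A' B'" "A' \<in> sets env_space" "\<forall>i m. N' \<le> i \<or> N' \<le> m \<longrightarrow> B' i m = UNIV"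
    unfolding cylinders_def by blast
  then have "C \<inter> D = cylinder (A \<inter> A') (\<lambda>i m. B i m \<inter> B' i m)" by (auto simp: cylinder_def)
  also have "\<dots> \<in> cylinders" by (rule cylinder_in_cylinders[of _ "max N N'"]) (use * in auto)
  finally show "C \<inter> D \<in> cylinders" .
qed

lemma sets_sample_space: "sets sample_space = sigma_sets (space sample_space) cylinders"
proof
  show "sigma_sets (space sample_space) cylinders \<subseteq> sets sample_space"
    by (rule sets.sigma_sets_subset) (use cylinder_sets in blast)
  let ?N = "sigma (space sample_space) cylinders"
  have cs: "cylinders \<subseteq> Pow (space sample_space)" using cylinder_sets sets.sets_into_space by blast
  have sN: "C \<in> sets ?N" if "C \<in> cylinders" for C using that cs by simp
  have spN: "space ?N = space sample_space" by (rule space_measure_of[OF cs])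
  have "fst \<in> ?N \<rightarrow>\<^sub>M env_space"
  proof (rule measurableI)
    fix A assume A: "A \<in> sets env_space"
    have "fst -` A \<inter> space ?N = cylinder A (\<lambda>_ _. UNIV)" using spN by (auto simp: cylinder_def)
    then show "fst -` A \<inter> space ?N \<in> sets ?N" using sN[OF cylinder_in_cylinders[OF A]] by simp
  qed (use spN in \<open>auto simp: space_sample_space\<close>)
  moreover have "(\<lambda>z. snd z i m) \<in> ?N \<rightarrow>\<^sub>M count_space UNIV" for i m
  proof (rule measurableI)
    fix X :: "int set"
    define B where "B i' m' = (if i' = i \<and> m' = m then X else UNIV)" for i' m'
    have "(\<lambda>z. snd z i m) -` X \<inter> space ?N = cylinder (space env_space) B"
      using spN by (auto simp: cylinder_def B_def space_sample_space)
    moreover have "cylinder (space env_space) B \<in> cylinders"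
      by (rule cylinder_in_cylinders[of _ "Suc (max i m)"]) (auto simp: B_def)
    ultimately show "(\<lambda>z. snd z i m) -` X \<inter> space ?N \<in> sets ?N" using sN by simp
  qed simp
  then have "snd \<in> ?N \<rightarrow>\<^sub>M (\<Pi>\<^sub>M k\<in>UNIV. path_space)"
    by (intro measurable_PiM_single' measurable_pathI) (auto simp: space_PiM)
  ultimately have "(\<lambda>z. z) \<in> ?N \<rightarrow>\<^sub>M sample_space"
    unfolding sample_space_def using measurable_Pair[of fst _ _ snd] by simp
  then have "(\<lambda>z. z) -` S \<inter> space ?N \<in> sets ?N" if "S \<in> sets sample_space" for S
    using that by (rule measurable_sets)
  then show "sets sample_space \<subseteq> sigma_sets (space sample_space) cylinders"
    using sets.sets_into_space[of _ sample_space] spN cs by (auto simp: Int_absorb2)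
qed

lemma sample_measure_eqI:
  assumes "prob_space M" "sets M = sets sample_space" "prob_space M'" "sets M' = sets sample_space"
    and "\<And>A B N. A \<in> sets env_space \<Longrightarrow> (\<And>i m. N \<le> i \<or> N \<le> m \<Longrightarrow> B i m = UNIV) \<Longrightarrow>
       emeasure M (cylinder A B) = emeasure M' (cylinder A B)"
  shows "M = M'"
proof (rule measure_eqI_generator_eq[OF Int_stable_cylinders, of "space sample_space" _ _ "\<lambda>_. space sample_space"])
  show "cylinders \<subseteq> Pow (space sample_space)" using cylinder_sets sets.sets_into_space by blast
  show "emeasure M X = emeasure M' X" if "X \<in> cylinders" for X
    using that assms(5) unfolding cylinders_def by blast
  show "range (\<lambda>_::nat. space sample_space) \<subseteq> cylinders"
  proof -
    have "cylinder (space env_space) (\<lambda>_ _. UNIV) = space sample_space"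
      by (auto simp: cylinder_def space_sample_space)
    then show ?thesis using cylinder_in_cylinders[of "space env_space" 0 "\<lambda>_ _. UNIV"] by auto
  qed
  show "emeasure M (space sample_space) \<noteq> \<infinity>"
    using assms(1) by (simp add: prob_space.finite_measure finite_measure.emeasure_finite)
qed (use assms sets_sample_space in auto)

lemma emeasure_cylinder_cong:
  assumes M: "prob_space M" "sets M = sets sample_space"
    and f: "f \<in> sample_space \<rightarrow>\<^sub>M sample_space"
    and g: "g \<in> sample_space \<rightarrow>\<^sub>M sample_space"
    and n: "AE z in M. f z \<in> cylinder A B \<longleftrightarrow> g z \<in> cylinder A B" 
    and A: "A \<in> sets env_space" "\<And>i m. N \<le> i \<or> N \<le> m \<Longrightarrow> B i m = UNIV"
  shows "emeasure (distr M sample_space f) (cylinder A B) = emeasure (distr M sample_space g) (cylinder A B)"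
proof -
  have spM: "space M = space sample_space" by (rule sets_eq_imp_space_eq[OF M(2)])
  have C [measurable]: "cylinder A B \<in> sets sample_space" by (rule cylinder_sets[OF cylinder_in_cylinders[OF A]])
  note [measurable] = f g and [measurable_cong] = M(2)
  have "emeasure M (f -` cylinder A B \<inter> space M) = emeasure M (g -` cylinder A B \<inter> space M)"
    by (rule emeasure_eq_AE) (use n in auto)
  then show ?thesis by (simp add: emeasure_distr)
qed

text \<open>
  One more step of the walk \<open>k\<close>, appended to a sample point of which all is revealed up to time \<open>n\<close>.
\<close>

definition extend :: "nat \<Rightarrow> nat \<Rightarrow> bool \<Rightarrow> sample \<Rightarrow> sample" where
  "extend k n b z = (fst z, (snd z)(k - 1 := (walk k z)(Suc n := walk k z n + (if b then 1 else - 1))))"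

lemma measurable_extend [measurable]: "extend k n b \<in> sample_space \<rightarrow>\<^sub>M sample_space"
proof -
  have w: "(\<lambda>z. snd z i m) \<in> sample_space \<rightarrow>\<^sub>M count_space UNIV" for i m
    using measurable_walk_at[of "Suc i" m] by (simp add: walk_def)
  have "(\<lambda>z. ((snd z)(k - 1 := (walk k z)(Suc n := walk k z n + (if b then 1 else - 1)))) i m)
      \<in> sample_space \<rightarrow>\<^sub>M count_space UNIV" for i m
  proof -
    have "(\<lambda>z. snd z (k - 1) n + (if b then 1 else - 1)) \<in> sample_space \<rightarrow>\<^sub>M count_space UNIV"
      by (rule measurable_compose[OF w]) simp
    then show ?thesis using w[of i m] unfolding walk_def
      by (cases "i = k - 1"; cases "m = Suc n") simp_all
  qed
  then have "(\<lambda>z. (snd z)(k - 1 := (walk k z)(Suc n := walk k z n + (if b then 1 else - 1))))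
      \<in> sample_space \<rightarrow>\<^sub>M (\<Pi>\<^sub>M k\<in>UNIV. path_space)"
    by (intro measurable_PiM_single' measurable_pathI) (auto simp: space_PiM)
  then show ?thesis
    unfolding extend_def by (subst (2) sample_space_def) (rule measurable_Pair[OF measurable_fst_sample])
qed

lemma reveal_Suc_eq_extend:
  "k \<ge> 1 \<Longrightarrow> z \<in> step_event k n b \<Longrightarrow> reveal k (Suc n) z = extend k n b (reveal k n z)"
  by (auto simp: reveal_def extend_def step_event_def walk_def fun_eq_iff le_Suc_eq)

text \<open>
  The law of \<open>reveal k n\<close> determines that of \<open>reveal k (Suc n)\<close> by the step probabilities, and for
  \<open>n \<rightarrow> \<infinity>\<close> it determines that of \<open>reveal (Suc k) 0\<close> on the cylinders.
\<close>

lemma step_law_unique: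
  assumes M: "step_law P M" and M': "step_law P M'"
  shows "M = M'"
proof -
  have aux: "prob_space N \<and> sets N = sets sample_space \<and> space N = space sample_space" if "step_law P N" for N
    using that by (auto simp: step_law_def dest: sets_eq_imp_space_eq)
  let ?D = "\<lambda>N k n. distr N sample_space (reveal k n)"
  have Dprob: "prob_space (?D N k n)" if "step_law P N" for N k n
    by (rule prob_space.prob_space_distr) (use aux[OF that] measurable_reveal in \<open>auto cong: measurable_cong_sets\<close>)
  have step: "emeasure (?D N k (Suc n)) B = (\<Sum>b\<in>UNIV.
       (\<integral>\<^sup>+y. indicator (extend k n b -` B \<inter> space sample_space) y * ennreal (step_prob k n b y) \<partial>?D N k n))"
    if N: "step_law P N" and k: "k \<ge> 1" and B [measurable]: "B \<in> sets sample_space" for N k n B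
  proof -
    note [measurable_cong, simp] = aux[OF N, THEN conjunct2, THEN conjunct1]
    have [simp]: "space N = space sample_space" using aux[OF N] by simp
    interpret N: prob_space N using aux[OF N] by simp
    have law: "emeasure N (reveal k n -` A \<inter> step_event k n b) =
          (\<integral>\<^sup>+z. indicator A (reveal k n z) * ennreal (step_prob k n b z) \<partial>N)"
      if "A \<in> sets sample_space" for A b using N k that unfolding step_law_def by blast
    have disj: "step_event k n True \<inter> step_event k n False = {}" by (auto simp: step_event_def)
    have re: "reveal k n z \<in> space sample_space" if "z \<in> space sample_space" for z
      using measurable_space[OF measurable_reveal that] .
    have "emeasure N (step_event k n True \<union> step_event k n False) = emeasure N (step_event k n True) + emeasure N (step_event k n False)"
      by (rule plus_emeasure[symmetric]) (use disj in auto)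
    also have "\<dots> = (\<integral>\<^sup>+z. ennreal (step_prob k n True z) + ennreal (step_prob k n False z) \<partial>N)"
    proof -
      have "emeasure N (step_event k n b) = (\<integral>\<^sup>+z. ennreal (step_prob k n b z) \<partial>N)" for b
      proof -
        have "reveal k n -` space sample_space \<inter> step_event k n b = step_event k n b"
          using re by (auto simp: step_event_def)
        moreover have "(\<integral>\<^sup>+z. indicator (space sample_space) (reveal k n z) * ennreal (step_prob k n b z) \<partial>N)
            = (\<integral>\<^sup>+z. ennreal (step_prob k n b z) \<partial>N)"
          by (rule nn_integral_cong) (use re in auto)
        ultimately show ?thesis using law[of "space sample_space" b] by simp
      qed
      then show ?thesis by (simp add: nn_integral_add)
    qed
    also have "\<dots> = (\<integral>\<^sup>+z. 1 \<partial>N)"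
    proof (rule nn_integral_cong)
      fix z assume "z \<in> space N"
      then have "0 \<le> step_prob k n True z" "0 \<le> step_prob k n False z" using step_prob_01 by auto
      moreover have "step_prob k n True z + step_prob k n False z = 1" by (simp add: step_prob_def Let_def)
      ultimately show "ennreal (step_prob k n True z) + ennreal (step_prob k n False z) = 1"
        by (simp add: ennreal_plus[symmetric] del: ennreal_plus)
    qed
    finally have "emeasure N (step_event k n True \<union> step_event k n False) = 1" using N.emeasure_space_1 by simp
    then have ae: "AE z in N. z \<in> step_event k n True \<union> step_event k n False"
      by (intro N.AE_prob_1) (simp add: N.emeasure_eq_measure)
    let ?A = "\<lambda>b. extend k n b -` B \<inter> space sample_space"
    have A: "?A b \<in> sets sample_space" for b by (rule measurable_sets[OF measurable_extend B])
    have m: "reveal k n -` ?A b \<inter> step_event k n b \<in> sets N" for b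
    proof -
      have "reveal k n -` ?A b \<inter> step_event k n b = (reveal k n -` ?A b \<inter> space sample_space) \<inter> step_event k n b"
        by (auto simp: step_event_def)
      then show ?thesis using measurable_sets[OF measurable_reveal A, of k n b] by auto
    qed
    have "emeasure (?D N k (Suc n)) B = emeasure N (reveal k (Suc n) -` B \<inter> space sample_space)"
      by (subst emeasure_distr) auto
    also have "\<dots> = emeasure N ((reveal k n -` ?A True \<inter> step_event k n True) \<union> (reveal k n -` ?A False \<inter> step_event k n False))"
    proof (rule emeasure_eq_AE)
      show "AE z in N. (z \<in> reveal k (Suc n) -` B \<inter> space sample_space) =
        (z \<in> (reveal k n -` ?A True \<inter> step_event k n True) \<union> (reveal k n -` ?A False \<inter> step_event k n False))"
        using ae
      proof eventually_elim
        case (elim z)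
        then have z: "z \<in> space sample_space" by (auto simp: step_event_def)
        from elim show ?case
        proof
          assume T: "z \<in> step_event k n True"
          then have "z \<notin> step_event k n False" using disj by blast
          then show ?thesis using T re[OF z] z reveal_Suc_eq_extend[OF k T] by auto
        next
          assume T: "z \<in> step_event k n False"
          then have "z \<notin> step_event k n True" using disj by blast
          then show ?thesis using T re[OF z] z reveal_Suc_eq_extend[OF k T] by auto
        qed
      qed
    qed (use m measurable_sets[OF measurable_reveal B] in auto)
    also have "\<dots> = (\<Sum>b\<in>UNIV. emeasure N (reveal k n -` ?A b \<inter> step_event k n b))"
    proof -
      show ?thesis
        by (subst plus_emeasure[symmetric, OF m m]) (use disj in \<open>auto simp: UNIV_bool add.commute\<close>)
    qed
    also have "\<dots> = (\<Sum>b\<in>UNIV.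
       (\<integral>\<^sup>+y. indicator (?A b) y * ennreal (step_prob k n b y) \<partial>?D N k n))"
    proof (rule sum.cong[OF refl])
      fix b
      have "(\<integral>\<^sup>+y. indicator (?A b) y * ennreal (step_prob k n b y) \<partial>?D N k n) =
         (\<integral>\<^sup>+z. indicator (?A b) (reveal k n z) * ennreal (step_prob k n b (reveal k n z)) \<partial>N)"
        by (rule nn_integral_distr) (use A[of b] in measurable)
      then show "emeasure N (reveal k n -` ?A b \<inter> step_event k n b) = 
         (\<integral>\<^sup>+y. indicator (?A b) y * ennreal (step_prob k n b y) \<partial>?D N k n)"
        unfolding law[OF A] by (simp only: step_prob_reveal[OF k])
    qed
    finally show ?thesis .
  qed
  have init: "emeasure (?D N 1 0) (cylinder A B) = emeasure P A * of_bool (\<forall>i m. 0 \<in> B i m)"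
    if N: "step_law P N" and A [measurable]: "A \<in> sets env_space" and B: "cylinder A B \<in> sets sample_space" for N A B
  proof -
    note [measurable_cong, simp] = aux[OF N, THEN conjunct2, THEN conjunct1]
    have [simp]: "space N = space sample_space" using aux[OF N] by simp
    have w: "AE z in N. walk 1 z 0 = 0" using N by (simp add: step_law_def)
    have r: "reveal 1 0 z = (fst z, \<lambda>i m. 0)" if "walk 1 z 0 = 0" for z
      using that by (auto simp: reveal_def fun_eq_iff)
    have "emeasure (?D N 1 0) (cylinder A B) = emeasure N (reveal 1 0 -` cylinder A B \<inter> space N)"
      using B by (subst emeasure_distr) auto
    also have "\<dots> = emeasure N {z \<in> space N. fst z \<in> A \<and> (\<forall>i m. 0 \<in> B i m)}"
    proof (rule emeasure_eq_AE)
      show "AE z in N. (z \<in> reveal 1 0 -` cylinder A B \<inter> space N) = 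
         (z \<in> {z \<in> space N. fst z \<in> A \<and> (\<forall>i m. 0 \<in> B i m)})"
        using w AE_space
      proof eventually_elim
        case (elim z)
        then show ?case using r[OF elim(1)] by (simp add: cylinder_def space_sample_space mem_Times_iff)
      qed
      show "reveal 1 0 -` cylinder A B \<inter> space N \<in> sets N" using measurable_sets[OF measurable_reveal B] by simp
    qed measurable
    also have "\<dots> = emeasure (distr N env_space fst) A * of_bool (\<forall>i m. 0 \<in> B i m)"
    proof (cases "\<forall>i m. 0 \<in> B i m")
      case True
      then show ?thesis by (subst emeasure_distr) (auto intro!: arg_cong[where f="emeasure N"])
    next
      case False
      then have "{z \<in> space N. fst z \<in> A \<and> (\<forall>i m. 0 \<in> B i m)} = {}" by blast
      then show ?thesis using False by (simp only: emeasure_empty) simp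
    qed
    finally show ?thesis using N by (simp add: step_law_def)
  qed
  have limit: "emeasure (?D N (Suc k) 0) (cylinder A B) = emeasure (?D N k n) (cylinder A B)"
    if N: "step_law P N" and k: "k \<ge> 1" and A: "A \<in> sets env_space" "\<And>i m. n \<le> i \<or> n \<le> m \<Longrightarrow> B i m = UNIV"
    for N k n A B
  proof (rule emeasure_cylinder_cong[OF _ _ measurable_reveal measurable_reveal _ A])
    have "AE z in N. walk (Suc k) z 0 = 0" using N by (simp add: step_law_def)
    then show "AE z in N. (reveal (Suc k) 0 z \<in> cylinder A B) = (reveal k n z \<in> cylinder A B)"
    proof eventually_elim
      case (elim z)
      have "snd (reveal (Suc k) 0 z) i m = snd (reveal k n z) i m" if "i < n" "m < n" for i m
        using elim that by (auto simp: reveal_def)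
      then have "(snd (reveal (Suc k) 0 z) i m \<in> B i m) = (snd (reveal k n z) i m \<in> B i m)" for i m
        using A(2)[of i m] by (cases "n \<le> i \<or> n \<le> m") auto
      moreover have "fst (reveal (Suc k) 0 z) = fst (reveal k n z)" by (simp add: reveal_def)
      ultimately show ?case by (simp add: cylinder_def space_sample_space mem_Times_iff)
    qed
  qed (use aux[OF N] in auto)
  have n_step: "?D M k (Suc n) = ?D M' k (Suc n)" if "?D M k n = ?D M' k n" "k \<ge> 1" for k n
    by (rule measure_eqI) (use step[OF M] step[OF M'] that in auto)
  have n_all: "?D M k n = ?D M' k n" if "?D M k 0 = ?D M' k 0" "k \<ge> 1" for k n
    using that by (induction n) (auto intro: n_step)
  have D: "?D M k n = ?D M' k n" if "k \<ge> 1" for k n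
    using that
  proof (induction k arbitrary: n rule: nat_induct_at_least)
    case base
    have "?D M 1 0 = ?D M' 1 0"
    proof (rule sample_measure_eqI)
      fix A and B :: "nat \<Rightarrow> nat \<Rightarrow> int set" and N :: nat assume A: "A \<in> sets env_space" "\<And>i m. N \<le> i \<or> N \<le> m \<Longrightarrow> B i m = UNIV"
      then have "cylinder A B \<in> sets sample_space" by (rule cylinder_sets[OF cylinder_in_cylinders])
      then show "emeasure (?D M 1 0) (cylinder A B) = emeasure (?D M' 1 0) (cylinder A B)"
        using init[OF M A(1)] init[OF M' A(1)] by simp
    qed (use Dprob M M' in auto)
    then show ?case by (rule n_all) simp
  next
    case (Suc k)
    have "?D M (Suc k) 0 = ?D M' (Suc k) 0"
    proof (rule sample_measure_eqI)
      fix A and B :: "nat \<Rightarrow> nat \<Rightarrow> int set" and N :: nat assume A: "A \<in> sets env_space" "\<And>i m. N \<le> i \<or> N \<le> m \<Longrightarrow> B i m = UNIV"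
      show "emeasure (?D M (Suc k) 0) (cylinder A B) = emeasure (?D M' (Suc k) 0) (cylinder A B)"
        using limit[OF M Suc.hyps A] limit[OF M' Suc.hyps A] Suc.IH by simp
    qed (use Dprob M M' in auto)
    then show ?case by (rule n_all) simp
  qed
  show ?thesis
  proof (rule sample_measure_eqI)
    fix A and B :: "nat \<Rightarrow> nat \<Rightarrow> int set" and N :: nat assume A: "A \<in> sets env_space" "\<And>i m. N \<le> i \<or> N \<le> m \<Longrightarrow> B i m = UNIV"
    have "emeasure (distr L sample_space (\<lambda>z. z)) (cylinder A B) = emeasure (?D L (Suc N) 0) (cylinder A B)"
      if L: "step_law P L" for L
    proof (rule emeasure_cylinder_cong[OF _ _ _ measurable_reveal _ A])
      have "(snd z i m \<in> B i m) = (snd (reveal (Suc N) 0 z) i m \<in> B i m)" for z i m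
        using A(2)[of i m] by (cases "i < N") (auto simp: reveal_def walk_def)
      moreover have "fst (reveal (Suc N) 0 z) = fst z" for z by (simp add: reveal_def)
      ultimately have "(z \<in> cylinder A B) = (reveal (Suc N) 0 z \<in> cylinder A B)" for z
        by (simp add: cylinder_def space_sample_space mem_Times_iff)
      then show "AE z in L. (z \<in> cylinder A B) = (reveal (Suc N) 0 z \<in> cylinder A B)" by simp
    qed (use aux[OF L] in auto)
    moreover have "distr L sample_space (\<lambda>z. z) = L" if "step_law P L" for L
      using aux[OF that] by (intro distr_id2) simp
    ultimately show "emeasure M (cylinder A B) = emeasure M' (cylinder A B)"
      using D[of "Suc N" 0] M M' by (metis le_add1 plus_1_eq_Suc)
  qed (use aux M M' in auto)
qed

section \<open>Walks driven by seeds\<close>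

text \<open>
  The index of a seed consists of the number of a family of seeds, of a site, and of the position in the
  stack at this site. New families come into play after walks that are not transient.
\<close>

type_synonym seed_index = "nat \<times> int \<times> nat"

definition seed_measure :: "('i \<Rightarrow> real) measure" where "seed_measure = (\<Pi>\<^sub>M i\<in>UNIV. unif)"

lemma prob_seed_measure: "prob_space seed_measure"
  unfolding seed_measure_def by (intro prob_space_PiM prob_unif)

lemma space_seed_measure [simp]: "space seed_measure = UNIV"
  by (simp add: seed_measure_def space_PiM)

lemma measurable_seed [measurable]: "(\<lambda>u. u i) \<in> borel_measurable seed_measure"
proof -
  have "(\<lambda>u. u i) \<in> seed_measure \<rightarrow>\<^sub>M unif"
    unfolding seed_measure_def by (rule measurable_component_singleton) simp
  then show ?thesis by (subst measurable_cong_sets[OF refl, of borel unif]) simp_all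
qed

lemma nn_integral_PiM_upd:
  assumes \<mu>: "prob_space \<mu>" and f [measurable]: "f \<in> borel_measurable (\<Pi>\<^sub>M i\<in>UNIV. \<mu>)"
  shows "(\<integral>\<^sup>+u. f u \<partial>(\<Pi>\<^sub>M i\<in>UNIV. \<mu>)) = (\<integral>\<^sup>+u. (\<integral>\<^sup>+v. f (u(i := v)) \<partial>\<mu>) \<partial>(\<Pi>\<^sub>M i\<in>UNIV. \<mu>))"
proof -
  let ?S = "\<Pi>\<^sub>M i\<in>UNIV. \<mu>"
  interpret U: prob_space \<mu> by (rule \<mu>)
  interpret S: prob_space ?S by (intro prob_space_PiM \<mu>)
  interpret US: pair_prob_space \<mu> ?S ..
  have d: "distr (\<mu> \<Otimes>\<^sub>M ?S) ?S (\<lambda>(v, u). u(i := v)) = ?S"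
    using distr_pair_PiM_eq_PiM[of UNIV "\<lambda>_. \<mu>" i] \<mu> by simp
  have m [measurable]: "(\<lambda>(v, u). u(i := v)) \<in> \<mu> \<Otimes>\<^sub>M ?S \<rightarrow>\<^sub>M ?S"
    unfolding split_beta' by (rule measurable_fun_upd[where J=UNIV]) auto
  have m2 [measurable]: "(\<lambda>(v, u). f (u(i := v))) \<in> borel_measurable (\<mu> \<Otimes>\<^sub>M ?S)"
    using measurable_compose[OF m f] by (simp add: split_beta')
  have "(\<integral>\<^sup>+u. f u \<partial>?S) = (\<integral>\<^sup>+u. f u \<partial>distr (\<mu> \<Otimes>\<^sub>M ?S) ?S (\<lambda>(v, u). u(i := v)))"
    by (simp only: d)
  also have "\<dots> = (\<integral>\<^sup>+(v, u). f (u(i := v)) \<partial>(\<mu> \<Otimes>\<^sub>M ?S))"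
    by (subst nn_integral_distr[OF m]) (simp_all add: split_beta')
  also have "\<dots> = (\<integral>\<^sup>+u. (\<integral>\<^sup>+v. f (u(i := v)) \<partial>\<mu>) \<partial>?S)"
    using US.nn_integral_snd[OF m2] by simp
  finally show ?thesis .
qed

text \<open>
  The index \<open>L u\<close> and the quantities \<open>h u\<close> and \<open>q u\<close> are found without looking at the seed with the index
  \<open>L u\<close>. So this seed is still uniform when they are given, as one sees by resampling it separately on
  each of the countably many events \<open>L u = l\<close>.
\<close>

lemma nn_integral_fresh_seed:
  fixes L :: "('i :: countable \<Rightarrow> real) \<Rightarrow> 'i" and h :: "_ \<Rightarrow> ennreal"
  assumes L [measurable]: "L \<in> seed_measure \<rightarrow>\<^sub>M count_space UNIV"
    and h [measurable]: "h \<in> borel_measurable seed_measure" and q [measurable]: "q \<in> borel_measurable seed_measure"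
    and q01: "\<And>u. 0 \<le> q u \<and> q u \<le> 1"
    and inv: "\<And>u v. L (u(L u := v)) = L u" "\<And>u v. h (u(L u := v)) = h u" "\<And>u v. q (u(L u := v)) = q u"
  shows "(\<integral>\<^sup>+u. h u * of_bool ((u (L u) < q u) = b) \<partial>seed_measure) =
         (\<integral>\<^sup>+u. h u * ennreal (if b then q u else 1 - q u) \<partial>seed_measure)"
proof -
  have [measurable]: "(\<lambda>u. u (L u)) \<in> borel_measurable seed_measure"
    by (rule measurable_compose_countable[where f="\<lambda>l u. u l" and g=L]) measurable
  have split: "(\<integral>\<^sup>+u. g u \<partial>seed_measure) = (\<Sum>n. \<integral>\<^sup>+u. g u * of_bool (to_nat (L u) = n) \<partial>seed_measure)"
    if [measurable]: "g \<in> borel_measurable seed_measure" for g :: "_ \<Rightarrow> ennreal"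
  proof -
    have "g u = (\<Sum>n. g u * of_bool (to_nat (L u) = n))" for u
      using sums_If_finite_set[of "{to_nat (L u)}" "\<lambda>_. g u"] suminf_finite[of "{to_nat (L u)}" "\<lambda>n. g u * of_bool (to_nat (L u) = n)"]
      by simp
    then have "(\<integral>\<^sup>+u. g u \<partial>seed_measure) = (\<integral>\<^sup>+u. (\<Sum>n. g u * of_bool (to_nat (L u) = n)) \<partial>seed_measure)" by simp
    also have "\<dots> = (\<Sum>n. \<integral>\<^sup>+u. g u * of_bool (to_nat (L u) = n) \<partial>seed_measure)"
      by (rule nn_integral_suminf) measurable
    finally show ?thesis .
  qed
  have Lu: "L (u(l := v)) = l \<longleftrightarrow> L u = l" for u l v
  proof
    assume "L u = l" then show "L (u(l := v)) = l" using inv(1)[of u v] by simp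
  next
    assume "L (u(l := v)) = l" then show "L u = l" using inv(1)[of "u(l := v)" "u l"] by simp
  qed
  let ?f = "\<lambda>u. h u * of_bool ((u (L u) < q u) = b)" and ?g = "\<lambda>u. h u * ennreal (if b then q u else 1 - q u)"
  have "(\<integral>\<^sup>+u. ?f u * of_bool (to_nat (L u) = n) \<partial>seed_measure) = (\<integral>\<^sup>+u. ?g u * of_bool (to_nat (L u) = n) \<partial>seed_measure)" for n
  proof (cases "\<exists>l::'i. to_nat l = n")
    case True
    then obtain l :: 'i where l: "n = to_nat l" by blast
    have "(\<integral>\<^sup>+u. ?f u * of_bool (L u = l) \<partial>seed_measure) =
        (\<integral>\<^sup>+u. (\<integral>\<^sup>+v. ?f (u(l := v)) * of_bool (L (u(l := v)) = l) \<partial>unif) \<partial>seed_measure)"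
      unfolding seed_measure_def by (rule nn_integral_PiM_upd[OF prob_unif]) (fold seed_measure_def, measurable)
    also have "\<dots> = (\<integral>\<^sup>+u. ?g u * of_bool (L u = l) \<partial>seed_measure)"
    proof (rule nn_integral_cong)
      fix u
      show "(\<integral>\<^sup>+v. ?f (u(l := v)) * of_bool (L (u(l := v)) = l) \<partial>unif) = ?g u * of_bool (L u = l)"
      proof (cases "L u = l")
        case True
        interpret U: prob_space unif by (rule prob_unif)
        have "(\<integral>\<^sup>+v. ?f (u(l := v)) * of_bool (L (u(l := v)) = l) \<partial>unif) =
            (\<integral>\<^sup>+v. h u * indicator {v. (v < q u) = b} v \<partial>unif)"
          by (rule nn_integral_cong) (use True inv in \<open>auto simp: Lu indicator_def of_bool_def\<close>)
        also have "\<dots> = h u * emeasure unif {v. (v < q u) = b}"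
          by (rule nn_integral_cmult_indicator) measurable
        also have "\<dots> = ?g u"
          using unif_less[of "q u" b] q01[of u] by (simp only: U.emeasure_eq_measure)
        finally show ?thesis using True by simp
      qed (simp add: Lu)
    qed
    finally show ?thesis using l by simp
  qed auto
  moreover have "(\<integral>\<^sup>+u. ?f u \<partial>seed_measure) = (\<Sum>n. \<integral>\<^sup>+u. ?f u * of_bool (to_nat (L u) = n) \<partial>seed_measure)"
    by (rule split) measurable
  moreover have "(\<integral>\<^sup>+u. ?g u \<partial>seed_measure) = (\<Sum>n. \<integral>\<^sup>+u. ?g u * of_bool (to_nat (L u) = n) \<partial>seed_measure)"
    by (rule split) measurable
  ultimately show ?thesis by simp
qed

text \<open>
  The state between two walks consists of the present environment, of the number of the family of seeds
  in use, and of the number of seeds of this family that have been used at each site.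
\<close>

definition arrows_of :: "env \<times> nat \<times> (int \<Rightarrow> nat) \<Rightarrow> (seed_index \<Rightarrow> real) \<Rightarrow> arrows" where
  "arrows_of S u = (\<lambda>x i. u (fst (snd S), x, snd (snd S) x + i) < fst S x i)"

text \<open>
  A transient walk only uses up seeds. After another walk the environment is reset, and a fresh family
  keeps the later walks independent of the past.
\<close>

definition next_stage :: "env \<times> nat \<times> (int \<Rightarrow> nat) \<Rightarrow> path \<Rightarrow> env \<times> nat \<times> (int \<Rightarrow> nat)" where
  "next_stage S Y = (leftover (fst S) Y, if transient Y then fst (snd S) else Suc (fst (snd S)),
     \<lambda>x. if transient Y then snd (snd S) x + visits Y x else 0)"

primrec stage :: "nat \<Rightarrow> env \<times> (seed_index \<Rightarrow> real) \<Rightarrow> env \<times> nat \<times> (int \<Rightarrow> nat)" where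
  "stage 0 s = (fst s, 0, \<lambda>_. 0)"
| "stage (Suc j) s = next_stage (stage j s) (arrow_walk (arrows_of (stage j s) (snd s)))"

definition stage_walk :: "nat \<Rightarrow> env \<times> (seed_index \<Rightarrow> real) \<Rightarrow> path" where
  "stage_walk j s = arrow_walk (arrows_of (stage j s) (snd s))"

definition arrow_sample :: "env \<times> (seed_index \<Rightarrow> real) \<Rightarrow> sample" where
  "arrow_sample s = (fst s, \<lambda>j. stage_walk j s)"

lemma walk_arrow_sample [simp]: "walk (Suc j) (arrow_sample s) = stage_walk j s"
  by (simp add: walk_def arrow_sample_def)

lemma fst_arrow_sample [simp]: "fst (arrow_sample s) = fst s"
  by (simp add: arrow_sample_def)

lemma leftover_env_arrow_sample [simp]: "leftover_env j (arrow_sample s) = fst (stage j s)"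
  by (induction j) (auto simp: next_stage_def stage_walk_def)

definition seed_used :: "nat \<Rightarrow> nat \<Rightarrow> env \<times> (seed_index \<Rightarrow> real) \<Rightarrow> seed_index" where
  "seed_used j n s = (let S = stage j s; Y = stage_walk j s in
     (fst (snd S), Y n, snd (snd S) (Y n) + used (arrows_of S (snd s)) n (Y n)))"

lemma current_cookie_arrow_walk:
  "current_cookie \<omega> (arrow_walk a) n = \<omega> (arrow_walk a n) (used a n (arrow_walk a n))"
  by (simp add: current_cookie_def used_eq_card)

lemma stage_walk_Suc: "stage_walk j s (Suc n) = stage_walk j s n +
   (if snd s (seed_used j n s) < current_cookie (fst (stage j s)) (stage_walk j s) n then 1 else - 1)"
  by (simp add: stage_walk_def arrow_walk_Suc seed_used_def Let_def current_cookie_arrow_walk arrows_of_def)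

text \<open>
  The seeds that the previous walks may have used. The walk of the stage \<open>j\<close> looks only at seeds outside
  \<open>spent (stage j s)\<close>, never twice at the same one, and only at seeds inside \<open>spent (stage (Suc j) s)\<close>.
\<close>

definition spent :: "env \<times> nat \<times> (int \<Rightarrow> nat) \<Rightarrow> seed_index set" where
  "spent S = {(f, x, i). f < fst (snd S) \<or> f = fst (snd S) \<and> i < snd (snd S) x}"

lemma used_less_visits: "transient (arrow_walk a) \<Longrightarrow> used a n (arrow_walk a n) < visits (arrow_walk a) (arrow_walk a n)"
  unfolding used_eq_card visits_def transient_def by (intro psubset_card_mono) auto

lemma used_strict: "m < n \<Longrightarrow> arrow_walk a m = arrow_walk a n \<Longrightarrow> used a m (arrow_walk a m) < used a n (arrow_walk a n)"
  unfolding used_eq_card by (intro psubset_card_mono) auto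

lemma spent_mono: "spent (stage j s) \<subseteq> spent (stage (Suc j) s)"
  by (auto simp: spent_def next_stage_def)

lemma seed_used_spent: "seed_used j n s \<in> spent (stage (Suc j) s)"
  using used_less_visits[of "arrows_of (stage j s) (snd s)" n]
  by (auto simp: seed_used_def Let_def spent_def next_stage_def stage_walk_def)

lemma seed_used_fresh: "seed_used j n s \<notin> spent (stage j s)"
  by (auto simp: seed_used_def Let_def spent_def)

lemma seed_used_inj: "m < n \<Longrightarrow> seed_used j m s \<noteq> seed_used j n s"
  using used_strict[of m n "arrows_of (stage j s) (snd s)"]
  by (auto simp: seed_used_def Let_def stage_walk_def)

lemma walk_state_cong:
  assumes "\<And>m. m < n \<Longrightarrow> a (arrow_walk a m) (used a m (arrow_walk a m)) = b (arrow_walk a m) (used a m (arrow_walk a m))"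
  shows "walk_state b n = walk_state a n"
  using assms
proof (induction n)
  case (Suc n)
  then have "walk_state b n = walk_state a n" by simp
  then show ?case using Suc.prems[of n]
    by (cases "walk_state a n") (simp add: arrow_walk_def used_def)
qed simp

lemma walk_state_stage_cong:
  assumes "stage j (\<omega>, u') = stage j (\<omega>, u)" "\<And>m. m < n \<Longrightarrow> u' (seed_used j m (\<omega>, u)) = u (seed_used j m (\<omega>, u))"
  shows "walk_state (arrows_of (stage j (\<omega>, u')) u') n = walk_state (arrows_of (stage j (\<omega>, u)) u) n"
  by (rule walk_state_cong)
    (use assms in \<open>simp add: arrows_of_def seed_used_def stage_walk_def Let_def\<close>)

lemma stage_walk_cong:
  assumes "stage j (\<omega>, u') = stage j (\<omega>, u)" "\<And>m. m < n \<Longrightarrow> u' (seed_used j m (\<omega>, u)) = u (seed_used j m (\<omega>, u))"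
  shows "stage_walk j (\<omega>, u') n = stage_walk j (\<omega>, u) n"
  using walk_state_stage_cong[OF assms] by (simp add: stage_walk_def arrow_walk_def)

lemma seed_used_cong:
  assumes "stage j (\<omega>, u') = stage j (\<omega>, u)" "\<And>m. m < n \<Longrightarrow> u' (seed_used j m (\<omega>, u)) = u (seed_used j m (\<omega>, u))"
  shows "seed_used j n (\<omega>, u') = seed_used j n (\<omega>, u)"
  using walk_state_stage_cong[OF assms] assms(1)
  by (simp add: seed_used_def Let_def stage_walk_def arrow_walk_def used_def)

lemma stage_cong:
  assumes "\<And>l. l \<in> spent (stage j (\<omega>, u)) \<Longrightarrow> u' l = u l"
  shows "stage j (\<omega>, u') = stage j (\<omega>, u)"
  using assms
proof (induction j)
  case (Suc j)
  have IH: "stage j (\<omega>, u') = stage j (\<omega>, u)"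
    using Suc.IH Suc.prems spent_mono[of j "(\<omega>, u)"] by blast
  have "stage_walk j (\<omega>, u') n = stage_walk j (\<omega>, u) n" for n
    by (rule stage_walk_cong[OF IH Suc.prems]) (rule seed_used_spent)
  then have "stage_walk j (\<omega>, u') = stage_walk j (\<omega>, u)" by blast
  then show ?case using IH by (simp add: stage_walk_def)
qed simp

lemma spent_mono_le: "i \<le> j \<Longrightarrow> spent (stage i s) \<subseteq> spent (stage j s)"
  by (rule lift_Suc_mono_le[of "\<lambda>i. spent (stage i s)"]) (rule spent_mono)

text \<open>
  Neither the past nor the place of the next seed depends on the value of the next seed.
\<close>

lemma fresh_seed_invariance:
  assumes l: "l = seed_used j n (\<omega>, u)"
  shows "reveal (Suc j) n (arrow_sample (\<omega>, u(l := v))) = reveal (Suc j) n (arrow_sample (\<omega>, u))"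
    and "seed_used j n (\<omega>, u(l := v)) = l"
proof -
  let ?u = "u(l := v)"
  have sp: "k \<in> spent (stage j (\<omega>, u)) \<Longrightarrow> ?u k = u k" for k
    using seed_used_fresh[of j n "(\<omega>, u)"] l by auto
  have st: "stage i (\<omega>, ?u) = stage i (\<omega>, u)" if "i \<le> j" for i
    by (rule stage_cong[OF sp]) (use spent_mono_le[OF that, of "(\<omega>, u)"] in blast)
  have su: "?u (seed_used j m (\<omega>, u)) = u (seed_used j m (\<omega>, u))" if "m < n" for m
    using seed_used_inj[OF that, of j "(\<omega>, u)"] l by auto
  show "seed_used j n (\<omega>, ?u) = l" unfolding l[symmetric] by (simp add: seed_used_cong[OF st su] l[symmetric])
  have "stage_walk i (\<omega>, ?u) m = stage_walk i (\<omega>, u) m" if "i < j \<or> i = j \<and> m \<le> n" for i m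
  proof (rule stage_walk_cong)
    show "stage i (\<omega>, ?u) = stage i (\<omega>, u)" using st that by auto
    fix m' assume "m' < m"
    show "?u (seed_used i m' (\<omega>, u)) = u (seed_used i m' (\<omega>, u))"
    proof (cases "i < j")
      case True
      then have "seed_used i m' (\<omega>, u) \<in> spent (stage j (\<omega>, u))"
        using seed_used_spent[of i m' "(\<omega>, u)"] spent_mono_le[of "Suc i" j "(\<omega>, u)"] by auto
      then show ?thesis by (rule sp)
    next
      case False
      then show ?thesis using su[of m'] that \<open>m' < m\<close> by auto
    qed
  qed
  then show "reveal (Suc j) n (arrow_sample (\<omega>, ?u)) = reveal (Suc j) n (arrow_sample (\<omega>, u))"
    by (simp add: reveal_def less_Suc_eq cong: if_cong) (simp add: fun_eq_iff)
qed

lemma measurable_walk_state: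
  assumes a: "\<And>x i. Measurable.pred N (\<lambda>z. a z x i)"
  shows "(\<lambda>z. arrow_walk (a z) n) \<in> N \<rightarrow>\<^sub>M count_space UNIV \<and> (\<forall>x. (\<lambda>z. used (a z) n x) \<in> N \<rightarrow>\<^sub>M count_space UNIV)"
proof (induction n)
  case (Suc n)
  have Y [measurable]: "(\<lambda>z. arrow_walk (a z) n) \<in> N \<rightarrow>\<^sub>M count_space UNIV" using Suc by blast
  have u [measurable]: "(\<lambda>z. used (a z) n x) \<in> N \<rightarrow>\<^sub>M count_space UNIV" for x using Suc by blast
  have uY: "(\<lambda>z. used (a z) n (arrow_walk (a z) n)) \<in> N \<rightarrow>\<^sub>M count_space UNIV"
    by (rule measurable_compose_countable[where f="\<lambda>x z. used (a z) n x", OF u Y])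
  have "(\<lambda>z. a z (arrow_walk (a z) n) i) \<in> N \<rightarrow>\<^sub>M count_space UNIV" for i
    by (rule measurable_compose_countable[where f="\<lambda>x z. a z x i", OF a Y]) 
  then have [measurable]: "Measurable.pred N (\<lambda>z. a z (arrow_walk (a z) n) (used (a z) n (arrow_walk (a z) n)))"
    by (rule measurable_compose_countable[where f="\<lambda>i z. a z (arrow_walk (a z) n) i", OF _ uY])
  show ?case unfolding arrow_walk_Suc used_Suc of_bool_def by (intro conjI allI) measurable
qed simp

lemma measurable_arrow_walk:
  assumes "\<And>x i. Measurable.pred N (\<lambda>z. a z x i)"
  shows "(\<lambda>z. arrow_walk (a z)) \<in> N \<rightarrow>\<^sub>M path_space"
  using measurable_walk_state[where N=N and a=a, OF assms] by (intro measurable_pathI) blast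

lemma measurable_visits:
  assumes "g \<in> N \<rightarrow>\<^sub>M path_space"
  shows "(\<lambda>z. visits (g z) x) \<in> N \<rightarrow>\<^sub>M count_space UNIV"
proof -
  have g [measurable]: "(\<lambda>z. g z m) \<in> N \<rightarrow>\<^sub>M count_space UNIV" for m
    using measurable_compose[OF assms(1) measurable_path_coord] .
  have "Measurable.pred N (\<lambda>z. visits (g z) x = l)" for l
  proof -
    have e: "(\<lambda>z. visits (g z) x = l) = (\<lambda>z. (\<exists>K. \<forall>n. n \<ge> K \<longrightarrow> g z n \<noteq> x) \<and>
         (\<exists>K. (\<forall>n. n \<ge> K \<longrightarrow> g z n \<noteq> x) \<and> (\<Sum>n<K. if g z n = x then 1 else 0) = l) \<or>
         \<not> (\<exists>K. \<forall>n. n \<ge> K \<longrightarrow> g z n \<noteq> x) \<and> l = 0)"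
    proof
      fix z
      show "(visits (g z) x = l) = ((\<exists>K. \<forall>n. n \<ge> K \<longrightarrow> g z n \<noteq> x) \<and>
         (\<exists>K. (\<forall>n. n \<ge> K \<longrightarrow> g z n \<noteq> x) \<and> (\<Sum>n<K. if g z n = x then 1 else 0) = l) \<or>
         \<not> (\<exists>K. \<forall>n. n \<ge> K \<longrightarrow> g z n \<noteq> x) \<and> l = 0)"
        unfolding visits_def finite_visits_iff[symmetric]
        using card_visits_iff[of "g z" x l] by (cases "finite {n. g z n = x}") auto
    qed
    have [measurable]: "Measurable.pred N (\<lambda>z. g z n \<noteq> x)" for n by measurable
    show ?thesis unfolding e by measurable
  qed
  then have "(\<lambda>z. visits (g z) x) -` {l} \<inter> space N \<in> sets N" for l
    by (simp only: pred_def vimage_def Int_def conj_commute singleton_iff mem_Collect_eq)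
  then show ?thesis by (simp add: measurable_count_space_eq2_countable)
qed

lemma measurable_transient:
  assumes "g \<in> N \<rightarrow>\<^sub>M path_space"
  shows "Measurable.pred N (\<lambda>z. transient (g z))"
proof -
  have g [measurable]: "(\<lambda>z. g z m) \<in> N \<rightarrow>\<^sub>M count_space UNIV" for m
    using measurable_compose[OF assms(1) measurable_path_coord] .
  have [measurable]: "Measurable.pred N (\<lambda>z. g z n \<noteq> x)" for n x by measurable
  have e: "(\<lambda>z. transient (g z)) = (\<lambda>z. \<forall>x. \<exists>K. \<forall>n. n \<ge> K \<longrightarrow> g z n \<noteq> x)"
    by (simp add: transient_def finite_visits_iff)
  show ?thesis unfolding e by measurable
qed

lemma measurable_Pair_countable:
  fixes F :: "_ \<Rightarrow> 'a::countable" and G :: "_ \<Rightarrow> 'b::countable"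
  assumes "F \<in> N \<rightarrow>\<^sub>M count_space UNIV" "G \<in> N \<rightarrow>\<^sub>M count_space UNIV"
  shows "(\<lambda>s. (F s, G s)) \<in> N \<rightarrow>\<^sub>M count_space UNIV"
  using measurable_Pair[OF assms] by (simp add: pair_measure_countable)

context
  fixes P :: "env measure"
  assumes P: "prob_space P" and sets_P [measurable_cong]: "sets P = sets env_space"
begin

lemma measurable_stage:
  "(\<lambda>s. fst (stage j s)) \<in> P \<Otimes>\<^sub>M seed_measure \<rightarrow>\<^sub>M env_space \<and>
   (\<lambda>s. fst (snd (stage j s))) \<in> P \<Otimes>\<^sub>M seed_measure \<rightarrow>\<^sub>M count_space UNIV \<and>
   (\<forall>x. (\<lambda>s. snd (snd (stage j s)) x) \<in> P \<Otimes>\<^sub>M seed_measure \<rightarrow>\<^sub>M count_space UNIV) \<and>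
   (\<forall>x i. Measurable.pred (P \<Otimes>\<^sub>M seed_measure) (\<lambda>s. arrows_of (stage j s) (snd s) x i))"
proof -
  let ?N = "P \<Otimes>\<^sub>M (seed_measure :: (seed_index \<Rightarrow> real) measure)"
  have arr: "Measurable.pred ?N (\<lambda>s. arrows_of (S s) (snd s) x i)"
    if w [measurable]: "(\<lambda>s. fst (S s)) \<in> ?N \<rightarrow>\<^sub>M env_space"
      and f: "(\<lambda>s. fst (snd (S s))) \<in> ?N \<rightarrow>\<^sub>M count_space UNIV"
      and c: "\<And>x. (\<lambda>s. snd (snd (S s)) x) \<in> ?N \<rightarrow>\<^sub>M count_space UNIV" for S x i
  proof -
    note [measurable] = f c
    have [measurable]: "(\<lambda>s. fst (S s) x i) \<in> borel_measurable ?N"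
      using measurable_compose[OF w measurable_cookie] .
    have [measurable]: "(\<lambda>s. snd s l) \<in> borel_measurable ?N" for l
      using measurable_compose[OF measurable_snd measurable_seed] .
    have "(\<lambda>s. (fst (snd (S s)), x, snd (snd (S s)) x + i)) \<in> ?N \<rightarrow>\<^sub>M count_space UNIV"
      by (intro measurable_Pair_countable) measurable
    then have "(\<lambda>s. snd s (fst (snd (S s)), x, snd (snd (S s)) x + i)) \<in> borel_measurable ?N"
      by (rule measurable_compose_countable[where f="\<lambda>l s. snd s l", rotated]) measurable
    then show ?thesis unfolding arrows_of_def by measurable
  qed
  show ?thesis
  proof (induction j)
    case 0
    have "fst \<in> ?N \<rightarrow>\<^sub>M env_space" by measurable
    then show ?case using arr[of "\<lambda>s. (fst s, 0, \<lambda>_. 0)"] by simp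
  next
    case (Suc j)
    let ?Y = "\<lambda>s. arrow_walk (arrows_of (stage j s) (snd s))"
    have Y: "?Y \<in> ?N \<rightarrow>\<^sub>M path_space" using Suc by (intro measurable_arrow_walk) blast
    note [measurable] = measurable_visits[OF Y] measurable_transient[OF Y]
    have w: "(\<lambda>s. fst (stage (Suc j) s)) \<in> ?N \<rightarrow>\<^sub>M env_space"
      using Suc Y by (simp add: next_stage_def measurable_leftover)
    have [measurable]: "(\<lambda>s. fst (snd (stage j s))) \<in> ?N \<rightarrow>\<^sub>M count_space UNIV"
      "(\<lambda>s. snd (snd (stage j s)) x) \<in> ?N \<rightarrow>\<^sub>M count_space UNIV" for x using Suc by blast+
    have f: "(\<lambda>s. fst (snd (stage (Suc j) s))) \<in> ?N \<rightarrow>\<^sub>M count_space UNIV"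
      by (simp add: next_stage_def)
    have c: "(\<lambda>s. snd (snd (stage (Suc j) s)) x) \<in> ?N \<rightarrow>\<^sub>M count_space UNIV" for x
      by (simp add: next_stage_def)
    show ?case using w f c arr[OF w f c] by blast
  qed
qed

lemma measurable_stage_walk: "stage_walk j \<in> P \<Otimes>\<^sub>M seed_measure \<rightarrow>\<^sub>M path_space"
  unfolding stage_walk_def using measurable_stage[of j] by (intro measurable_arrow_walk) blast

lemma measurable_arrow_sample: "arrow_sample \<in> P \<Otimes>\<^sub>M seed_measure \<rightarrow>\<^sub>M sample_space"
proof -
  have "(\<lambda>s. \<lambda>j. stage_walk j s) \<in> P \<Otimes>\<^sub>M seed_measure \<rightarrow>\<^sub>M (\<Pi>\<^sub>M k\<in>UNIV. path_space)"
    by (intro measurable_PiM_single') (auto simp: measurable_stage_walk)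
  moreover have "fst \<in> P \<Otimes>\<^sub>M seed_measure \<rightarrow>\<^sub>M env_space" by measurable
  ultimately show ?thesis unfolding arrow_sample_def sample_space_def by (rule measurable_Pair[rotated])
qed

lemma measurable_seed_used: "seed_used j n \<in> P \<Otimes>\<^sub>M seed_measure \<rightarrow>\<^sub>M count_space UNIV"
proof -
  let ?N = "P \<Otimes>\<^sub>M (seed_measure :: (seed_index \<Rightarrow> real) measure)"
  note st = measurable_stage[of j]
  have w: "(\<lambda>s. arrow_walk (arrows_of (stage j s) (snd s)) n) \<in> ?N \<rightarrow>\<^sub>M count_space UNIV"
    "(\<lambda>s. used (arrows_of (stage j s) (snd s)) n x) \<in> ?N \<rightarrow>\<^sub>M count_space UNIV" for x
    using measurable_walk_state[where N="?N" and a="\<lambda>s. arrows_of (stage j s) (snd s)" and n=n] st by blast+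
  have [measurable]: "(\<lambda>s. snd (snd (stage j s)) x) \<in> ?N \<rightarrow>\<^sub>M count_space UNIV" for x using st by blast
  note [measurable] = w(2)
  have "(\<lambda>s. snd (snd (stage j s)) x + used (arrows_of (stage j s) (snd s)) n x) \<in> ?N \<rightarrow>\<^sub>M count_space UNIV" for x
    by measurable
  then have "(\<lambda>s. snd (snd (stage j s)) (stage_walk j s n) + used (arrows_of (stage j s) (snd s)) n (stage_walk j s n)) \<in> ?N \<rightarrow>\<^sub>M count_space UNIV"
    unfolding stage_walk_def using w(1)
    by (rule measurable_compose_countable[where f="\<lambda>x s. snd (snd (stage j s)) x + used (arrows_of (stage j s) (snd s)) n x"])
  then show ?thesis unfolding seed_used_def Let_def
    by (intro measurable_Pair_countable) (use st w in \<open>auto simp: stage_walk_def\<close>)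
qed

definition arrow_law :: "sample measure" where
  "arrow_law = distr (P \<Otimes>\<^sub>M seed_measure) sample_space arrow_sample"

text \<open>
  The cookie that the walk finds is a function of the past, and the seed that it is compared with is fresh.
\<close>

lemma step_law_arrow_law: "step_law P arrow_law"
proof -
  interpret P: prob_space P by (rule P)
  interpret S: prob_space "seed_measure :: (seed_index \<Rightarrow> real) measure" by (rule prob_seed_measure)
  interpret PS: pair_prob_space P "seed_measure :: (seed_index \<Rightarrow> real) measure" ..
  note so [measurable] = measurable_arrow_sample
  let ?N = "P \<Otimes>\<^sub>M (seed_measure :: (seed_index \<Rightarrow> real) measure)"
  have 1: "distr arrow_law env_space fst = P"
  proof -
    have "distr arrow_law env_space fst = distr ?N env_space (fst \<circ> arrow_sample)"
      unfolding arrow_law_def by (rule distr_distr) measurable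
    also have "\<dots> = distr ?N P fst"
      by (rule distr_cong) (auto simp: sets_P)
    also have "\<dots> = P" by (rule S.distr_pair_fst)
    finally show ?thesis .
  qed
  have 2: "AE z in arrow_law. walk (Suc j) z 0 = 0" for j
    unfolding arrow_law_def by (subst AE_distr_iff) (auto simp: stage_walk_def)
  have 3: "emeasure arrow_law (reveal (Suc j) n -` A \<inter> step_event (Suc j) n b) =
          (\<integral>\<^sup>+z. indicator A (reveal (Suc j) n z) * ennreal (step_prob (Suc j) n b z) \<partial>arrow_law)"
    if A [measurable]: "A \<in> sets sample_space" for j n b A
  proof -
    define T where "T s = reveal (Suc j) n (arrow_sample s)" for s
    have T [measurable]: "T \<in> ?N \<rightarrow>\<^sub>M sample_space" unfolding T_def by measurable
    let ?q = "\<lambda>s. step_prob (Suc j) n True (T s)"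
    have qT: "step_prob (Suc j) n b (arrow_sample s) = (if b then ?q s else 1 - ?q s)" for s b
    proof -
      have "step_prob (Suc j) n b (arrow_sample s) = step_prob (Suc j) n b (T s)"
        unfolding T_def by (rule step_prob_reveal[symmetric]) simp
      then show ?thesis by (simp add: step_prob_def Let_def)
    qed
    have q: "current_cookie (fst (stage j s)) (stage_walk j s) n = ?q s" for s
      using qT[of True s] by (simp add: step_prob_def Let_def)
    have su [measurable]: "seed_used j n \<in> ?N \<rightarrow>\<^sub>M count_space UNIV" by (rule measurable_seed_used)
    have seed_at: "(\<lambda>s. snd s (seed_used j n s)) \<in> borel_measurable ?N"
      by (rule measurable_compose_countable[where f="\<lambda>l s. snd s l", OF measurable_compose[OF measurable_snd measurable_seed] su])
    note [measurable] = seed_at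
    have Im [measurable]: "(\<lambda>s. indicator A (T s) :: ennreal) \<in> borel_measurable ?N" by measurable
    have qm [measurable]: "?q \<in> borel_measurable ?N" by measurable
    have "Measurable.pred ?N (\<lambda>s. (snd s (seed_used j n s) < ?q s) = b)"
      by (cases b) simp_all
    then have Lm: "(\<lambda>s. indicator A (T s) * of_bool ((snd s (seed_used j n s) < ?q s) = b) :: ennreal) \<in> borel_measurable ?N"
      unfolding of_bool_def by measurable
    have Rm: "(\<lambda>s. indicator A (T s) * ennreal (if b then ?q s else 1 - ?q s)) \<in> borel_measurable ?N"
      by measurable
    let ?B = "reveal (Suc j) n -` A \<inter> step_event (Suc j) n b"
    have B [measurable]: "?B \<in> sets sample_space"
    proof -
      have "?B = (reveal (Suc j) n -` A \<inter> space sample_space) \<inter> step_event (Suc j) n b" by (auto simp: step_event_def)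
      then show ?thesis using measurable_sets[OF measurable_reveal A, of "Suc j" n] by auto
    qed
    have "emeasure arrow_law ?B = (\<integral>\<^sup>+z. indicator ?B z \<partial>arrow_law)"
      by (rule nn_integral_indicator[symmetric]) (simp add: arrow_law_def)
    also have "\<dots> = (\<integral>\<^sup>+s. indicator ?B (arrow_sample s) \<partial>?N)"
      unfolding arrow_law_def by (rule nn_integral_distr) measurable
    also have "\<dots> = (\<integral>\<^sup>+s. indicator A (T s) * of_bool ((snd s (seed_used j n s) < ?q s) = b) \<partial>?N)"
    proof (rule nn_integral_cong)
      fix s assume "s \<in> space ?N"
      then have "arrow_sample s \<in> space sample_space" by (rule measurable_space[OF so])
      then show "(indicator ?B (arrow_sample s) :: ennreal) = indicator A (T s) * of_bool ((snd s (seed_used j n s) < ?q s) = b)"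
        by (auto simp: indicator_def T_def[symmetric] step_event_def stage_walk_Suc q)
    qed
    also have "\<dots> = (\<integral>\<^sup>+\<omega>. \<integral>\<^sup>+u. indicator A (T (\<omega>, u)) * of_bool ((u (seed_used j n (\<omega>, u)) < ?q (\<omega>, u)) = b) \<partial>seed_measure \<partial>P)"
      using S.nn_integral_fst[OF Lm] by simp
    also have "\<dots> = (\<integral>\<^sup>+\<omega>. \<integral>\<^sup>+u. indicator A (T (\<omega>, u)) * ennreal (if b then ?q (\<omega>, u) else 1 - ?q (\<omega>, u)) \<partial>seed_measure \<partial>P)"
    proof (rule nn_integral_cong)
      fix \<omega> assume w: "\<omega> \<in> space P"
      have TS: "T (\<omega>, u) \<in> space sample_space" for u
        using measurable_space[OF T, of "(\<omega>, u)"] w by (simp add: space_pair_measure)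
      note m = measurable_compose[OF measurable_Pair1'[OF w]]
      show "(\<integral>\<^sup>+u. indicator A (T (\<omega>, u)) * of_bool ((u (seed_used j n (\<omega>, u)) < ?q (\<omega>, u)) = b) \<partial>seed_measure) =
        (\<integral>\<^sup>+u. indicator A (T (\<omega>, u)) * ennreal (if b then ?q (\<omega>, u) else 1 - ?q (\<omega>, u)) \<partial>seed_measure)"
      proof (rule nn_integral_fresh_seed[where L="\<lambda>u. seed_used j n (\<omega>, u)"])
        show "(\<lambda>u. seed_used j n (\<omega>, u)) \<in> seed_measure \<rightarrow>\<^sub>M count_space UNIV" by (rule m[OF su])
        show "(\<lambda>u. indicator A (T (\<omega>, u)) :: ennreal) \<in> borel_measurable seed_measure"
          by (rule m[OF Im])
        show "(\<lambda>u. ?q (\<omega>, u)) \<in> borel_measurable seed_measure"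
          by (rule m[OF qm])
        have T_upd: "T (\<omega>, u(seed_used j n (\<omega>, u) := v)) = T (\<omega>, u)" for u v
          unfolding T_def by (rule fresh_seed_invariance(1)) simp
        show "indicator A (T (\<omega>, u(seed_used j n (\<omega>, u) := v))) = (indicator A (T (\<omega>, u)) :: ennreal)"
          "?q (\<omega>, u(seed_used j n (\<omega>, u) := v)) = ?q (\<omega>, u)" for u v by (simp_all only: T_upd)
        show "seed_used j n (\<omega>, u(seed_used j n (\<omega>, u) := v)) = seed_used j n (\<omega>, u)" for u v
          by (rule fresh_seed_invariance(2)) simp
        show "0 \<le> ?q (\<omega>, u) \<and> ?q (\<omega>, u) \<le> 1" for u by (rule step_prob_01[OF TS])
      qed
    qed
    also have "\<dots> = (\<integral>\<^sup>+s. indicator A (T s) * ennreal (if b then ?q s else 1 - ?q s) \<partial>?N)"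
      using S.nn_integral_fst[OF Rm] by simp
    also have "\<dots> = (\<integral>\<^sup>+s. indicator A (reveal (Suc j) n (arrow_sample s)) * ennreal (step_prob (Suc j) n b (arrow_sample s)) \<partial>?N)"
      unfolding T_def[symmetric] qT ..
    also have "\<dots> = (\<integral>\<^sup>+z. indicator A (reveal (Suc j) n z) * ennreal (step_prob (Suc j) n b z) \<partial>arrow_law)"
      unfolding arrow_law_def by (rule nn_integral_distr[symmetric]) measurable
    finally show ?thesis .
  qed
  have "prob_space arrow_law" unfolding arrow_law_def by (rule PS.P.prob_space_distr) (rule so)
  moreover have "(AE z in arrow_law. walk k z 0 = 0) \<and>
       (\<forall>n b. \<forall>A\<in>sets sample_space. 
          emeasure arrow_law (reveal k n -` A \<inter> step_event k n b) =
          (\<integral>\<^sup>+z. indicator A (reveal k n z) * ennreal (step_prob k n b z) \<partial>arrow_law))" if "k \<ge> 1" for k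
    using that 2 3 by (cases k) auto
  ultimately show ?thesis using 1 unfolding step_law_def by (simp add: arrow_law_def)
qed

lemma annealed_law_eq: "annealed_law P M \<Longrightarrow> M = arrow_law"
  by (rule step_law_unique[OF annealed_law_step_law step_law_arrow_law])

lemma AE_annealed_lawI:
  assumes M: "annealed_law P M" and Q: "AE s in P \<Otimes>\<^sub>M seed_measure. Q (stage_walk j s)"
    and Qm: "Measurable.pred path_space Q"
  shows "AE z in M. Q (walk (Suc j) z)"
proof -
  have "Measurable.pred sample_space (\<lambda>z. Q (walk (Suc j) z))"
    using measurable_compose[OF measurable_walk Qm] .
  then show ?thesis unfolding annealed_law_eq[OF M] arrow_law_def
    by (subst AE_distr_iff[OF measurable_arrow_sample]) (use Q in \<open>auto simp: pred_def\<close>)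
qed

end

section \<open>Zero-one law and Borel-Cantelli lemma for product measures\<close>

lemma emeasure_PiM_Int_coordinate:
  fixes C :: "('i \<Rightarrow> 'a) set"
  assumes \<mu>: "prob_space \<mu>" and C: "C \<in> sets (\<Pi>\<^sub>M i\<in>UNIV. \<mu>)" and I: "I \<in> sets \<mu>"
    and inv: "\<And>u v. u \<in> space (\<Pi>\<^sub>M i\<in>UNIV. \<mu>) \<Longrightarrow> v \<in> space \<mu> \<Longrightarrow> u(i := v) \<in> C \<longleftrightarrow> u \<in> C"
  shows "emeasure (\<Pi>\<^sub>M i\<in>UNIV. \<mu>) (C \<inter> {u \<in> space (\<Pi>\<^sub>M i\<in>UNIV. \<mu>). u i \<in> I}) = emeasure (\<Pi>\<^sub>M i\<in>UNIV. \<mu>) C * emeasure \<mu> I"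
proof -
  let ?S = "\<Pi>\<^sub>M i\<in>(UNIV :: 'i set). \<mu>"
  interpret U: prob_space \<mu> by (rule \<mu>)
  have cm: "(\<lambda>u. u i) \<in> ?S \<rightarrow>\<^sub>M \<mu>" by (rule measurable_component_singleton) simp
  have D: "{u \<in> space ?S. u i \<in> I} \<in> sets ?S"
    using measurable_sets[OF cm I] by (simp add: vimage_def Int_def conj_commute)
  let ?D = "C \<inter> {u \<in> space ?S. u i \<in> I}"
  have CD: "?D \<in> sets ?S" using C D by blast
  have "emeasure ?S ?D = (\<integral>\<^sup>+u. indicator ?D u \<partial>?S)" using CD by simp
  also have "\<dots> = (\<integral>\<^sup>+u. (\<integral>\<^sup>+v. indicator ?D (u(i := v)) \<partial>\<mu>) \<partial>?S)"
    by (rule nn_integral_PiM_upd[OF \<mu>]) (use CD in simp)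
  also have "\<dots> = (\<integral>\<^sup>+u. indicator C u * emeasure \<mu> I \<partial>?S)"
  proof (rule nn_integral_cong)
    fix u assume u: "u \<in> space ?S"
    have "(\<integral>\<^sup>+v. indicator ?D (u(i := v)) \<partial>\<mu>) = (\<integral>\<^sup>+v. indicator C u * indicator I v \<partial>\<mu>)"
      using inv[OF u] u by (intro nn_integral_cong) (auto simp: indicator_def space_PiM PiE_iff)
    also have "\<dots> = indicator C u * emeasure \<mu> I" using I by (rule nn_integral_cmult_indicator)
    finally show "(\<integral>\<^sup>+v. indicator ?D (u(i := v)) \<partial>\<mu>) = indicator C u * emeasure \<mu> I" .
  qed
  also have "\<dots> = emeasure ?S C * emeasure \<mu> I"
    using C by (simp add: nn_integral_multc)
  finally show ?thesis .
qed

lemma emeasure_PiM_Int_finite_box: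
  fixes C :: "('i \<Rightarrow> 'a) set"
  assumes \<mu>: "prob_space \<mu>" and C: "C \<in> sets (\<Pi>\<^sub>M i\<in>UNIV. \<mu>)" and J: "finite J" and A: "\<And>i. i \<in> J \<Longrightarrow> A i \<in> sets \<mu>"
    and inv: "\<And>u i v. i \<in> J \<Longrightarrow> u \<in> space (\<Pi>\<^sub>M i\<in>UNIV. \<mu>) \<Longrightarrow> v \<in> space \<mu> \<Longrightarrow> u(i := v) \<in> C \<longleftrightarrow> u \<in> C"
  shows "emeasure (\<Pi>\<^sub>M i\<in>UNIV. \<mu>) (C \<inter> {u \<in> space (\<Pi>\<^sub>M i\<in>UNIV. \<mu>). \<forall>i\<in>J. u i \<in> A i}) =
    emeasure (\<Pi>\<^sub>M i\<in>UNIV. \<mu>) C * (\<Prod>i\<in>J. emeasure \<mu> (A i))"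
  using J A inv
proof (induction J)
  case empty
  have "C \<inter> space (\<Pi>\<^sub>M i\<in>UNIV. \<mu>) = C" using sets.sets_into_space[OF C] by blast
  then show ?case by simp
next
  case (insert j J)
  let ?S = "\<Pi>\<^sub>M i\<in>(UNIV :: 'i set). \<mu>"
  let ?C = "C \<inter> {u \<in> space ?S. \<forall>i\<in>J. u i \<in> A i}"
  have "{u \<in> space ?S. \<forall>i\<in>J. u i \<in> A i} \<in> sets ?S"
  proof -
    have "Measurable.pred ?S (\<lambda>u. u i \<in> A i)" if "i \<in> J" for i
      by (rule pred_sets2[OF _ measurable_component_singleton]) (use insert that in auto)
    then show ?thesis using insert(1) by measurable
  qed
  then have "?C \<in> sets ?S" using C by blast
  moreover have "u(j := v) \<in> ?C \<longleftrightarrow> u \<in> ?C" if "u \<in> space ?S" "v \<in> space \<mu>" for u v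
  proof -
    have "u(j := v) \<in> C \<longleftrightarrow> u \<in> C" by (rule insert.prems(2)) (use that in auto)
    moreover have "u(j := v) \<in> space ?S" using that by (simp add: space_PiM PiE_iff)
    moreover have "(\<forall>i\<in>J. (u(j := v)) i \<in> A i) \<longleftrightarrow> (\<forall>i\<in>J. u i \<in> A i)" using insert(2) by auto
    ultimately show ?thesis using that by blast
  qed
  ultimately have "emeasure ?S (?C \<inter> {u \<in> space ?S. u j \<in> A j}) = emeasure ?S ?C * emeasure \<mu> (A j)"
    using insert.prems(1) by (intro emeasure_PiM_Int_coordinate \<mu>) auto
  moreover have "?C \<inter> {u \<in> space ?S. u j \<in> A j} = C \<inter> {u \<in> space ?S. \<forall>i\<in>insert j J. u i \<in> A i}" by blast
  ultimately show ?case using insert by (simp add: mult_ac)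
qed

lemma emeasure_PiM_finite_box:
  fixes A :: "'i \<Rightarrow> 'a set"
  assumes \<mu>: "prob_space \<mu>" and J: "finite J" and A: "\<And>i. i \<in> J \<Longrightarrow> A i \<in> sets \<mu>"
  shows "emeasure (\<Pi>\<^sub>M i\<in>UNIV. \<mu>) {u \<in> space (\<Pi>\<^sub>M i\<in>UNIV. \<mu>). \<forall>i\<in>J. u i \<in> A i} = (\<Prod>i\<in>J. emeasure \<mu> (A i))"
proof -
  let ?S = "\<Pi>\<^sub>M i\<in>(UNIV :: 'i set). \<mu>"
  interpret S: prob_space ?S by (intro prob_space_PiM \<mu>)
  have "emeasure ?S (space ?S \<inter> {u \<in> space ?S. \<forall>i\<in>J. u i \<in> A i}) = emeasure ?S (space ?S) * (\<Prod>i\<in>J. emeasure \<mu> (A i))"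
    by (rule emeasure_PiM_Int_finite_box[OF \<mu> sets.top J A]) (auto simp: space_PiM PiE_iff)
  then show ?thesis by (simp add: S.emeasure_space_1 Int_absorb1 Collect_conj_eq)
qed

lemma prod_emb_UNIV_eq: 
  "prod_emb UNIV (\<lambda>_. \<mu>) J (Pi\<^sub>E J A) = {u \<in> space (\<Pi>\<^sub>M i\<in>UNIV. \<mu>). \<forall>i\<in>J. u i \<in> A i}"
  by (auto simp: prod_emb_def space_PiM PiE_iff extensional_def restrict_def Pi_iff)

text \<open>
  An event that is not affected by the change of any single coordinate is independent of all finite boxes.
  These generate the product, so the event is independent of itself.
\<close>

lemma PiM_zero_one:
  fixes C :: "('i \<Rightarrow> 'a) set"
  assumes \<mu>: "prob_space \<mu>" and C: "C \<in> sets (\<Pi>\<^sub>M i\<in>UNIV. \<mu>)"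
    and inv: "\<And>u i v. u \<in> space (\<Pi>\<^sub>M i\<in>UNIV. \<mu>) \<Longrightarrow> v \<in> space \<mu> \<Longrightarrow> u(i := v) \<in> C \<longleftrightarrow> u \<in> C"
  shows "measure (\<Pi>\<^sub>M i\<in>UNIV. \<mu>) C \<in> {0, 1}"
proof -
  let ?S = "\<Pi>\<^sub>M i\<in>(UNIV :: 'i set). \<mu>"
  interpret S: prob_space ?S by (intro prob_space_PiM \<mu>)
  \<comment> \<open>Independence of \<open>C\<close> from all events, as an equality of measures.\<close>
  have "density ?S (indicator C) = scale_measure (emeasure ?S C) ?S"
  proof (rule measure_eqI_PiM_infinite)
    show "finite_measure (density ?S (indicator C))"
      by (rule finite_measureI) (use C in \<open>simp add: emeasure_density S.emeasure_eq_measure\<close>)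
    fix A :: "'i \<Rightarrow> 'a set" and J :: "'i set"
    assume J: "finite J" "\<And>i. i \<in> J \<Longrightarrow> A i \<in> sets \<mu>"
    let ?E = "{u \<in> space ?S. \<forall>i\<in>J. u i \<in> A i}"
    have "?E \<in> sets ?S" unfolding prod_emb_UNIV_eq[symmetric] using J by (intro sets_PiM_I) auto
    then have "emeasure (density ?S (indicator C)) ?E = emeasure ?S (C \<inter> ?E)"
      using C by (simp add: emeasure_density indicator_inter_arith[symmetric])
    also have "\<dots> = emeasure ?S C * emeasure ?S ?E"
      by (simp only: emeasure_PiM_Int_finite_box[OF \<mu> C J inv] emeasure_PiM_finite_box[OF \<mu> J])
    finally show "emeasure (density ?S (indicator C)) (prod_emb UNIV (\<lambda>_. \<mu>) J (Pi\<^sub>E J A)) =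
      emeasure (scale_measure (emeasure ?S C) ?S) (prod_emb UNIV (\<lambda>_. \<mu>) J (Pi\<^sub>E J A))"
      by (simp add: prod_emb_UNIV_eq)
  qed auto
  then have "emeasure (density ?S (indicator C)) C = emeasure ?S C * emeasure ?S C" by simp
  then have "emeasure ?S C = emeasure ?S C * emeasure ?S C"
    using C by (simp add: emeasure_density indicator_inter_arith[symmetric])
  then have "measure ?S C = measure ?S C * measure ?S C"
    by (simp add: S.emeasure_eq_measure ennreal_mult[symmetric])
  then show ?thesis by simp
qed

lemma distr_PiM_reindex_map:
  fixes \<pi> :: "'i \<Rightarrow> 'i"
  assumes \<mu>: "prob_space \<mu>" and \<pi>: "inj \<pi>" and g: "g \<in> \<mu> \<rightarrow>\<^sub>M \<mu>" "distr \<mu> \<mu> g = \<mu>"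
  shows "distr (\<Pi>\<^sub>M i\<in>UNIV. \<mu>) (\<Pi>\<^sub>M i\<in>UNIV. \<mu>) (\<lambda>u i. g (u (\<pi> i))) = (\<Pi>\<^sub>M i\<in>UNIV. \<mu>)"
proof (rule measure_eqI_PiM_infinite)
  let ?S = "\<Pi>\<^sub>M i\<in>(UNIV :: 'i set). \<mu>"
  interpret S: prob_space ?S by (intro prob_space_PiM \<mu>)
  have m: "(\<lambda>u i. g (u (\<pi> i))) \<in> ?S \<rightarrow>\<^sub>M ?S"
  proof (rule measurable_PiM_single')
    show "(\<lambda>u. g (u (\<pi> i))) \<in> ?S \<rightarrow>\<^sub>M \<mu>" for i
      by (rule measurable_compose[OF _ g(1)], rule measurable_component_singleton) simp
    show "(\<lambda>u i. g (u (\<pi> i))) \<in> space ?S \<rightarrow> (UNIV \<rightarrow>\<^sub>E space \<mu>)"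
      using measurable_space[OF g(1)] by (auto simp: space_PiM PiE_iff)
  qed
  show "finite_measure (distr ?S ?S (\<lambda>u i. g (u (\<pi> i))))"
    using S.prob_space_distr[OF m] by (simp add: prob_space.finite_measure)
  fix A :: "'i \<Rightarrow> 'a set" and J :: "'i set"
  assume J: "finite J" "\<And>i. i \<in> J \<Longrightarrow> A i \<in> sets \<mu>"
  have E: "{u \<in> space ?S. \<forall>i\<in>J. u i \<in> A i} \<in> sets ?S"
    unfolding prod_emb_UNIV_eq[symmetric] using J by (intro sets_PiM_I) auto
  \<comment> \<open>The box \<open>A\<close> in the new coordinates is a box over \<open>\<pi> ` J\<close> in the old ones.\<close>
  let ?A = "\<lambda>i. g -` A (inv \<pi> i) \<inter> space \<mu>"
  have "emeasure (distr ?S ?S (\<lambda>u i. g (u (\<pi> i)))) {u \<in> space ?S. \<forall>i\<in>J. u i \<in> A i} =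
     emeasure ?S ((\<lambda>u i. g (u (\<pi> i))) -` {u \<in> space ?S. \<forall>i\<in>J. u i \<in> A i} \<inter> space ?S)"
    by (rule emeasure_distr[OF m E])
  also have "(\<lambda>u i. g (u (\<pi> i))) -` {u \<in> space ?S. \<forall>i\<in>J. u i \<in> A i} \<inter> space ?S =
      {u \<in> space ?S. \<forall>i\<in>\<pi> ` J. u i \<in> ?A i}"
    using measurable_space[OF g(1)] by (auto simp: space_PiM PiE_iff inv_f_f[OF \<pi>])
  also have "emeasure ?S \<dots> = (\<Prod>i\<in>\<pi> ` J. emeasure \<mu> (?A i))"
    by (rule emeasure_PiM_finite_box[OF \<mu>]) (use J measurable_sets[OF g(1)] in \<open>auto simp: inv_f_f[OF \<pi>]\<close>)
  also have "\<dots> = (\<Prod>i\<in>J. emeasure \<mu> (g -` A i \<inter> space \<mu>))"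
    by (subst prod.reindex) (use \<pi> in \<open>auto simp: inv_f_f intro: inj_on_subset\<close>)
  also have "\<dots> = (\<Prod>i\<in>J. emeasure \<mu> (A i))"
    by (rule prod.cong[OF refl]) (subst g(2)[symmetric], subst emeasure_distr[OF g(1)], use J in auto)
  also have "\<dots> = emeasure ?S {u \<in> space ?S. \<forall>i\<in>J. u i \<in> A i}"
    by (rule emeasure_PiM_finite_box[OF \<mu> J, symmetric])
  finally show "emeasure (distr ?S ?S (\<lambda>u i. g (u (\<pi> i)))) (prod_emb UNIV (\<lambda>_. \<mu>) J (Pi\<^sub>E J A)) =
     emeasure ?S (prod_emb UNIV (\<lambda>_. \<mu>) J (Pi\<^sub>E J A))" by (simp only: prod_emb_UNIV_eq)
qed auto

lemma emeasure_seed_box: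
  assumes J: "finite J" and A: "\<And>i. i \<in> J \<Longrightarrow> A i \<in> sets borel"
  shows "emeasure seed_measure {u. \<forall>i\<in>J. u i \<in> A i} = (\<Prod>i\<in>J. emeasure unif (A i))"
  using emeasure_PiM_finite_box[OF prob_unif J, of A] A by (simp add: seed_measure_def[symmetric])

text \<open>
  The second Borel-Cantelli lemma: the probability that none of the events \<open>N, \<dots>, K - 1\<close> occurs is at most
  the exponential of minus the sum of their probabilities.
\<close>

lemma AE_frequently_seed:
  fixes l :: "nat \<Rightarrow> 'i :: countable"
  assumes l: "inj l" and A: "\<And>i. A i \<in> sets borel" and sum: "(\<Sum>i. emeasure unif (A i)) = \<infinity>"
  shows "AE u in seed_measure. \<exists>\<^sub>\<infinity>i. u (l i) \<in> A i"
proof -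
  interpret S: prob_space "seed_measure :: ('i \<Rightarrow> real) measure" by (rule prob_seed_measure)
  interpret U: prob_space unif by (rule prob_unif)
  define p where "p i = measure unif (A i)" for i
  have p0: "0 \<le> p i" for i by (simp add: p_def)
  have A': "A i \<in> sets unif" for i using A by simp
  have null: "emeasure seed_measure {u. \<forall>i\<ge>N. u (l i) \<notin> A i} = 0" for N
  proof -
    have bound: "measure seed_measure {u. \<forall>i\<ge>N. u (l i) \<notin> A i} \<le> exp (- (\<Sum>i=N..<K. p i))" for K
    proof -
      let ?J = "l ` {N..<K}"
      have Jm: "{u. \<forall>j\<in>?J. u j \<in> - A (inv l j)} \<in> sets (seed_measure :: ('i \<Rightarrow> real) measure)"
      proof -
        have "Measurable.pred seed_measure (\<lambda>u. u j \<in> - A (inv l j))" for j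
          by (rule pred_sets2[OF _ measurable_seed]) (use A in auto)
        then have "Measurable.pred seed_measure (\<lambda>u. \<forall>j\<in>?J. u j \<in> - A (inv l j))" by measurable
        then show ?thesis by (simp add: pred_def)
      qed
      have "measure seed_measure {u. \<forall>i\<ge>N. u (l i) \<notin> A i} \<le> measure seed_measure {u. \<forall>j\<in>?J. u j \<in> - A (inv l j)}"
        by (rule S.finite_measure_mono[OF _ Jm]) (auto simp: inv_f_f[OF l])
      also have "\<dots> = (\<Prod>j\<in>?J. measure unif (- A (inv l j)))"
      proof -
        have "emeasure seed_measure {u. \<forall>j\<in>?J. u j \<in> - A (inv l j)} = (\<Prod>j\<in>?J. emeasure unif (- A (inv l j)))"
          by (rule emeasure_seed_box) (use A in auto)
        then show ?thesis by (simp add: S.emeasure_eq_measure U.emeasure_eq_measure prod_ennreal prod_nonneg)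
      qed
      also have "\<dots> = (\<Prod>i=N..<K. 1 - p i)"
      proof -
        have "measure unif (- A i) = 1 - p i" for i
          using U.prob_compl[OF A', of i] by (simp add: p_def Compl_eq_Diff_UNIV)
        then show ?thesis by (subst prod.reindex) (use l in \<open>auto simp: inv_f_f intro: inj_on_subset\<close>)
      qed
      also have "\<dots> \<le> (\<Prod>i=N..<K. exp (- p i))"
        by (rule prod_mono) (use exp_ge_add_one_self[of "- p _"] in \<open>auto simp: p_def\<close>)
      also have "\<dots> = exp (- (\<Sum>i=N..<K. p i))" by (simp add: exp_sum sum_negf[symmetric])
      finally show ?thesis .
    qed
    have "\<not> summable p"
    proof
      assume "summable p"
      then have "(\<Sum>i. ennreal (p i)) = ennreal (suminf p)" by (intro suminf_ennreal2 p0)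
      then show False using sum by (simp add: U.emeasure_eq_measure p_def)
    qed
    then have "\<exists>n. \<not> sum p {..n} \<le> c" for c
      using bounded_imp_summable[of p c] p0 by blast
    then have unb: "\<exists>K. c < (\<Sum>i<K. p i)" for c
      by (metis lessThan_Suc_atMost not_le)
    have "measure seed_measure {u. \<forall>i\<ge>N. u (l i) \<notin> A i} \<le> e" if e: "e > 0" for e
    proof -
      obtain K where K: "- ln e + (\<Sum>i<N. p i) < (\<Sum>i<K. p i)" using unb by blast
      have "(\<Sum>i<K. p i) \<le> (\<Sum>i\<in>{..<N} \<union> {N..<K}. p i)" by (rule sum_mono2) (auto simp: p_def)
      also have "\<dots> = (\<Sum>i<N. p i) + (\<Sum>i=N..<K. p i)" by (rule sum.union_disjoint) auto
      finally have "- (\<Sum>i=N..<K. p i) \<le> ln e" using K by linarith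
      then have "exp (- (\<Sum>i=N..<K. p i)) \<le> e" using e exp_le_cancel_iff[of _ "ln e"] by simp
      with bound[of K] show ?thesis by linarith
    qed
    then have "measure seed_measure {u. \<forall>i\<ge>N. u (l i) \<notin> A i} \<le> 0" by (rule field_le_epsilon[of _ 0, simplified])
    then show ?thesis by (simp add: S.emeasure_eq_measure measure_le_0_iff)
  qed
  have "AE u in seed_measure. \<not> (\<forall>i\<ge>N. u (l i) \<notin> A i)" for N
  proof (rule AE_I[where N="{u. \<forall>i\<ge>N. u (l i) \<notin> A i}"])
    have "Measurable.pred seed_measure (\<lambda>u. u (l i) \<in> A i)" for i
      by (rule pred_sets2[OF _ measurable_seed]) (use A in auto)
    then have "Measurable.pred seed_measure (\<lambda>u. \<forall>i. i \<ge> N \<longrightarrow> u (l i) \<notin> A i)" by measurable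
    then show "{u. \<forall>i\<ge>N. u (l i) \<notin> A i} \<in> sets (seed_measure :: ('i \<Rightarrow> real) measure)" by (simp add: pred_def)
  qed (use null in auto)
  then have "AE u in seed_measure. \<forall>N. \<not> (\<forall>i\<ge>N. u (l i) \<notin> A i)" by (simp add: AE_all_countable)
  then show ?thesis by eventually_elim (auto simp: INFM_nat_le)
qed

section \<open>Zero-one laws for escaping\<close>

definition seed_arrows :: "nat \<Rightarrow> env \<times> (seed_index \<Rightarrow> real) \<Rightarrow> arrows" where
  "seed_arrows f s = (\<lambda>x i. snd s (f, x, i) < fst s x i)"

text \<open>
  For balanced arrows this is \<^prop>\<open>escapes k a 0\<close>. In contrast to the latter, it is invariant under
  shifts, and not affected by the arrows at finitely many sites, without any exceptional set.
\<close>

definition far_escapes :: "nat \<Rightarrow> arrows \<Rightarrow> bool" where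
  "far_escapes k a \<longleftrightarrow> (\<exists>x0. \<forall>x\<ge>x0. escapes k a x)"

lemma far_escapes_iff: "balanced a \<Longrightarrow> far_escapes k a \<longleftrightarrow> escapes k a 0"
  unfolding far_escapes_def using escapes_iff[of a k] by (metis order_refl)

lemma escapes_cong: "(\<And>y. y \<ge> x \<Longrightarrow> a y = b y) \<Longrightarrow> escapes k a x = escapes k b x"
  unfolding escapes_def using returns_cong[of x a b k] by simp

lemma total_returns_cong: "(\<And>y. y \<ge> x \<Longrightarrow> a y = b y) \<Longrightarrow> total_returns k a x = total_returns k b x"
  unfolding total_returns_def using returns_cong[of x a b k] by simp

lemma far_escapes_cong:
  assumes "\<And>y. y \<ge> n \<Longrightarrow> a y = b y"
  shows "far_escapes k a = far_escapes k b"
proof -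
  have "far_escapes k b" if ab: "\<And>y. y \<ge> n \<Longrightarrow> a y = b y" and "far_escapes k a" for a b
  proof -
    obtain x0 where x0: "escapes k a x" if "x \<ge> x0" for x using \<open>far_escapes k a\<close> unfolding far_escapes_def by blast
    have "escapes k b x" if "x \<ge> max x0 n" for x
      using x0[of x] that escapes_cong[of x a b k] ab by auto
    then show ?thesis unfolding far_escapes_def by blast
  qed
  then show ?thesis using assms by metis
qed

lemma escapes_shift: "escapes k (\<lambda>x. a (x + 1)) x = escapes k a (x + 1)"
  by (simp add: escapes_def returns_shift)

lemma total_returns_shift: "total_returns k (\<lambda>x. a (x + 1)) x = total_returns k a (x + 1)"
  by (simp add: total_returns_def returns_shift)

lemma far_escapes_shift: "far_escapes k (\<lambda>x. a (x + 1)) = far_escapes k a"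
proof
  assume "far_escapes k (\<lambda>x. a (x + 1))"
  then obtain x0 where "\<forall>x\<ge>x0. escapes k a (x + 1)" unfolding far_escapes_def escapes_shift by blast
  then have "\<forall>x\<ge>x0 + 1. escapes k a x" by (metis add_le_cancel_right diff_add_cancel)
  then show "far_escapes k a" unfolding far_escapes_def by blast
next
  assume "far_escapes k a"
  then obtain x0 where "\<forall>x\<ge>x0. escapes k a x" unfolding far_escapes_def by blast
  then have "\<forall>x\<ge>x0. escapes k a (x + 1)" by simp
  then show "far_escapes k (\<lambda>x. a (x + 1))" unfolding far_escapes_def escapes_shift by blast
qed

lemma reflect_shift: "reflect (\<lambda>x. a (x + 1)) (x + 1) = reflect a x"
  by (simp add: reflect_def)

text \<open>
  With \<open>r\<close> false, left and right are exchanged, so that the statements on walks to \<open>+\<infinity>\<close> also cover walks to \<open>-\<infinity>\<close>.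
\<close>

definition orient :: "bool \<Rightarrow> arrows \<Rightarrow> arrows" where
  "orient r a = (if r then a else reflect a)"

lemma reflect_orient: "reflect (orient r a) = orient (\<not> r) a"
  by (simp add: orient_def)

lemma balanced_orient: "balanced (orient r a) \<longleftrightarrow> balanced a"
  by (simp add: orient_def)

lemma far_escapes_orient_shift: "far_escapes k (orient r (\<lambda>x. a (x + 1))) = far_escapes k (orient r a)"
  using far_escapes_shift[of k a] far_escapes_shift[of k "reflect (\<lambda>x. a (x + 1))"]
  by (simp add: orient_def reflect_shift)

lemma far_escapes_orient_cong:
  assumes "\<forall>x. (if r then x \<ge> n else x \<le> n) \<longrightarrow> a x = b x"
  shows "far_escapes k (orient r a) = far_escapes k (orient r b)"
  by (rule far_escapes_cong[of "if r then n else - n"])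
     (use assms in \<open>auto simp: orient_def reflect_def split: if_splits\<close>)

lemma total_returns_reflect_shift:
  "total_returns k (reflect (\<lambda>x. a (x + 1))) (x + 1) = total_returns k (reflect a) x"
  using total_returns_shift[of k "reflect (\<lambda>x. a (x + 1))" x] by (simp add: reflect_shift)

lemma measurable_rights:
  assumes [measurable]: "\<And>i. Measurable.pred N (\<lambda>z. b z i)"
  shows "(\<lambda>z. rights (b z) n) \<in> N \<rightarrow>\<^sub>M count_space UNIV"
proof (induction n)
  case (Suc n)
  note [measurable] = Suc
  show ?case by (simp add: of_bool_def)
qed simp

lemma measurable_failures:
  assumes b: "\<And>i. Measurable.pred N (\<lambda>z. b z i)"
  shows "(\<lambda>z. failures (b z) r) \<in> N \<rightarrow>\<^sub>M count_space UNIV"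
proof -
  note [measurable] = measurable_rights[OF b]
  have "(\<lambda>z. hit (b z) r) \<in> N \<rightarrow>\<^sub>M count_space UNIV"
    unfolding hit_def by measurable
  moreover have "(\<lambda>z. lefts (b z) n) \<in> N \<rightarrow>\<^sub>M count_space UNIV" for n
    by (rule measurable_rights) (use b in simp)
  ultimately show ?thesis unfolding failures_def
    by (rule measurable_compose_countable[where f="\<lambda>n z. lefts (b z) n", rotated])
qed

lemma measurable_returns:
  assumes a: "\<And>x i. Measurable.pred N (\<lambda>z. a z x i)"
  shows "(\<lambda>z. returns k (a z) d x) \<in> N \<rightarrow>\<^sub>M count_space UNIV"
proof (induction d arbitrary: x)
  case (Suc d)
  note [measurable] = Suc
  have "(\<lambda>z. returns k (a z) d (x + 1) + k) \<in> N \<rightarrow>\<^sub>M count_space UNIV" by measurable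
  then show ?case unfolding returns.simps
    by (rule measurable_compose_countable[where f="\<lambda>r z. failures (a z x) r", OF measurable_failures[OF a]])
qed simp

lemma measurable_escapes:
  assumes a: "\<And>x i. Measurable.pred N (\<lambda>z. a z x i)"
  shows "Measurable.pred N (\<lambda>z. escapes k (a z) x)"
proof -
  note [measurable] = measurable_returns[OF a]
  show ?thesis unfolding escapes_def by measurable
qed

lemma measurable_total_returns:
  assumes a: "\<And>x i. Measurable.pred N (\<lambda>z. a z x i)"
  shows "(\<lambda>z. total_returns k (a z) x) \<in> N \<rightarrow>\<^sub>M count_space UNIV"
proof -
  note [measurable] = measurable_returns[OF a]
  show ?thesis unfolding total_returns_def by measurable
qed

lemma measurable_far_escapes:
  assumes a: "\<And>x i. Measurable.pred N (\<lambda>z. a z x i)"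
  shows "Measurable.pred N (\<lambda>z. far_escapes k (a z))"
proof -
  note [measurable] = measurable_escapes[OF a]
  have "(\<lambda>z. far_escapes k (a z)) = (\<lambda>z. \<exists>x0. \<forall>x. x \<ge> x0 \<longrightarrow> escapes k (a z) x)"
    by (simp add: far_escapes_def)
  then show ?thesis by simp
qed

lemma measurable_reflect:
  assumes "\<And>x i. Measurable.pred N (\<lambda>z. a z x i)"
  shows "Measurable.pred N (\<lambda>z. reflect (a z) x i)"
  using assms by (simp add: reflect_def)

lemma distr_seed_measure_reindex:
  fixes \<pi> :: "'i \<Rightarrow> 'i"
  assumes "inj \<pi>" and "g \<in> borel_measurable borel" "distr unif unif g = unif"
  shows "distr seed_measure seed_measure (\<lambda>u i. g (u (\<pi> i))) = seed_measure"
  unfolding seed_measure_def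
proof (rule distr_PiM_reindex_map[OF prob_unif assms(1) _ assms(3)])
  show "g \<in> unif \<rightarrow>\<^sub>M unif" using assms(2) by (simp cong: measurable_cong_sets)
qed

lemma measurable_seed_measure_reindex:
  assumes [measurable]: "g \<in> borel_measurable borel"
  shows "(\<lambda>u i. g (u (\<pi> i))) \<in> seed_measure \<rightarrow>\<^sub>M seed_measure"
proof -
  have "(\<lambda>u. g (u (\<pi> i))) \<in> seed_measure \<rightarrow>\<^sub>M unif" for i
  proof -
    have "(\<lambda>u. g (u (\<pi> i))) \<in> borel_measurable seed_measure" by measurable
    then show ?thesis by (simp cong: measurable_cong_sets)
  qed
  then show ?thesis by (subst (2) seed_measure_def) (rule measurable_PiM_single', auto)
qed

definition right_tail :: "env set \<Rightarrow> bool" where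
  "right_tail A \<longleftrightarrow> (\<forall>n. \<forall>\<omega>\<in>space env_space. \<forall>\<omega>'\<in>space env_space. (\<forall>x\<ge>n. \<omega> x = \<omega>' x) \<longrightarrow> (\<omega> \<in> A \<longleftrightarrow> \<omega>' \<in> A))"

text \<open>
  The cookies at 0 do not force arrows to the right, nor do those at 1 force arrows to the left.
\<close>

abbreviation free_env :: "env set" where
  "free_env \<equiv> {\<omega> \<in> space env_space. \<forall>i. \<omega> 0 i < 1 \<and> \<omega> 1 i > 0}"

definition left_tail :: "env set \<Rightarrow> bool" where
  "left_tail A \<longleftrightarrow> (\<forall>n. \<forall>\<omega>\<in>space env_space. \<forall>\<omega>'\<in>space env_space. (\<forall>x\<le>n. \<omega> x = \<omega>' x) \<longrightarrow> (\<omega> \<in> A \<longleftrightarrow> \<omega>' \<in> A))"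

text \<open>
  What the two kinds of environments have in common. The last condition says that \<open>free_env\<close> is compatible
  with every event of positive probability that does not involve the sites 0 and 1.
\<close>

locale admissible =
  fixes P :: "env measure"
  assumes prob_P: "prob_space P" and sets_P [measurable_cong, simp]: "sets P = sets env_space"
    and stationary: "distr P P env_shift = P"
    and zero_one: "\<And>A. A \<in> sets P \<Longrightarrow> env_shift -` A \<inter> space P = A \<Longrightarrow> right_tail A \<or> left_tail A \<Longrightarrow> measure P A \<in> {0, 1}"
    and divergent: "ND P"
    and finite_energy: "\<And>B. B \<in> sets P \<Longrightarrow> measure P B > 0 \<Longrightarrow>
      (\<And>\<omega> \<omega>'. \<omega> \<in> space env_space \<Longrightarrow> \<omega>' \<in> space env_space \<Longrightarrow> (\<And>x. x \<noteq> 0 \<Longrightarrow> x \<noteq> 1 \<Longrightarrow> \<omega> x = \<omega>' x) \<Longrightarrow> \<omega> \<in> B \<longleftrightarrow> \<omega>' \<in> B) \<Longrightarrow>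
      measure P (B \<inter> free_env) > 0"
begin

abbreviation Q :: "(env \<times> (seed_index \<Rightarrow> real)) measure" where "Q \<equiv> P \<Otimes>\<^sub>M seed_measure"

lemma space_P: "space P = space env_space"
  by (rule sets_eq_imp_space_eq) simp

sublocale P: prob_space P by (rule prob_P)
sublocale S: prob_space "seed_measure :: (seed_index \<Rightarrow> real) measure" by (rule prob_seed_measure)
sublocale PS: pair_prob_space P "seed_measure :: (seed_index \<Rightarrow> real) measure" ..

lemma measurable_seed_arrows: "Measurable.pred Q (\<lambda>s. seed_arrows f s x i)"
proof -
  have [measurable]: "(\<lambda>s. fst s x i) \<in> borel_measurable Q"
    by (rule measurable_compose[OF measurable_fst]) measurable
  have [measurable]: "(\<lambda>s. snd s l) \<in> borel_measurable Q" for l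
    using measurable_compose[OF measurable_snd measurable_seed] .
  show ?thesis unfolding seed_arrows_def by measurable
qed

lemma AE_balanced: "AE s in Q. balanced (seed_arrows f s)"
proof (rule PS.AE_pair_measure)
  note [measurable] = measurable_seed_arrows[of f]
  have "Measurable.pred Q (\<lambda>s. \<forall>x. (\<forall>m. \<exists>i. m \<le> i \<and> seed_arrows f s x i) \<and> (\<forall>m. \<exists>i. m \<le> i \<and> \<not> seed_arrows f s x i))"
    by measurable
  then have "Measurable.pred Q (\<lambda>s. balanced (seed_arrows f s))"
    by (simp only: balanced_def INFM_nat_le)
  then show "{s \<in> space Q. balanced (seed_arrows f s)} \<in> sets Q"
    by (simp only: pred_def)
  show "AE \<omega> in P. AE u in seed_measure. balanced (seed_arrows f (\<omega>, u))"
    using divergent[unfolded ND_def] AE_space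
  proof eventually_elim
    case (elim \<omega>)
    have r: "0 \<le> \<omega> x i \<and> \<omega> x i \<le> 1" for x i using elim(2) by (auto simp: space_P space_env_space)
    have e: "emeasure unif {v. (v < \<omega> x i) = b} = ennreal (if b then \<omega> x i else 1 - \<omega> x i)" for x i b
      using unif_less[of "\<omega> x i" b] r[of x i] prob_space.finite_measure[OF prob_unif] 
      by (simp only: finite_measure.emeasure_eq_measure)
    have "AE u in seed_measure. \<exists>\<^sub>\<infinity>i. u (f, x, i) \<in> {v. (v < \<omega> x i) = b}" for x b
    proof (rule AE_frequently_seed)
      show "inj (\<lambda>i. (f, x, i))" by (auto simp: inj_def)
      show "{v. (v < \<omega> x i) = b} \<in> sets borel" for i by measurable
      show "(\<Sum>i. emeasure unif {v. (v < \<omega> x i) = b}) = \<infinity>"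
        unfolding e using elim(1) by (cases b) simp_all
    qed
    then have "AE u in seed_measure. \<forall>x. (\<exists>\<^sub>\<infinity>i. u (f, x, i) \<in> {v. (v < \<omega> x i) = True}) \<and> (\<exists>\<^sub>\<infinity>i. u (f, x, i) \<in> {v. (v < \<omega> x i) = False})"
      by (simp only: AE_all_countable AE_conj_iff) simp
    then show ?case by eventually_elim (simp add: balanced_def seed_arrows_def)
  qed
qed

definition shift_seeds :: "(seed_index \<Rightarrow> real) \<Rightarrow> (seed_index \<Rightarrow> real)" where
  "shift_seeds u = (\<lambda>i. u (case i of (f, x, j) \<Rightarrow> (f, x + 1, j)))"

lemma distr_shift_seeds: "distr seed_measure seed_measure shift_seeds = seed_measure"
  and measurable_shift_seeds: "shift_seeds \<in> seed_measure \<rightarrow>\<^sub>M seed_measure"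
proof -
  have i: "inj (\<lambda>(f, x, j). (f :: nat, x + 1 :: int, j :: nat))" by (auto simp: inj_def)
  have d: "distr unif unif (\<lambda>v. v) = unif" by (rule distr_id)
  show "distr seed_measure seed_measure shift_seeds = seed_measure"
    using distr_seed_measure_reindex[OF i _ d] by (simp add: shift_seeds_def[abs_def])
  show "shift_seeds \<in> seed_measure \<rightarrow>\<^sub>M seed_measure"
    using measurable_seed_measure_reindex[of "\<lambda>v. v" "\<lambda>(f, x, j). (f :: nat, x + 1 :: int, j :: nat)"]
    by (simp add: shift_seeds_def[abs_def])
qed

lemma seed_arrows_shift: "seed_arrows f (env_shift \<omega>, shift_seeds u) = (\<lambda>x. seed_arrows f (\<omega>, u) (x + 1))"
  by (simp add: seed_arrows_def env_shift_def shift_seeds_def)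

lemma env_shift_P: "env_shift \<in> P \<rightarrow>\<^sub>M P"
  using env_shift_measurable by (simp cong: measurable_cong_sets)

lemma distr_Q_shift: "distr Q Q (\<lambda>(\<omega>, u). (env_shift \<omega>, shift_seeds u)) = Q"
  using pair_measure_distr[OF env_shift_P measurable_shift_seeds]
  by (simp add: stationary distr_shift_seeds S.sigma_finite_measure_axioms)

text \<open>
  For a fixed environment the event is not affected by any single seed, so \<open>PiM_zero_one\<close> applies. The set
  of the environments for which it has probability 1 is a shift-invariant tail event.
\<close>

lemma seed_arrows_zero_one:
  assumes m: "Measurable.pred Q (\<lambda>s. \<phi> (seed_arrows f s))"
    and shift: "\<And>a. \<phi> (\<lambda>x. a (x + 1)) = \<phi> a"
    and tail: "(\<forall>n a b. (\<forall>x\<ge>n. a x = b x) \<longrightarrow> \<phi> a = \<phi> b) \<or> (\<forall>n a b. (\<forall>x\<le>n. a x = b x) \<longrightarrow> \<phi> a = \<phi> b)"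
  shows "(AE s in Q. \<phi> (seed_arrows f s)) \<or> (AE s in Q. \<not> \<phi> (seed_arrows f s))"
proof -
  define C where "C \<omega> = {u. \<phi> (seed_arrows f (\<omega>, u))}" for \<omega>
  define A where "A = {\<omega> \<in> space P. emeasure seed_measure (C \<omega>) = 1}"
  have Cs: "C \<omega> \<in> sets seed_measure" if "\<omega> \<in> space P" for \<omega>
    using measurable_compose[OF measurable_Pair1'[OF that] m] by (simp add: pred_def C_def)
  have Em: "(\<lambda>\<omega>. emeasure seed_measure (C \<omega>)) \<in> borel_measurable P"
  proof -
    have "(\<lambda>\<omega>. emeasure seed_measure (Pair \<omega> -` {s \<in> space Q. \<phi> (seed_arrows f s)})) \<in> borel_measurable P"
      by (rule S.measurable_emeasure_Pair) (use m in \<open>simp add: pred_def\<close>)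
    moreover have "Pair \<omega> -` {s \<in> space Q. \<phi> (seed_arrows f s)} = C \<omega>" if "\<omega> \<in> space P" for \<omega>
      using that by (auto simp: C_def space_pair_measure)
    ultimately show ?thesis by (simp cong: measurable_cong)
  qed
  have C01: "emeasure seed_measure (C \<omega>) \<in> {0, 1}" if w: "\<omega> \<in> space P" for \<omega>
  proof -
    have "u(i := v) \<in> C \<omega> \<longleftrightarrow> u \<in> C \<omega>" for u i v
    proof -
      obtain g y j where i: "i = (g, y, j)" by (cases i) auto
      have same: "seed_arrows f (\<omega>, u(i := v)) x = seed_arrows f (\<omega>, u) x" if "x \<noteq> y" for x
        using that by (simp add: seed_arrows_def i)
      from tail show ?thesis
      proof
        assume "\<forall>n a b. (\<forall>x\<ge>n. a x = b x) \<longrightarrow> \<phi> a = \<phi> b"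
        moreover have "\<forall>x\<ge>y + 1. seed_arrows f (\<omega>, u(i := v)) x = seed_arrows f (\<omega>, u) x" using same by simp
        ultimately show ?thesis unfolding C_def mem_Collect_eq by blast
      next
        assume "\<forall>n a b. (\<forall>x\<le>n. a x = b x) \<longrightarrow> \<phi> a = \<phi> b"
        moreover have "\<forall>x\<le>y - 1. seed_arrows f (\<omega>, u(i := v)) x = seed_arrows f (\<omega>, u) x" using same by simp
        ultimately show ?thesis unfolding C_def mem_Collect_eq by blast
      qed
    qed
    then have "measure seed_measure (C \<omega>) \<in> {0, 1}"
      using PiM_zero_one[OF prob_unif, of "C \<omega>"] Cs[OF w] by (simp add: seed_measure_def)
    then show ?thesis by (auto simp: S.emeasure_eq_measure)
  qed
  have inv: "emeasure seed_measure (C (env_shift \<omega>)) = emeasure seed_measure (C \<omega>)" if w: "\<omega> \<in> space P" for \<omega>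
  proof -
    have w': "env_shift \<omega> \<in> space P" using measurable_space[OF env_shift_P w] .
    have "emeasure (distr seed_measure seed_measure shift_seeds) (C (env_shift \<omega>)) = emeasure seed_measure (shift_seeds -` C (env_shift \<omega>) \<inter> space seed_measure)"
      by (rule emeasure_distr[OF measurable_shift_seeds Cs[OF w']])
    also have "shift_seeds -` C (env_shift \<omega>) \<inter> space seed_measure = C \<omega>"
      using shift by (simp add: C_def vimage_def seed_arrows_shift)
    finally show ?thesis by (simp add: distr_shift_seeds)
  qed
  have As: "A \<in> sets P" unfolding A_def using Em by measurable
  have A_inv: "env_shift -` A \<inter> space P = A"
    using inv measurable_space[OF env_shift_P] by (auto simp: A_def)
  have A_cong: "(\<omega> \<in> A) = (\<omega>' \<in> A)"
    if "\<omega> \<in> space env_space" "\<omega>' \<in> space env_space" "\<forall>x\<in>U. \<omega> x = \<omega>' x"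
      and \<phi>: "\<forall>a b. (\<forall>x\<in>U. a x = b x) \<longrightarrow> \<phi> a = \<phi> b" for \<omega> \<omega>' U
  proof -
    have "\<forall>x\<in>U. seed_arrows f (\<omega>, u) x = seed_arrows f (\<omega>', u) x" for u
      using that(3) by (simp add: seed_arrows_def)
    with \<phi> have "\<phi> (seed_arrows f (\<omega>, u)) = \<phi> (seed_arrows f (\<omega>', u))" for u by blast
    then show ?thesis using that by (simp add: A_def C_def space_P)
  qed
  have A_tail: "right_tail A \<or> left_tail A"
    using tail
  proof
    assume t: "\<forall>n a b. (\<forall>x\<ge>n. a x = b x) \<longrightarrow> \<phi> a = \<phi> b"
    have "right_tail A"
      unfolding right_tail_def
    proof (intro allI ballI impI)
      fix n :: int
      have t': "\<forall>a b. (\<forall>x\<in>{n..}. a x = b x) \<longrightarrow> \<phi> a = \<phi> b" using t by (simp add: Ball_def)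
      fix \<omega> \<omega>' assume "\<omega> \<in> space env_space" "\<omega>' \<in> space env_space" "\<forall>x\<ge>n. \<omega> x = \<omega>' x"
      then show "(\<omega> \<in> A) = (\<omega>' \<in> A)" by (rule A_cong[OF _ _ _ t', unfolded Ball_def atLeast_iff atMost_iff])
    qed
    then show ?thesis ..
  next
    assume t: "\<forall>n a b. (\<forall>x\<le>n. a x = b x) \<longrightarrow> \<phi> a = \<phi> b"
    have "left_tail A"
      unfolding left_tail_def
    proof (intro allI ballI impI)
      fix n :: int
      have t': "\<forall>a b. (\<forall>x\<in>{..n}. a x = b x) \<longrightarrow> \<phi> a = \<phi> b" using t by (simp add: Ball_def)
      fix \<omega> \<omega>' assume "\<omega> \<in> space env_space" "\<omega>' \<in> space env_space" "\<forall>x\<le>n. \<omega> x = \<omega>' x"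
      then show "(\<omega> \<in> A) = (\<omega>' \<in> A)" by (rule A_cong[OF _ _ _ t', unfolded Ball_def atLeast_iff atMost_iff])
    qed
    then show ?thesis ..
  qed
  have "measure P A = 0 \<or> measure P A = 1" using zero_one[OF As A_inv A_tail] by simp
  then show ?thesis
  proof
    assume "measure P A = 1"
    then have "AE \<omega> in P. \<omega> \<in> A" by (rule P.AE_prob_1)
    then have "AE \<omega> in P. AE u in seed_measure. \<phi> (seed_arrows f (\<omega>, u))"
      using AE_space
    proof eventually_elim
      case (elim \<omega>)
      then have "measure seed_measure (C \<omega>) = 1" by (simp add: A_def S.emeasure_eq_measure)
      then show ?case using S.AE_prob_1[of "C \<omega>"] by (simp add: C_def)
    qed
    then have "AE s in Q. \<phi> (seed_arrows f s)"
      by (intro PS.AE_pair_measure) (use m in \<open>simp_all add: pred_def\<close>)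
    then show ?thesis ..
  next
    assume "measure P A = 0"
    then have "AE \<omega> in P. \<omega> \<notin> A" using As by (simp add: P.prob_eq_0)
    then have "AE \<omega> in P. AE u in seed_measure. \<not> \<phi> (seed_arrows f (\<omega>, u))"
      using AE_space
    proof eventually_elim
      case (elim \<omega>)
      then have "emeasure seed_measure (C \<omega>) = 0" using C01[of \<omega>] by (auto simp: A_def)
      then show ?case using Cs[OF elim(2)] by (subst AE_iff_measurable[OF _ refl]) (auto simp: C_def)
    qed
    moreover have "Measurable.pred Q (\<lambda>s. \<not> \<phi> (seed_arrows f s))" using m by measurable
    ultimately have "AE s in Q. \<not> \<phi> (seed_arrows f s)"
      by (intro PS.AE_pair_measure) (simp_all add: pred_def)
    then show ?thesis ..
  qed
qed

lemma escapes_zero_one: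
  "(AE s in Q. escapes k (orient r (seed_arrows f s)) 0) \<or> (AE s in Q. \<not> escapes k (orient r (seed_arrows f s)) 0)"
proof -
  have "(AE s in Q. far_escapes k (orient r (seed_arrows f s))) \<or> (AE s in Q. \<not> far_escapes k (orient r (seed_arrows f s)))"
  proof (rule seed_arrows_zero_one[where \<phi>="\<lambda>a. far_escapes k (orient r a)"])
    show "Measurable.pred Q (\<lambda>s. far_escapes k (orient r (seed_arrows f s)))"
      using measurable_far_escapes[OF measurable_seed_arrows]
        measurable_far_escapes[OF measurable_reflect[OF measurable_seed_arrows]]
      by (cases r) (simp_all add: orient_def)
    show "(\<forall>n a b. (\<forall>x\<ge>n. a x = b x) \<longrightarrow> far_escapes k (orient r a) = far_escapes k (orient r b)) \<or>
       (\<forall>n a b. (\<forall>x\<le>n. a x = b x) \<longrightarrow> far_escapes k (orient r a) = far_escapes k (orient r b))"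
      using far_escapes_orient_cong[of r] by (cases r) simp_all
  qed (rule far_escapes_orient_shift)
  then show ?thesis
  proof
    assume "AE s in Q. far_escapes k (orient r (seed_arrows f s))"
    with AE_balanced[of f] have "AE s in Q. escapes k (orient r (seed_arrows f s)) 0"
      by eventually_elim (simp add: far_escapes_iff balanced_orient)
    then show ?thesis ..
  next
    assume "AE s in Q. \<not> far_escapes k (orient r (seed_arrows f s))"
    with AE_balanced[of f] have "AE s in Q. \<not> escapes k (orient r (seed_arrows f s)) 0"
      by eventually_elim (simp add: far_escapes_iff balanced_orient)
    then show ?thesis ..
  qed
qed

text \<open>
  Here \<open>r x\<close> is the number of returns to \<open>x - 1\<close> of the walkers that start at \<open>x\<close> before one of them
  escapes to the right, and \<open>l x\<close> is the number of returns to \<open>- x + 1\<close> of those that start at \<open>- x\<close>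
  before one escapes to the left. Duality at the site 0 and stationarity exclude \<open>l 0 = r 1\<close>, whereas
  suitable arrows at 0 and 1 make both of them 0.
\<close>

lemma not_both_escape:
  assumes R: "AE s in Q. escapes 1 (seed_arrows f s) 0" and L: "AE s in Q. escapes 1 (reflect (seed_arrows f s)) 0"
  shows False
proof -
  define r where "r x s = total_returns 1 (seed_arrows f s) x" for x s
  define l where "l x s = total_returns 1 (reflect (seed_arrows f s)) x" for x s
  have rm [measurable]: "r x \<in> Q \<rightarrow>\<^sub>M count_space UNIV" for x
    unfolding r_def by (rule measurable_total_returns[OF measurable_seed_arrows])
  have lm [measurable]: "l x \<in> Q \<rightarrow>\<^sub>M count_space UNIV" for x
    unfolding l_def by (rule measurable_total_returns[OF measurable_reflect[OF measurable_seed_arrows]])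
  have am [measurable]: "Measurable.pred Q (\<lambda>s. seed_arrows f s x i)" for x i by (rule measurable_seed_arrows)
  have rec: "AE s in Q. balanced (seed_arrows f s) \<and> r 0 s = failures (seed_arrows f s 0) (Suc (r 1 s)) \<and>
      r 1 s = failures (seed_arrows f s 1) (Suc (r 2 s)) \<and>
      l 0 s = failures (\<lambda>i. \<not> seed_arrows f s 0 i) (Suc (l 1 s))"
    using AE_balanced[of f] R L
  proof eventually_elim
    case (elim s)
    let ?a = "seed_arrows f s"
    have b: "balanced (reflect ?a)" using elim by simp
    have "escapes 1 ?a 1" using elim escapes_iff[OF elim(1), of 1 1 0] by simp
    then show ?case
      using total_rec[OF elim(1,2)] total_rec[OF elim(1), of 1 1] total_rec[OF b elim(3)] elim(1)
      by (simp add: r_def l_def reflect_def)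
  qed
  have ne: "AE s in Q. l 0 s \<noteq> r 1 s"
  proof -
    \<comment> \<open>\<open>?D1\<close> is the shift of \<open>?D0\<close>, and \<open>?D0\<close> is almost surely \<open>?D0'\<close> by duality at the site 0.\<close>
    let ?D0 = "{s \<in> space Q. l 1 s < r 0 s}" and ?D1 = "{s \<in> space Q. l 0 s < r 1 s}"
    let ?D0' = "{s \<in> space Q. l 0 s \<le> r 1 s}"
    let ?\<theta> = "\<lambda>(\<omega>, u). (env_shift \<omega>, shift_seeds u)"
    have \<theta>: "?\<theta> \<in> Q \<rightarrow>\<^sub>M Q"
      using env_shift_P measurable_shift_seeds by measurable
    have D [measurable]: "?D0 \<in> sets Q" "?D1 \<in> sets Q" "?D0' \<in> sets Q"
    proof -
      have "Measurable.pred Q (\<lambda>s. R (l x s) (r y s))" for R :: "nat \<Rightarrow> nat \<Rightarrow> bool" and x y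
        using measurable_compose[OF measurable_Pair_countable[OF lm rm], of "\<lambda>(a, b). R a b" "count_space UNIV" x y] by simp
      then show "?D0 \<in> sets Q" "?D1 \<in> sets Q" "?D0' \<in> sets Q" unfolding pred_def by blast+
    qed
    have "?\<theta> -` ?D0 \<inter> space Q = ?D1"
    proof -
      have "r 0 (?\<theta> s) = r 1 s" "l 1 (?\<theta> s) = l 0 s" for s
        using total_returns_shift[of 1 "seed_arrows f s" 0] total_returns_reflect_shift[of 1 "seed_arrows f s" 0]
        by (simp_all add: r_def l_def split_beta seed_arrows_shift)
      then show ?thesis using measurable_space[OF \<theta>] by auto
    qed
    then have "measure (distr Q Q ?\<theta>) ?D0 = measure Q ?D1"
      using measure_distr[OF \<theta> D(1)] by simp
    then have "measure Q ?D0 = measure Q ?D1" by (simp only: distr_Q_shift)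
    moreover have "measure Q ?D0 = measure Q ?D0'"
    proof (rule measure_eq_AE)
      show "AE s in Q. (s \<in> ?D0) = (s \<in> ?D0')"
        using rec
      proof eventually_elim
        case (elim s)
        then have b: "balanced (seed_arrows f s)" by blast
        have "l 0 s \<le> r 1 s \<longleftrightarrow> l 1 s < r 0 s"
          using failures_duality[OF often_right[OF b, of 0] often_left[OF b, of 0], of "l 1 s" "r 1 s"] elim by simp
        then show ?case by simp
      qed
    qed (use D in auto)
    moreover have "?D1 \<subseteq> ?D0'" by auto
    ultimately have "measure Q (?D0' - ?D1) = 0"
      using PS.P.finite_measure_Diff[OF D(3,2)] by auto
    then have "AE s in Q. s \<notin> ?D0' - ?D1" using D by (simp add: PS.P.prob_eq_0)
    then show ?thesis using AE_space by eventually_elim auto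
  qed
  \<comment> \<open>\<open>X\<close> does not involve the arrows at 0 and 1; the first arrows there are prescribed in \<open>Y\<close>.\<close>
  define X where "X m m' = {s \<in> space Q. r 2 s = m \<and> l 1 s = m'}" for m m'
  have Xs: "X m m' \<in> sets Q" for m m' unfolding X_def by measurable
  have "\<exists>m m'. emeasure Q (X m m') \<noteq> 0"
  proof (rule ccontr)
    assume "\<not> ?thesis"
    then have "AE s in Q. s \<notin> X m m'" for m m' by (intro AE_not_in null_setsI Xs) simp
    then have "AE s in Q. \<forall>m m'. s \<notin> X m m'" by (simp add: AE_all_countable)
    then have "AE s in Q. False" using AE_space by eventually_elim (auto simp: X_def)
    then show False by simp
  qed
  then obtain m m' where X: "emeasure Q (X m m') \<noteq> 0" by blast
  define G where "G = {\<omega> \<in> space P. emeasure seed_measure (Pair \<omega> -` X m m') \<noteq> 0}"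
  have Gm: "G \<in> sets P" unfolding G_def using S.measurable_emeasure_Pair[OF Xs] by measurable
  have Gpos: "measure P G > 0"
  proof (rule ccontr)
    assume "\<not> ?thesis"
    then have "measure P G = 0" by (simp add: zero_less_measure_iff)
    then have "AE \<omega> in P. \<omega> \<notin> G" using Gm by (simp add: P.prob_eq_0)
    then have "AE \<omega> in P. emeasure seed_measure (Pair \<omega> -` X m m') = 0"
      using AE_space by eventually_elim (auto simp: G_def)
    then have "(\<integral>\<^sup>+\<omega>. emeasure seed_measure (Pair \<omega> -` X m m') \<partial>P) = 0"
      using S.measurable_emeasure_Pair[OF Xs] by (simp add: nn_integral_0_iff_AE)
    then show False using X S.emeasure_pair_measure_alt[OF Xs] by simp
  qed
  let ?G = "G \<inter> free_env"
  have "measure P ?G > 0"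
  proof (rule finite_energy[OF Gm Gpos])
    fix \<omega> \<omega>' assume w: "\<omega> \<in> space env_space" "\<omega>' \<in> space env_space" "\<And>x. x \<noteq> 0 \<Longrightarrow> x \<noteq> 1 \<Longrightarrow> \<omega> x = \<omega>' x"
    have "r 2 (\<omega>, u) = r 2 (\<omega>', u)" "l 1 (\<omega>, u) = l 1 (\<omega>', u)" for u
      unfolding r_def l_def by (rule total_returns_cong; use w(3) in \<open>simp add: seed_arrows_def reflect_def\<close>)+
    then have "Pair \<omega> -` X m m' = Pair \<omega>' -` X m m'"
      using w(1,2) by (auto simp: X_def space_pair_measure space_P)
    then show "(\<omega> \<in> G) = (\<omega>' \<in> G)" using w(1,2) by (simp add: G_def space_P)
  qed
  define Y where "Y = {s \<in> X m m'. (\<forall>i\<le>m. seed_arrows f s 1 i) \<and> (\<forall>i\<le>m'. \<not> seed_arrows f s 0 i)}"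
  have Ys: "Y \<in> sets Q"
  proof -
    have "Y = {s \<in> space Q. (r 2 s = m \<and> l 1 s = m') \<and> (\<forall>i. i \<le> m \<longrightarrow> seed_arrows f s 1 i) \<and> (\<forall>i. i \<le> m' \<longrightarrow> \<not> seed_arrows f s 0 i)}"
      by (auto simp: Y_def X_def)
    also have "\<dots> \<in> sets Q" by measurable
    finally show ?thesis .
  qed
  have Ypos: "emeasure seed_measure (Pair \<omega> -` Y) \<noteq> 0" if w: "\<omega> \<in> ?G" for \<omega>
  proof -
    define J where "J = (\<lambda>i. (f, 1 :: int, i)) ` {..m} \<union> (\<lambda>i. (f, 0, i)) ` {..m'}"
    define B where "B l = {v. (v < \<omega> (fst (snd l)) (snd (snd l))) = (fst (snd l) = 1)}" for l :: seed_index
    have w': "\<omega> \<in> space P" "0 \<le> \<omega> x i" "\<omega> x i \<le> 1" "\<omega> 0 i < 1" "\<omega> 1 i > 0" for x i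
      using w by (auto simp: space_P space_env_space)
    let ?X = "Pair \<omega> -` X m m'"
    have Y_eq: "Pair \<omega> -` Y = ?X \<inter> {u. \<forall>l\<in>J. u l \<in> B l}"
      unfolding Y_def J_def B_def seed_arrows_def ball_Un by (auto simp: image_iff)
    have "emeasure seed_measure (?X \<inter> {u. \<forall>l\<in>J. u l \<in> B l}) = emeasure seed_measure ?X * (\<Prod>l\<in>J. emeasure unif (B l))"
    proof -
      have XS: "?X \<in> sets (\<Pi>\<^sub>M i\<in>UNIV. unif)"
        using sets_Pair1[OF Xs, of \<omega> m m'] by (simp add: seed_measure_def)
      have BS: "B l \<in> sets unif" for l unfolding B_def by simp
      have inv: "u(j := v) \<in> ?X \<longleftrightarrow> u \<in> ?X" if j: "j \<in> J" for u j v
      proof -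
        have "seed_arrows f (\<omega>, u(j := v)) x = seed_arrows f (\<omega>, u) x" if "x \<noteq> 0" "x \<noteq> 1" for x
          using j that by (auto simp: seed_arrows_def J_def)
        then have "r 2 (\<omega>, u(j := v)) = r 2 (\<omega>, u)" "l 1 (\<omega>, u(j := v)) = l 1 (\<omega>, u)"
          unfolding r_def l_def by (intro total_returns_cong; simp add: reflect_def)+
        then show ?thesis using w'(1) by (simp add: X_def space_pair_measure)
      qed
      show ?thesis
        using emeasure_PiM_Int_finite_box[OF prob_unif XS _ BS inv, of J] by (simp add: J_def seed_measure_def[symmetric])
    qed
    moreover have "emeasure unif (B l) \<noteq> 0" if "l \<in> J" for l
    proof -
      interpret U: prob_space unif by (rule prob_unif)
      have "measure unif (B l) \<noteq> 0"
        unfolding B_def using that w'(4,5) less_imp_neq[OF w'(4)]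
        by (subst unif_less[OF w'(2,3)]) (auto simp: J_def less_imp_neq[symmetric])
      then show ?thesis by (simp add: U.emeasure_eq_measure)
    qed
    moreover have "finite J" by (simp add: J_def)
    ultimately show ?thesis using w unfolding Y_eq G_def by simp
  qed
  have "AE s in Q. s \<notin> Y"
    using ne rec
  proof eventually_elim
    case (elim s)
    show ?case
    proof
      assume s: "s \<in> Y"
      have zero: "failures b (Suc n) = 0" if "\<exists>\<^sub>\<infinity>i. b i" "\<forall>i\<le>n. b i" for b n
      proof -
        have "rights b k = k \<and> lefts b k = 0" if "k \<le> Suc n" for k
          using that \<open>\<forall>i\<le>n. b i\<close> by (induction k) auto
        then have *: "rights b (Suc n) = Suc n" "lefts b (Suc n) = 0" by blast+
        then have "hit b (Suc n) \<le> Suc n" using hit_le_iff[OF that(1)] by simp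
        then show ?thesis using rights_mono[of _ "Suc n" "\<lambda>i. \<not> b i"] *(2) by (simp add: failures_def)
      qed
      have b: "balanced (seed_arrows f s)" using elim by blast
      have "r 1 s = 0" using elim(2) s zero[OF often_right[OF b], of m 1] by (auto simp: Y_def X_def)
      moreover have "l 0 s = 0" using elim(2) s zero[OF often_left[OF b], of m' 0] by (auto simp: Y_def X_def)
      ultimately show False using elim(1) by simp
    qed
  qed
  then have "emeasure Q Y = 0" using Ys by (subst (asm) AE_iff_measurable[OF Ys]) (auto dest: sets.sets_into_space[OF Ys, THEN subsetD])
  then have "(\<integral>\<^sup>+\<omega>. emeasure seed_measure (Pair \<omega> -` Y) \<partial>P) = 0" using S.emeasure_pair_measure_alt[OF Ys] by simp
  then have "AE \<omega> in P. emeasure seed_measure (Pair \<omega> -` Y) = 0"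
    using S.measurable_emeasure_Pair[OF Ys] by (simp add: nn_integral_0_iff_AE)
  then have "AE \<omega> in P. \<omega> \<notin> ?G" 
  proof eventually_elim
    case (elim \<omega>)
    then show ?case using Ypos[of \<omega>] by blast
  qed
  moreover have "?G \<in> sets P"
  proof -
    have "free_env \<in> sets P" by measurable
    then show ?thesis using Gm by blast
  qed
  ultimately have "measure P ?G = 0" by (simp add: P.prob_eq_0)
  then show False using \<open>measure P ?G > 0\<close> by simp
qed

end

section \<open>Admissible environments\<close>

lemma admissibleI_SE:
  assumes "prob_space P" and sets_P: "sets P = sets env_space" and "SE P" "ELL P" "ND P"
  shows "admissible P"
proof (rule admissible.intro)
  interpret P: prob_space P by fact
  note [measurable_cong] = sets_P
  show "prob_space P" "sets P = sets env_space" "ND P" by fact+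
  show "distr P P env_shift = P" using \<open>SE P\<close> by (simp add: SE_def)
  show "measure P A \<in> {0, 1}" if "A \<in> sets P" "env_shift -` A \<inter> space P = A" for A
    using \<open>SE P\<close> that by (simp add: SE_def)
  fix B assume B [measurable]: "B \<in> sets P" and pos: "measure P B > 0"
  have G: "free_env \<in> sets P" by measurable
  have "measure P (B \<inter> free_env) = measure P B"
  proof (rule measure_eq_AE)
    show "AE \<omega> in P. (\<omega> \<in> B \<inter> free_env) = (\<omega> \<in> B)"
      using \<open>ELL P\<close>[unfolded ELL_def] AE_space
      by eventually_elim (auto simp: sets_eq_imp_space_eq[OF sets_P])
  qed (use B G in auto)
  then show "measure P (B \<inter> free_env) > 0" using pos by simp
qed

lemma suminf_eventually_half:
  assumes f: "\<And>i. i \<ge> m \<Longrightarrow> f i = ennreal (1/2)"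
  shows "(\<Sum>i. f i) = \<infinity>"
proof (rule ccontr)
  assume "(\<Sum>i. f i) \<noteq> \<infinity>"
  then obtain r where r: "0 \<le> r" "(\<Sum>i. f i) = ennreal r" by (cases "\<Sum>i. f i") auto
  obtain n :: nat where n: "2 * r < n" using reals_Archimedean2 by blast
  have "ennreal (n / 2) = (\<Sum>i=m..<m+n. ennreal (1/2))"
    by (subst sum_ennreal) auto
  also have "\<dots> = (\<Sum>i=m..<m+n. f i)" by (rule sum.cong) (auto simp: f)
  also have "\<dots> \<le> (\<Sum>i. f i)" by (rule sum_le_suminf) auto
  finally show False using r n by (simp add: ennreal_le_iff)
qed

text \<open>
  Under the product of the laws of the stacks, environments live on the whole function space. This map
  brings them into \<^term>\<open>env_space\<close> and leaves alone those that belong to it.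
\<close>

definition clamp_env :: "env \<Rightarrow> env" where
  "clamp_env \<omega> = (\<lambda>x i. max 0 (min 1 (\<omega> x i)))"

lemma clamp_env_id: "\<omega> \<in> space env_space \<Longrightarrow> clamp_env \<omega> = \<omega>"
  by (simp add: clamp_env_def space_env_space fun_eq_iff min_absorb2 max_absorb2)

lemma clamp_env_space: "clamp_env \<omega> \<in> space env_space"
  by (auto simp: clamp_env_def space_env_space)

text \<open>
  The environment is the image under \<open>clamp_env\<close> of a product measure, which is invariant under
  reindexing, obeys \<open>PiM_zero_one\<close>, and allows the stacks at 0 and 1 to be chosen independently of
  the others.
\<close>

lemma admissibleI_IID:
  assumes P: "prob_space P" and sets_P: "sets P = sets env_space" and "IID P" "WEL P" "BD P"
  shows "admissible P"
proof -
  interpret P: prob_space P by fact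
  note [measurable_cong] = sets_P
  have space_P: "space P = space env_space" by (rule sets_eq_imp_space_eq[OF sets_P])
  define \<mu> where "\<mu> = distr P borel (\<lambda>\<omega>. \<omega> 0)"
  let ?N = "\<Pi>\<^sub>M x\<in>(UNIV :: int set). \<mu>"
  have stack: "(\<lambda>\<omega>. \<omega> x) \<in> P \<rightarrow>\<^sub>M borel" for x
  proof (rule measurable_coordinatewise_then_product)
    show "(\<lambda>\<omega>. \<omega> x i) \<in> borel_measurable P" for i by measurable
  qed
  have \<mu>: "prob_space \<mu>" unfolding \<mu>_def by (rule P.prob_space_distr[OF stack])
  have sets_\<mu>: "sets \<mu> = sets borel" by (simp add: \<mu>_def)
  have space_N: "space ?N = UNIV" by (simp add: space_PiM \<mu>_def)
  interpret N: prob_space ?N by (intro prob_space_PiM \<mu>)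
  have sets_N: "sets ?N = sets (\<Pi>\<^sub>M x\<in>(UNIV :: int set). (borel :: (nat \<Rightarrow> real) measure))"
    by (rule sets_PiM_cong) (auto simp: sets_\<mu>)
  have coord: "(\<lambda>\<omega>. \<omega> x) \<in> ?N \<rightarrow>\<^sub>M borel" for x
    using measurable_component_singleton[of x UNIV "\<lambda>_. \<mu>"] measurable_cong_sets[OF refl sets_\<mu>, of ?N] by simp
  have cookie: "(\<lambda>\<omega>. \<omega> x i) \<in> borel_measurable ?N" for x i
  proof -
    have "(\<lambda>v :: nat \<Rightarrow> real. v i) \<in> borel_measurable borel"
      by (intro borel_measurable_continuous_onI continuous_on_product_coordinates)
    from measurable_compose[OF coord this] show ?thesis .
  qed
  have cl: "clamp_env \<in> ?N \<rightarrow>\<^sub>M env_space"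
  proof (rule measurable_env_spaceI)
    note [measurable] = cookie
    show "(\<lambda>\<omega>. clamp_env \<omega> x i) \<in> borel_measurable ?N" for x i unfolding clamp_env_def by measurable
  qed (simp add: clamp_env_def)
  have PN: "P = distr ?N env_space clamp_env"
  proof -
    have m: "(\<lambda>\<omega>. \<omega>) \<in> P \<rightarrow>\<^sub>M ?N"
      unfolding measurable_cong_sets[OF refl sets_N]
      by (rule measurable_PiM_single') (auto simp: stack)
    have "?N = (\<Pi>\<^sub>M x\<in>UNIV. distr P borel (\<lambda>\<omega>. \<omega> x))"
      unfolding \<mu>_def using \<open>IID P\<close> by (intro PiM_cong) (auto simp: IID_def)
    also have "\<dots> = distr P (\<Pi>\<^sub>M x\<in>UNIV. borel) (\<lambda>\<omega>. \<lambda>x\<in>UNIV. \<omega> x)"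
      using \<open>IID P\<close> P.indep_vars_iff_distr_eq_PiM[of UNIV "\<lambda>x \<omega>. \<omega> x" "\<lambda>_. borel"] stack
      by (simp add: IID_def)
    also have "\<dots> = distr P ?N (\<lambda>\<omega>. \<omega>)"
      by (rule distr_cong) (auto simp: sets_N)
    finally have N_eq: "?N = distr P ?N (\<lambda>\<omega>. \<omega>)" .
    have "distr ?N env_space clamp_env = distr (distr P ?N (\<lambda>\<omega>. \<omega>)) env_space clamp_env" using N_eq by simp
    also have "\<dots> = distr P env_space (clamp_env \<circ> (\<lambda>\<omega>. \<omega>))" by (rule distr_distr[OF cl m])
    also have "\<dots> = distr P P (\<lambda>\<omega>. \<omega>)"
      by (rule distr_cong) (auto simp: sets_P clamp_env_id space_P)
    also have "\<dots> = P" by (rule distr_id)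
    finally show ?thesis ..
  qed
  have emP: "emeasure P B = emeasure ?N (clamp_env -` B)" and Bs: "clamp_env -` B \<in> sets ?N" if "B \<in> sets P" for B
  proof -
    have B: "B \<in> sets env_space" using that sets_P by simp
    show "clamp_env -` B \<in> sets ?N" using measurable_sets[OF cl B] by (simp add: space_N)
    show "emeasure P B = emeasure ?N (clamp_env -` B)"
      by (subst PN) (simp add: emeasure_distr[OF cl B] space_N)
  qed
  have sh: "env_shift \<in> ?N \<rightarrow>\<^sub>M ?N"
    unfolding env_shift_def
    by (rule measurable_PiM_single') (use measurable_component_singleton[of _ UNIV "\<lambda>_. \<mu>"] in \<open>auto simp: \<mu>_def\<close>)
  have dsh: "distr ?N ?N env_shift = ?N"
  proof -
    have "inj (\<lambda>x :: int. x + 1)" by (simp add: inj_def)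
    from distr_PiM_reindex_map[OF \<mu> this, of "\<lambda>v. v"] show ?thesis
      by (simp add: env_shift_def[abs_def] distr_id)
  qed
  show ?thesis
  proof (rule admissible.intro)
    show "prob_space P" "sets P = sets env_space" by fact+
    have "distr P P env_shift = distr P env_space env_shift" by (rule distr_cong) (auto simp: sets_P)
    also have "\<dots> = distr (distr ?N env_space clamp_env) env_space env_shift" using PN by simp
    also have "\<dots> = distr ?N env_space (env_shift \<circ> clamp_env)" by (rule distr_distr[OF env_shift_measurable cl])
    also have "env_shift \<circ> clamp_env = clamp_env \<circ> env_shift" by (auto simp: env_shift_def clamp_env_def)
    also have "distr ?N env_space (clamp_env \<circ> env_shift) = distr (distr ?N ?N env_shift) env_space clamp_env"
      by (rule distr_distr[OF cl sh, symmetric])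
    also have "\<dots> = P" using PN dsh by simp
    finally show "distr P P env_shift = P" .
    show "measure P A \<in> {0, 1}" if A: "A \<in> sets P" and tail: "right_tail A \<or> left_tail A" for A
    proof -
      have "u(x := v) \<in> clamp_env -` A \<longleftrightarrow> u \<in> clamp_env -` A" for u x v
      proof -
        have same: "clamp_env (u(x := v)) y = clamp_env u y" if "y \<noteq> x" for y using that by (simp add: clamp_env_def)
        from tail show ?thesis
        proof
          assume "right_tail A"
          moreover have "\<forall>y\<ge>x + 1. clamp_env (u(x := v)) y = clamp_env u y" using same by simp
          ultimately show ?thesis unfolding right_tail_def vimage_eq using clamp_env_space by blast
        next
          assume "left_tail A"
          moreover have "\<forall>y\<le>x - 1. clamp_env (u(x := v)) y = clamp_env u y" using same by simp
          ultimately show ?thesis unfolding left_tail_def vimage_eq using clamp_env_space by blast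
        qed
      qed
      then have "measure ?N (clamp_env -` A) \<in> {0, 1}" by (intro PiM_zero_one[OF \<mu> Bs[OF A]])
      then show ?thesis using emP[OF A] by (simp add: measure_def)
    qed
    obtain m where m: "AE \<omega> in P. \<forall>x. \<forall>i\<ge>m. \<omega> x i = 1/2" using \<open>BD P\<close> unfolding BD_def by blast
    show "ND P"
      unfolding ND_def using m
    proof eventually_elim
      case (elim \<omega>)
      show ?case
      proof
        fix x
        have h: "\<omega> x i = 1/2" "1 - \<omega> x i = 1/2" if "i \<ge> m" for i using elim that by auto
        have "(\<Sum>i. ennreal (\<omega> x i)) = \<infinity>" by (rule suminf_eventually_half[of m]) (simp only: h)
        moreover have "(\<Sum>i. ennreal (1 - \<omega> x i)) = \<infinity>" by (rule suminf_eventually_half[of m]) (simp only: h(2))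
        ultimately show "(\<Sum>i. ennreal (\<omega> x i)) = \<infinity> \<and> (\<Sum>i. ennreal (1 - \<omega> x i)) = \<infinity>" ..
      qed
    qed
    fix B assume B: "B \<in> sets P" and pos: "measure P B > 0"
      and local: "\<And>\<omega> \<omega>'. \<omega> \<in> space env_space \<Longrightarrow> \<omega>' \<in> space env_space \<Longrightarrow> (\<And>x. x \<noteq> 0 \<Longrightarrow> x \<noteq> 1 \<Longrightarrow> \<omega> x = \<omega>' x) \<Longrightarrow> \<omega> \<in> B \<longleftrightarrow> \<omega>' \<in> B"
    let ?G = free_env
    have G: "?G \<in> sets P" by measurable
    \<comment> \<open>Stacks at 0 and 1 that allow left and right arrows, respectively.\<close>
    define I where "I x = (if x = (0 :: int) then {v. \<forall>i. v i < (1 :: real)} else {v. \<forall>i. (v :: nat \<Rightarrow> real) i > 0})" for x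
    have Is: "I x \<in> sets \<mu>" for x
    proof -
      have [measurable]: "(\<lambda>v :: nat \<Rightarrow> real. v i) \<in> borel_measurable borel" for i
        by (intro borel_measurable_continuous_onI continuous_on_product_coordinates)
      have "{v \<in> space borel. \<forall>i. (v :: nat \<Rightarrow> real) i < 1} \<in> sets borel" "{v \<in> space borel. \<forall>i. (v :: nat \<Rightarrow> real) i > 0} \<in> sets borel"
        by measurable
      then show ?thesis by (simp add: I_def sets_\<mu>)
    qed
    have Ipos: "emeasure \<mu> (I x) \<noteq> 0" for x
    proof -
      have "emeasure \<mu> (I x) = emeasure P ((\<lambda>\<omega>. \<omega> 0) -` I x \<inter> space P)"
        unfolding \<mu>_def by (rule emeasure_distr[OF stack]) (use Is in \<open>simp add: sets_\<mu>\<close>)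
      also have "(\<lambda>\<omega>. \<omega> 0) -` I x \<inter> space P = (if x = 0 then {\<omega> \<in> space P. \<forall>i. \<omega> 0 i < 1} else {\<omega> \<in> space P. \<forall>i. \<omega> 0 i > 0})"
        by (auto simp: I_def)
      finally show ?thesis using \<open>WEL P\<close> by (auto simp: WEL_def P.emeasure_eq_measure dest!: spec[of _ 0])
    qed
    have "clamp_env -` (B \<inter> ?G) = clamp_env -` B \<inter> {u \<in> space ?N. \<forall>x\<in>{0, 1}. u x \<in> I x}"
    proof -
      have "clamp_env u 0 i < 1 \<longleftrightarrow> u 0 i < 1" "clamp_env u 1 i > 0 \<longleftrightarrow> u 1 i > 0" for u i
        by (auto simp: clamp_env_def)
      then show ?thesis by (auto simp: I_def clamp_env_space space_P space_N)
    qed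
    moreover have "emeasure ?N (clamp_env -` B \<inter> {u \<in> space ?N. \<forall>x\<in>{0, 1}. u x \<in> I x}) = emeasure ?N (clamp_env -` B) * (\<Prod>x\<in>{0, 1}. emeasure \<mu> (I x))"
    proof (rule emeasure_PiM_Int_finite_box[OF \<mu> Bs[OF B]])
      fix u v and x :: int assume "x \<in> {0, 1}"
      then have "clamp_env (u(x := v)) y = clamp_env u y" if "y \<noteq> 0" "y \<noteq> 1" for y using that by (auto simp: clamp_env_def)
      then show "(u(x := v) \<in> clamp_env -` B) = (u \<in> clamp_env -` B)"
        unfolding vimage_eq by (intro local clamp_env_space)
    qed (use Is in auto)
    moreover have "emeasure ?N (clamp_env -` B) \<noteq> 0" using pos emP[OF B] by (auto simp: measure_def)
    ultimately have "emeasure P (B \<inter> ?G) \<noteq> 0"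
      using emP[of "B \<inter> ?G"] B G Ipos by simp
    then show "measure P (B \<inter> ?G) > 0"
      by (simp add: P.emeasure_eq_measure zero_less_measure_iff)
  qed
qed

lemma distr_unif_reflect: "distr unif unif (\<lambda>v. 1 - v) = unif"
proof (rule measure_eqI)
  fix A assume "A \<in> sets (distr unif unif (\<lambda>v. 1 - v))"
  then have A: "A \<in> sets borel" by simp
  have m: "(\<lambda>v :: real. 1 - v) \<in> unif \<rightarrow>\<^sub>M unif" by (simp cong: measurable_cong_sets)
  have pre: "(\<lambda>v. 1 - v) -` A \<in> sets borel" 
    using measurable_sets[of "\<lambda>v :: real. 1 - v" borel borel A] A by simp
  have L: "lborel = distr lborel borel (\<lambda>x :: real. 1 + (- 1) * x)"
    using lborel_real_affine[of "- 1" 1] by (simp add: density_1)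
  have "emeasure (distr unif unif (\<lambda>v. 1 - v)) A = emeasure unif ((\<lambda>v. 1 - v) -` A)"
    using A by (subst emeasure_distr[OF m]) auto
  also have "\<dots> = emeasure lborel ({0..1} \<inter> (\<lambda>v. 1 - v) -` A)" using pre by (simp add: divide_ennreal_def)
  also have "{0..1} \<inter> (\<lambda>v. 1 - v) -` A = (\<lambda>x :: real. 1 + (- 1) * x) -` ({0..1} \<inter> A)" by auto
  also have "emeasure lborel \<dots> = emeasure (distr lborel borel (\<lambda>x :: real. 1 + (- 1) * x)) ({0..1} \<inter> A)"
    using A by (subst emeasure_distr) auto
  also have "\<dots> = emeasure unif A" using A by (simp only: L[symmetric]) (simp add: divide_ennreal_def)
  finally show "emeasure (distr unif unif (\<lambda>v. 1 - v)) A = emeasure unif A" .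
qed simp

text \<open>
  The environment in which the walks that follow a recurrent one find themselves.
\<close>

abbreviation fair :: env where "fair \<equiv> (\<lambda>x i. 1/2)"

lemma fair_space: "fair \<in> space env_space"
  by (simp add: space_env_space)

lemma admissible_fair: "admissible (return env_space fair)"
proof (rule admissible.intro)
  let ?P = "return env_space fair"
  show "prob_space ?P" by (rule prob_space_return[OF fair_space])
  show "sets ?P = sets env_space" by simp
  have "distr ?P ?P env_shift = distr ?P env_space env_shift" by (rule distr_cong) auto
  also have "\<dots> = ?P" by (subst distr_return[OF env_shift_measurable fair_space]) (simp add: env_shift_def)
  finally show "distr ?P ?P env_shift = ?P" .
  show "measure ?P A \<in> {0, 1}" if "A \<in> sets ?P" for A
    using that by (simp add: measure_return indicator_def)
  have "Measurable.pred env_space (\<lambda>\<omega>. \<forall>x. (\<Sum>i. ennreal (\<omega> x i)) = \<infinity> \<and> (\<Sum>i. ennreal (1 - \<omega> x i)) = \<infinity>)"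
    by measurable
  then show "ND ?P" unfolding ND_def
    using suminf_eventually_half[of 0 "\<lambda>_. ennreal (1/2)"] by (subst AE_return[OF fair_space]) simp_all
  fix B assume B: "B \<in> sets ?P" "measure ?P B > 0"
  have "free_env \<in> sets env_space" by measurable
  then have G: "free_env \<in> sets ?P" by simp
  show "measure ?P (B \<inter> free_env) > 0"
    using B G by (subst measure_return) (auto simp: measure_return indicator_def fair_space split: if_splits)
qed

text \<open>
  Reflecting the sites and replacing every seed \<open>v\<close> by \<open>1 - v\<close> reflects the arrows, so escapes to the
  right and to the left have the same probability. By \<open>not_both_escape\<close> it is not 1.
\<close>

lemma fair_arrows:
  "AE u in seed_measure. balanced (seed_arrows f (fair, u)) \<and> \<not> escapes 1 (seed_arrows f (fair, u)) 0 \<and>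
     \<not> escapes 1 (reflect (seed_arrows f (fair, u))) 0"
proof -
  interpret admissible "return env_space fair" by (rule admissible_fair)
  let ?a = "\<lambda>u. seed_arrows f (fair, u)"
  have half: "AE u in seed_measure. \<phi> (fair, u)" if "AE s in Q. \<phi> s" for \<phi>
  proof -
    have "AE \<omega> in return env_space fair. AE u in seed_measure. \<phi> (\<omega>, u)" by (rule PS.AE_pair[OF that])
    then obtain N where N: "{\<omega> \<in> space (return env_space fair). \<not> (AE u in seed_measure. \<phi> (\<omega>, u))} \<subseteq> N"
      "emeasure (return env_space fair) N = 0" "N \<in> sets (return env_space fair)" by (rule AE_E)
    then have "fair \<notin> N" by (simp add: indicator_eq_0_iff)
    then show ?thesis using N(1) fair_space by auto
  qed
  \<comment> \<open>The image of the seeds under reflection; ties at \<open>1/2\<close> would spoil it, but are negligible.\<close>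
  define \<rho> where "\<rho> u = (\<lambda>l. 1 - u (case l of (g, x, i) \<Rightarrow> (g, - x, i)) :: real)" for u :: "seed_index \<Rightarrow> real"
  have i: "inj (\<lambda>(g, x, j). (g :: nat, - x :: int, j :: nat))" by (auto simp: inj_def)
  have \<rho>: "distr seed_measure seed_measure \<rho> = seed_measure" "\<rho> \<in> seed_measure \<rightarrow>\<^sub>M seed_measure"
    using distr_seed_measure_reindex[OF i _ distr_unif_reflect]
      measurable_seed_measure_reindex[of "\<lambda>v. 1 - v" "\<lambda>(g, x, j). (g :: nat, - x :: int, j :: nat)"]
    by (simp_all add: \<rho>_def[abs_def])
  have "AE u in seed_measure. u l \<noteq> 1/2" for l :: seed_index
  proof -
    have "emeasure seed_measure {u :: seed_index \<Rightarrow> real. \<forall>i\<in>{l}. u i \<in> {1/2}} = 0"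
      by (subst emeasure_seed_box) auto
    moreover have "{u :: seed_index \<Rightarrow> real. u l = 1/2} \<in> sets seed_measure"
      using measurable_sets[OF measurable_seed, of "{1/2}" l] by (simp add: vimage_def)
    ultimately have "{u :: seed_index \<Rightarrow> real. u l = 1/2} \<in> null_sets seed_measure" by (auto simp: null_sets_def)
    then show ?thesis using AE_not_in by fastforce
  qed
  then have "AE u in seed_measure. \<forall>l. (u :: seed_index \<Rightarrow> real) l \<noteq> 1/2" by (simp add: AE_all_countable)
  then have refl: "AE u in seed_measure. ?a (\<rho> u) = reflect (?a u)"
  proof eventually_elim
    case (elim u)
    have "(1 - u l < 1/2) = (\<not> u l < 1/2)" for l using elim[rule_format, of l] by auto
    then show ?case by (simp add: seed_arrows_def reflect_def \<rho>_def fun_eq_iff)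
  qed
  have swap: "AE u in seed_measure. \<phi> (reflect (?a u))" if "AE u in seed_measure. \<phi> (?a u)" for \<phi>
  proof -
    have "AE u in seed_measure. \<phi> (?a (\<rho> u))"
      by (rule AE_distrD[OF \<rho>(2)]) (subst \<rho>(1), rule that)
    with refl show ?thesis by eventually_elim simp
  qed
  have "AE s in Q. \<not> escapes 1 (seed_arrows f s) 0"
  proof (rule ccontr)
    assume "\<not> ?thesis"
    then have "AE s in Q. escapes 1 (seed_arrows f s) 0"
      using escapes_zero_one[of 1 True f] by (simp add: orient_def)
    then have 1: "AE u in seed_measure. escapes 1 (?a u) 0" by (rule half)
    have "AE s in Q. escapes 1 (reflect (seed_arrows f s)) 0"
    proof (rule ccontr)
      assume "\<not> ?thesis"
      then have "AE s in Q. \<not> escapes 1 (reflect (seed_arrows f s)) 0" 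
        using escapes_zero_one[of 1 False f] by (simp add: orient_def)
      then have "AE u in seed_measure. \<not> escapes 1 (reflect (?a u)) 0" by (rule half)
      with swap[OF 1] have "AE u in (seed_measure :: (seed_index \<Rightarrow> real) measure). False" by eventually_elim simp
      then show False by simp
    qed
    with \<open>AE s in Q. escapes 1 (seed_arrows f s) 0\<close> show False using not_both_escape by blast
  qed
  then have 1: "AE u in seed_measure. \<not> escapes 1 (?a u) 0" by (rule half)
  show ?thesis using half[OF AE_balanced[of f]] 1 swap[OF 1] by eventually_elim simp
qed

section \<open>All the walks\<close>

definition orient_count :: "bool \<Rightarrow> (int \<Rightarrow> nat) \<Rightarrow> int \<Rightarrow> nat" where
  "orient_count r c = (if r then c else (\<lambda>x. c (- x)))"

definition escape_filter :: "bool \<Rightarrow> int filter" where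
  "escape_filter r = (if r then at_top else at_bot)"

lemma drop_arrows_orient: "drop_arrows (orient_count r c) (orient r a) = orient r (drop_arrows c a)"
  by (simp add: orient_def orient_count_def drop_arrows_reflect)

lemma total_used_orient: "total_used (orient r a) (orient_count r c) = orient_count r (total_used a c)"
  by (auto simp: orient_def orient_count_def total_used_reflect)

lemma recurrent_orient: "recurrent (arrow_walk (orient r a)) \<longleftrightarrow> recurrent (arrow_walk a)"
  by (simp add: orient_def recurrent_reflect)

lemma at_top_orient: "filterlim (arrow_walk (orient r a)) at_top sequentially \<longleftrightarrow> filterlim (arrow_walk a) (escape_filter r) sequentially"
  by (simp add: orient_def escape_filter_def at_top_reflect)

lemma transient_at_top: "filterlim Y at_top sequentially \<Longrightarrow> transient Y"
  unfolding transient_def using finite_visits_at_top by blast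

lemma transient_orient: "transient (arrow_walk (orient r a)) \<longleftrightarrow> transient (arrow_walk a)"
proof -
  have "{n. arrow_walk (reflect a) n = x} = {n. arrow_walk a n = - x}" for x
    by (auto simp: arrow_walk_reflect)
  then have "transient (arrow_walk (reflect a)) \<longleftrightarrow> transient (arrow_walk a)"
    unfolding transient_def by (metis minus_minus)
  then show ?thesis by (simp add: orient_def)
qed

lemma escapes_0: "escapes 0 a x"
proof -
  have "returns 0 a d x = 0" for d
    by (induction d arbitrary: x) (simp_all add: failures_def hit_def)
  then show ?thesis by (simp add: escapes_def)
qed

text \<open>
  All the walks so far were transient, so that the cookies and the seeds are the original ones with the
  first \<open>c x\<close> of them removed at every site \<open>x\<close>.
\<close>

definition main_phase :: "env \<times> (seed_index \<Rightarrow> real) \<Rightarrow> nat \<Rightarrow> (int \<Rightarrow> nat) \<Rightarrow> bool" where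
  "main_phase s j c \<longleftrightarrow> fst (snd (stage j s)) = 0 \<and> snd (snd (stage j s)) = c \<and>
     (\<forall>x i. fst (stage j s) x i = fst s x (c x + i))"

lemma stage_walk_main_phase:
  "main_phase s j c \<Longrightarrow> stage_walk j s = arrow_walk (drop_arrows c (seed_arrows 0 s))"
  by (simp add: main_phase_def stage_walk_def arrows_of_def drop_arrows_def[abs_def] seed_arrows_def)

lemma main_phase_Suc:
  assumes "main_phase s j c" "transient (stage_walk j s)"
  shows "main_phase s (Suc j) (total_used (seed_arrows 0 s) c)"
  using assms(2) stage_walk_main_phase[OF assms(1)] assms(1)
  by (auto simp: main_phase_def next_stage_def stage_walk_def leftover_def total_used_def visits_def add_ac)

lemma stage_after_not_transient:
  "\<not> transient (stage_walk j s) \<Longrightarrow> \<exists>f. stage (Suc j) s = (fair, f, \<lambda>_. 0)"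
  by (simp add: next_stage_def stage_walk_def leftover_def)

lemma recurrent_not_transient: "recurrent Y \<Longrightarrow> \<not> transient Y"
  by (simp add: recurrent_def transient_def)

lemma recurrent_if_no_escape:
  assumes "balanced a" "\<not> escapes 1 a 0" "\<not> escapes 1 (reflect a) 0"
  shows "recurrent (arrow_walk a)"
proof -
  have "drop_arrows (\<lambda>_. 0) a = a" by (simp add: drop_arrows_def[abs_def])
  then show ?thesis using next_walk_after_right(2)[OF assms(1) after_right_0 assms(3)] assms(2) by simp
qed

context
  fixes s :: "env \<times> (seed_index \<Rightarrow> real)" and r :: bool
  assumes bal: "balanced (seed_arrows 0 s)"
    and no_escape: "\<not> escapes 1 (orient (\<not> r) (seed_arrows 0 s)) 0"
    and fair_recurrent: "\<And>f. recurrent (arrow_walk (seed_arrows f (fair, snd s)))"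
begin

private abbreviation (input) "a \<equiv> orient r (seed_arrows 0 s)"

text \<open>
  By induction every one of the first \<open>j\<close> walks escapes, as \<^prop>\<open>escapes j a 0\<close> becomes weaker when \<open>j\<close> decreases.
\<close>

lemma main_phase_escapes:
  assumes "escapes j a 0"
  shows "\<exists>c. main_phase s j c \<and> after_right a j (orient_count r c)"
  using assms
proof (induction j)
  case 0
  have "main_phase s 0 (\<lambda>_. 0)" by (simp add: main_phase_def)
  moreover have "after_right a 0 (orient_count r (\<lambda>_. 0))" by (simp add: orient_count_def after_right_0)
  ultimately show ?case by blast
next
  case (Suc j)
  have b: "balanced a" using bal by (simp add: balanced_orient)
  have "escapes j a 0" using escapes_antimono[OF b, of j "Suc j"] Suc.prems by simp
  then obtain c where c: "main_phase s j c" "after_right a j (orient_count r c)" using Suc.IH by blast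
  have "filterlim (arrow_walk (drop_arrows (orient_count r c) a)) at_top sequentially \<and>
      after_right a (Suc j) (total_used a (orient_count r c))"
    by (rule next_walk_after_right(1)[OF b c(2) _ Suc.prems]) (use no_escape in \<open>simp add: reflect_orient\<close>)
  then have "transient (stage_walk j s)" "after_right a (Suc j) (orient_count r (total_used (seed_arrows 0 s) c))"
    using transient_at_top transient_orient
    by (auto simp: drop_arrows_orient total_used_orient stage_walk_main_phase[OF c(1)])
  then show ?case using main_phase_Suc[OF c(1)] by blast
qed

lemma stage_walk_escapes:
  assumes "escapes (Suc j) a 0"
  shows "filterlim (stage_walk j s) (escape_filter r) sequentially"
proof -
  have b: "balanced a" using bal by (simp add: balanced_orient)
  have "escapes j a 0" using escapes_antimono[OF b, of j "Suc j"] assms by simp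
  then obtain c where c: "main_phase s j c" "after_right a j (orient_count r c)" using main_phase_escapes by blast
  have "filterlim (arrow_walk (drop_arrows (orient_count r c) a)) at_top sequentially"
    using next_walk_after_right(1)[OF b c(2) _ assms] no_escape by (simp add: reflect_orient)
  then show ?thesis by (simp add: drop_arrows_orient at_top_orient stage_walk_main_phase[OF c(1)])
qed

lemma stage_walk_recurrent_main:
  assumes "escapes j a 0" "\<not> escapes (Suc j) a 0"
  shows "recurrent (stage_walk j s)"
proof -
  have b: "balanced a" using bal by (simp add: balanced_orient)
  obtain c where c: "main_phase s j c" "after_right a j (orient_count r c)" using main_phase_escapes assms(1) by blast
  have "recurrent (arrow_walk (drop_arrows (orient_count r c) a))"
    using next_walk_after_right(2)[OF b c(2) _ assms(2)] no_escape by (simp add: reflect_orient)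
  then show ?thesis by (simp add: drop_arrows_orient recurrent_orient stage_walk_main_phase[OF c(1)])
qed

text \<open>
  Either the previous walks were all transient and this is the first walk that does not escape, or the
  previous walk was recurrent and this one runs in the fair environment with fresh seeds.
\<close>

lemma stage_walk_recurrent:
  assumes "\<not> escapes (Suc j) a 0"
  shows "recurrent (stage_walk j s)"
  using assms
proof (induction j)
  case (Suc j)
  show ?case
  proof (cases "escapes (Suc j) a 0")
    case True
    then show ?thesis using Suc.prems by (rule stage_walk_recurrent_main)
  next
    case False
    then have "\<not> transient (stage_walk j s)" using Suc.IH recurrent_not_transient by blast
    then obtain f where f: "stage (Suc j) s = (fair, f, \<lambda>_. 0)" using stage_after_not_transient by blast
    have "stage_walk (Suc j) s = arrow_walk (seed_arrows f (fair, snd s))"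
      unfolding stage_walk_def f by (simp add: arrows_of_def seed_arrows_def)
    then show ?thesis using fair_recurrent by simp
  qed
qed (rule stage_walk_recurrent_main, rule escapes_0)

end

lemma pred_recurrent: "Measurable.pred path_space recurrent"
proof -
  have "recurrent = (\<lambda>Y. \<forall>x. \<forall>N. \<exists>n. n \<ge> N \<and> Y n = x)"
    by (simp add: fun_eq_iff recurrent_def infinite_visits_iff)
  moreover have "Measurable.pred path_space (\<lambda>Y :: path. \<forall>x. \<forall>N. \<exists>n. n \<ge> N \<and> Y n = x)" by measurable
  ultimately show ?thesis by (simp only:)
qed

lemma pred_filterlim_escape_filter: "Measurable.pred path_space (\<lambda>Y. filterlim Y (escape_filter r) sequentially)"
proof -
  have "(\<lambda>Y :: path. filterlim Y at_top sequentially) = (\<lambda>Y. \<forall>Z. \<exists>N. \<forall>n. n \<ge> N \<longrightarrow> Z \<le> Y n)"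
    "(\<lambda>Y :: path. filterlim Y at_bot sequentially) = (\<lambda>Y. \<forall>Z. \<exists>N. \<forall>n. n \<ge> N \<longrightarrow> Y n \<le> Z)"
    by (simp_all only: filterlim_at_top filterlim_at_bot eventually_sequentially)
  moreover have [measurable]: "Measurable.pred path_space (\<lambda>Y. Z \<le> Y n)" "Measurable.pred path_space (\<lambda>Y. Y n \<le> Z)" for Z n
    by (rule measurable_compose[OF measurable_path_coord]; simp)+
  ultimately show ?thesis unfolding escape_filter_def by (cases r) simp_all
qed

text \<open>
  The direction \<open>r\<close> is chosen such that no walker escapes in the opposite direction.
\<close>

lemma (in admissible) walks_dichotomy:
  obtains r where "\<And>j. AE s in Q. escapes (Suc j) (orient r (seed_arrows 0 s)) 0 \<Longrightarrow> AE s in Q. filterlim (stage_walk j s) (escape_filter r) sequentially"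
    "\<And>j. AE s in Q. \<not> escapes (Suc j) (orient r (seed_arrows 0 s)) 0 \<Longrightarrow> AE s in Q. recurrent (stage_walk j s)"
proof -
  have "\<exists>r. AE s in Q. \<not> escapes 1 (orient (\<not> r) (seed_arrows 0 s)) 0"
  proof (rule ccontr)
    assume no: "\<not> ?thesis"
    have "AE s in Q. escapes 1 (orient r (seed_arrows 0 s)) 0" for r
    proof -
      have "\<not> (AE s in Q. \<not> escapes 1 (orient (\<not> (\<not> r)) (seed_arrows 0 s)) 0)" using no by blast
      then show ?thesis using escapes_zero_one[of 1 r 0] by simp
    qed
    from this[of True] this[of False] show False
      using not_both_escape[of 0] by (simp add: orient_def)
  qed
  then obtain r where r: "AE s in Q. \<not> escapes 1 (orient (\<not> r) (seed_arrows 0 s)) 0" by blast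
  have fair: "AE s in Q. \<forall>f. recurrent (arrow_walk (seed_arrows f (fair, snd s)))"
  proof -
    have "AE u in seed_measure. recurrent (arrow_walk (seed_arrows f (fair, u)))" for f
      using fair_arrows[of f] by eventually_elim (blast intro: recurrent_if_no_escape)
    moreover have "Measurable.pred Q (\<lambda>s. recurrent (arrow_walk (seed_arrows f (fair, snd s))))" for f
    proof -
      have "Measurable.pred Q (\<lambda>s. seed_arrows f (fair, snd s) x i)" for x i
      proof -
        have [measurable]: "(\<lambda>s. snd s l) \<in> borel_measurable Q" for l
          using measurable_compose[OF measurable_snd measurable_seed] .
        show ?thesis by (simp add: seed_arrows_def)
      qed
      from measurable_compose[OF measurable_arrow_walk[OF this] pred_recurrent] show ?thesis .
    qed
    ultimately have "AE s in Q. recurrent (arrow_walk (seed_arrows f (fair, snd s)))" for f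
      by (intro PS.AE_pair_measure) (simp_all only: pred_def snd_conv eventually_const, simp)
    then show ?thesis by (simp add: AE_all_countable)
  qed
  show ?thesis
  proof (rule that)
    fix j
    show "AE s in Q. filterlim (stage_walk j s) (escape_filter r) sequentially"
      if "AE s in Q. escapes (Suc j) (orient r (seed_arrows 0 s)) 0"
      using AE_balanced[of 0] r fair that by eventually_elim (rule stage_walk_escapes, auto)
    show "AE s in Q. recurrent (stage_walk j s)"
      if "AE s in Q. \<not> escapes (Suc j) (orient r (seed_arrows 0 s)) 0"
      using AE_balanced[of 0] r fair that by eventually_elim (rule stage_walk_recurrent, auto)
  qed
qed

theorem theorem1p1:
  fixes P :: "env measure"
  assumes "prob_space P" and "sets P = sets env_space"
    and "(SE P \<and> ELL P \<and> ND P) \<or> (IID P \<and> WEL P \<and> BD P)"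
  shows "\<exists>R\<in>extended_ints. \<forall>M. annealed_law P M \<longrightarrow>
           (\<forall>k::nat. k \<ge> 1 \<longrightarrow>
              (ereal (real k) > \<bar>R\<bar> \<longrightarrow> (AE z in M. recurrent (walk k z))) \<and>
              (ereal (real k) \<le> \<bar>R\<bar> \<and> R > 0 \<longrightarrow>
                 (AE z in M. filterlim (walk k z) at_top sequentially)) \<and>
              (ereal (real k) \<le> \<bar>R\<bar> \<and> R < 0 \<longrightarrow>
                 (AE z in M. filterlim (walk k z) at_bot sequentially)))"
proof -
  have "admissible P"
    using assms admissibleI_SE admissibleI_IID by blast
  then interpret admissible P .
  obtain r where esc: "\<And>j. AE s in Q. escapes (Suc j) (orient r (seed_arrows 0 s)) 0 \<Longrightarrow> AE s in Q. filterlim (stage_walk j s) (escape_filter r) sequentially"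
    and rec: "\<And>j. AE s in Q. \<not> escapes (Suc j) (orient r (seed_arrows 0 s)) 0 \<Longrightarrow> AE s in Q. recurrent (stage_walk j s)"
    using walks_dichotomy by blast
  \<comment> \<open>\<open>K\<close> is an initial segment of the natural numbers; \<open>R\<close> is its supremum up to the sign.\<close>
  define K where "K = {k. AE s in Q. escapes k (orient r (seed_arrows 0 s)) 0}"
  define N :: ereal where "N = (SUP k\<in>K. ereal (real k))"
  have K0: "0 \<in> K" by (simp add: K_def escapes_0)
  have down: "k \<in> K" if "l \<in> K" "k \<le> l" for k l
  proof -
    from that(1) have "AE s in Q. escapes l (orient r (seed_arrows 0 s)) 0" by (simp add: K_def)
    with AE_balanced[of 0] have "AE s in Q. escapes k (orient r (seed_arrows 0 s)) 0"
      by eventually_elim (rule escapes_antimono[OF _ that(2)], simp_all add: balanced_orient)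
    then show ?thesis by (simp add: K_def)
  qed
  have N0: "N \<ge> 0" unfolding N_def using K0 by (intro SUP_upper2[of 0]) auto
  have K_iff: "k \<in> K \<longleftrightarrow> ereal (real k) \<le> N" for k
  proof
    show "k \<in> K \<Longrightarrow> ereal (real k) \<le> N" unfolding N_def by (rule SUP_upper)
    assume k: "ereal (real k) \<le> N"
    show "k \<in> K"
    proof (rule ccontr)
      assume "k \<notin> K"
      then have lt: "l < k" if "l \<in> K" for l using down[OF that] by (meson not_le)
      then have "N \<le> ereal (real (k - 1))" unfolding N_def by (intro SUP_least) (use lt in fastforce)
      moreover have "k > 0" using lt[OF K0] .
      ultimately have "ereal (real k) \<le> ereal (real (k - 1))" using k by (meson order_trans)
      with \<open>k > 0\<close> show False by simp
    qed
  qed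
  have N_cases: "N \<in> range (\<lambda>m::nat. ereal (real m)) \<union> {\<infinity>}"
  proof (cases "finite K")
    case True
    have "N = ereal (real (Max K))"
      unfolding N_def
      by (rule antisym[OF SUP_least SUP_upper]) (use True K0 Max_ge Max_in in auto)
    then show ?thesis by blast
  next
    case False
    have "N = \<infinity>"
    proof (rule ereal_top)
      fix B
      obtain n :: nat where n: "B < real n" using reals_Archimedean2 by blast
      obtain k where "k \<in> K" "n \<le> k" using False by (auto simp: infinite_nat_iff_unbounded_le)
      then have "ereal (real n) \<le> N" using K_iff down by blast
      then show "ereal B \<le> N" using n by (meson ereal_less_eq(3) less_imp_le order_trans)
    qed
    then show ?thesis by blast
  qed
  define R where "R = (if r then N else - N)"
  have absR: "\<bar>R\<bar> = N" using N0 by (simp add: R_def)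
  have "R \<in> extended_ints"
  proof (cases "N = \<infinity>")
    case False
    then obtain m :: nat where "N = ereal (real m)" using N_cases by blast
    then have "R = ereal (of_int (if r then int m else - int m))" by (simp add: R_def)
    then show ?thesis unfolding extended_ints_def by blast
  qed (simp add: R_def extended_ints_def)
  moreover have "(ereal (real k) > \<bar>R\<bar> \<longrightarrow> (AE z in M. recurrent (walk k z))) \<and>
              (ereal (real k) \<le> \<bar>R\<bar> \<and> R > 0 \<longrightarrow>
                 (AE z in M. filterlim (walk k z) at_top sequentially)) \<and>
              (ereal (real k) \<le> \<bar>R\<bar> \<and> R < 0 \<longrightarrow>
                 (AE z in M. filterlim (walk k z) at_bot sequentially))"
    if M: "annealed_law P M" and k: "k \<ge> 1" for M and k :: nat
  proof -
    obtain j where j: "k = Suc j" using k by (cases k) auto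
    note transfer = AE_annealed_lawI[OF assms(1,2) M]
    have 1: "AE z in M. recurrent (walk k z)" if "ereal (real k) > N"
    proof -
      have "k \<notin> K" using that K_iff by (simp add: not_le)
      then have "AE s in Q. \<not> escapes (Suc j) (orient r (seed_arrows 0 s)) 0" using escapes_zero_one[of k r 0] j by (auto simp: K_def)
      then show ?thesis unfolding j by (intro transfer rec pred_recurrent)
    qed
    have 2: "AE z in M. filterlim (walk k z) (escape_filter r) sequentially" if "ereal (real k) \<le> N"
    proof -
      have "AE s in Q. escapes (Suc j) (orient r (seed_arrows 0 s)) 0" using that K_iff j by (simp add: K_def)
      then show ?thesis unfolding j by (intro transfer esc pred_filterlim_escape_filter)
    qed
    have 3: "r" if "R > 0" using that N0 by (auto simp: R_def split: if_splits)
    have 4: "\<not> r" if "R < 0" using that N0 by (auto simp: R_def)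
    show ?thesis using 1 2 3 4 unfolding absR by (auto simp: escape_filter_def)
  qed
  ultimately show ?thesis by blast
qed

end
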